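(* Let $\Gamma$ be a finitely generated group and let $(\Omega,\mu)$ be a standard Borel probability $\Gamma$-space. Let $\sigma_1,\sigma_2:\Gamma\times\Omega\to \mathrm{Homeo}^+(\mathbb{S}^1)$ be two measurable cocycles. Then the following hold: (1) Suppose that $\sigma_1$ and $\sigma_2$ are semicohomologous and that $\sigma_1$ admits an equivariant family of points. Then $\sigma_2$ also admits an equivariant family of points and $\mathrm{H}^2_b(\sigma_1)(e^b_{\mathbb{Z}})=\mathrm{H}^2_b(\sigma_2)(e^b_{\mathbb{Z}})=0$ in $\mathrm{H}^2_b(\Gamma;\mathrm{L}^\infty(\Omega,\mathbb{Z}))$. (2) If $\mathrm{H}^2_b(\sigma_1)(e^b_{\mathbb{Z}})=\mathrm{H}^2_b(\sigma_2)(e^b_{\mathbb{Z}})$, then $\sigma_1$ and $\sigma_2$ are semicohomologous. (3) Assume that $\Omega$ is $\Gamma$-ergodic. Suppose that $\sigma_1$ does not admit any equivariant family of points and that $\sigma_1$ is left semicohomologous to $\sigma_2$. Then $\mathrm{H}^2_b(\sigma_1)(e^b_{\mathbb{Z}})=\mathrm{H}^2_b(\sigma_2)(e^b_{\mathbb{Z}})\neq 0$.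
   Context: A standard Borel probability $\Gamma$-space is a standard Borel probability space $(\Omega,\mu)$ with an essentially free, measure preserving action of $\Gamma$. Put $H=\mathrm{Homeo}^+(\mathbb{S}^1)$, the group of orientation preserving homeomorphisms of $\mathbb{S}^1\cong\mathbb{R}/\mathbb{Z}$, with the Borel structure of the compact-open topology. A measurable cocycle is a measurable map $\sigma:\Gamma\times\Omega\to H$ with $\sigma(\gamma_1\gamma_2,\omega)=\sigma(\gamma_1,\gamma_2\omega)\sigma(\gamma_2,\omega)$ for every $\gamma_1,\gamma_2\in\Gamma$ and almost every $\omega\in\Omega$. Equivariant family of points for $\sigma$: a measurable map $r:\Omega\to\mathbb{S}^1$ with $r(\gamma\omega)=\sigma(\gamma,\omega)r(\omega)$ for every $\gamma\in\Gamma$ and almost every $\omega\in\Omega$. A non-decreasing degree one map $\mathbb{S}^1\to\mathbb{S}^1$ is a (not necessarily continuous) map that weakly preserves the cyclic order of every $k$-tuple of points, for every $k\in\mathbb{N}$; equivalently, it has a lift $\mathbb{R}\to\mathbb{R}$ that is non-decreasing and commutes with integer translations (constant maps are allowed). Semicohomology: $\sigma_1$ is left semicohomologous to $\sigma_2$ (equivalently, $\sigma_2$ is right semicohomologous to $\sigma_1$) if there is a measurable map $\varphi:\mathbb{S}^1\times\Omega\to\mathbb{S}^1$ such that $\varphi(\omega):=\varphi(\cdot,\omega)$ is a non-decreasing degree one map for almost every $\omega$ and $\sigma_1(\gamma,\omega)\varphi(\omega)=\varphi(\gamma\omega)\sigma_2(\gamma,\omega)$ for every $\gamma\in\Gamma$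 and almost every $\omega\in\Omega$. $\sigma_1$ and $\sigma_2$ are semicohomologous if $\sigma_1$ is both left and right semicohomologous to $\sigma_2$. Bounded cohomology: for a discrete group $G$ and a normed $G$-module $A$ with isometric action, $\mathrm{H}^n_b(G;A)$ is the cohomology of the inhomogeneous complex of bounded functions $\overline{\mathrm{C}}^n_b(G;A)=\{f:G^n\to A \text{ bounded}\}$ with coboundary $(\overline\delta f)(g_1,\dots,g_{n+1})=g_1\cdot f(g_2,\dots,g_{n+1})+\sum_{i=1}^n(-1)^if(g_1,\dots,g_ig_{i+1},\dots,g_{n+1})+(-1)^{n+1}f(g_1,\dots,g_n)$. All groups, including $H$, are regarded as discrete here. $\mathbb{Z}$ is a trivial $H$-module; $\mathrm{L}^\infty(\Omega,\mathbb{Z})$ has the sup norm and the action $(\gamma f)(\omega)=f(\gamma^{-1}\omega)$. Bounded Euler class: let $\widetilde H=\mathrm{Homeo}^+_{\mathbb{Z}}(\mathbb{R})$ be the group of orientation preserving homeomorphisms $f$ of $\mathbb{R}$ with $f(x+1)=f(x)+1$, $i:\mathbb{Z}\to\widetilde H$ the inclusion as integer translations, $p:\widetilde H\to H$ the projection, and $\overline s:H\to\widetilde H$ the section of $p$ determined by $\overline s(f)(0)\in[0,1)$. Then $\overline\varepsilon:H^2\to\mathbb{Z}$ defined by $\overline s(fg)\,i(\overline\varepsilon(f,g))=\overline s(f)\overline s(g)$ is a bounded cocycle and $e^b_{\mathbb{Z}}=[\overline\varepsilon]\in\mathrm{H}^2_b(H;\mathbb{Z})$. Parametrized Euler class: for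 a measurable cocycle $\sigma$, $\mathrm{H}^2_b(\sigma):\mathrm{H}^2_b(H;\mathbb{Z})\to\mathrm{H}^2_b(\Gamma;\mathrm{L}^\infty(\Omega,\mathbb{Z}))$ is induced by $\psi\mapsto\big[(\gamma,\lambda)\mapsto\big(\omega\mapsto\psi(\sigma(\gamma^{-1},\omega)^{-1},\sigma(\lambda^{-1},\gamma^{-1}\omega)^{-1})\big)\big]$, and the $\Omega$-parametrized Euler class of $\sigma$ is $\mathrm{H}^2_b(\sigma)(e^b_{\mathbb{Z}})$. *)

theory Defs
  imports
    "HOL-Probability.Probability_Measure"
    "HOL-Algebra.QuotRing"
    "HOL-Algebra.IntRing"
    "HOL-Algebra.Group_Action"
    "HOL-Algebra.Generated_Groups"
begin

section \<open>The circle and maps of the circle\<close>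

quotient_type circle = real / "\<lambda>x y :: real. x - y \<in> \<int>"
  morphisms rep_circle to_circle
proof (rule equivpI)
  show "reflp (\<lambda>x y :: real. x - y \<in> \<int>)"
    by (simp add: reflp_def)
  show "symp (\<lambda>x y :: real. x - y \<in> \<int>)"
    by (metis (no_types, lifting) Ints_minus minus_diff_eq sympI)
  show "transp (\<lambda>x y :: real. x - y \<in> \<int>)"
    by (metis (no_types, lifting) Ints_add diff_add_cancel add_diff_eq transpI)
qed

instantiation circle :: topological_space
begin

definition open_circle :: "circle set \<Rightarrow> bool"
  where "open_circle U \<longleftrightarrow> open (to_circle -` U)"

instance
proof
  show "open (UNIV :: circle set)"
    by (simp add: open_circle_def)
  show "open (S \<inter> T)" if "open S" "open T" for S T :: "circle set"
    using that by (simp add: open_circle_def vimage_Int open_Int)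
  show "open (\<Union>K)" if "\<forall>S\<in>K. open S" for K :: "circle set set"
    using that by (auto simp: open_circle_def vimage_Union)
qed

end

definition is_lift :: "(real \<Rightarrow> real) \<Rightarrow> (circle \<Rightarrow> circle) \<Rightarrow> bool"
  where "is_lift F f \<longleftrightarrow> f \<circ> to_circle = to_circle \<circ> F"

text \<open>A tuple is weakly cyclically ordered if, going once around the circle in the positive
  direction, its entries are met in the given order; repetitions are allowed.\<close>

definition weakly_cyclic :: "circle list \<Rightarrow> bool"
  where "weakly_cyclic xs \<longleftrightarrow>
    (\<exists>ts. map to_circle ts = xs \<and> sorted ts \<and> (ts \<noteq> [] \<longrightarrow> last ts \<le> hd ts + 1))"

definition nondecreasing_degree_one :: "(circle \<Rightarrow> circle) \<Rightarrow> bool"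
  where "nondecreasing_degree_one f \<longleftrightarrow> (\<forall>xs. weakly_cyclic xs \<longrightarrow> weakly_cyclic (map f xs))"

lemma to_circle_eq_iff: "to_circle s = to_circle t \<longleftrightarrow> s - t \<in> \<int>"
  by (rule circle.abs_eq_iff)

lemma to_circle_surj: "\<exists>t. to_circle t = x"
  by (rule circle.abs_induct[of _ x]) blast

lemma nondecreasing_degree_one_iff_lift:
  "nondecreasing_degree_one f \<longleftrightarrow>
    (\<exists>F. mono F \<and> (\<forall>t. F (t + 1) = F t + 1) \<and> is_lift F f)"
proof
  assume "\<exists>F. mono F \<and> (\<forall>t. F (t + 1) = F t + 1) \<and> is_lift F f"
  then obtain F where F: "mono F" "\<And>t. F (t + 1) = F t + 1" "is_lift F f"
    by blast
  from F(3) have lift: "f (to_circle t) = to_circle (F t)" for t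
    by (auto simp: is_lift_def fun_eq_iff)
  show "nondecreasing_degree_one f"
    unfolding nondecreasing_degree_one_def
  proof (intro allI impI)
    fix xs assume "weakly_cyclic xs"
    then obtain ts where ts: "map to_circle ts = xs" "sorted ts" "ts \<noteq> [] \<longrightarrow> last ts \<le> hd ts + 1"
      by (auto simp: weakly_cyclic_def)
    have "map to_circle (map F ts) = map f xs"
      using ts(1) by (auto simp: lift)
    moreover have "sorted (map F ts)"
      using ts(2) F(1) by (simp add: sorted_wrt_map sorted_wrt_mono_rel[of ts "(\<le>)"] monoD)
    moreover have "last (map F ts) \<le> hd (map F ts) + 1" if "map F ts \<noteq> []"
    proof -
      have "F (last ts) \<le> F (hd ts + 1)"
        using ts(3) that F(1) by (auto intro: monoD)
      then show ?thesis
        using that F(2) by (simp add: last_map hd_map)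
    qed
    ultimately show "weakly_cyclic (map f xs)"
      unfolding weakly_cyclic_def by blast
  qed
next
  assume nd: "nondecreasing_degree_one f"
  obtain c where c: "to_circle c = f (to_circle 0)"
    using to_circle_surj by blast
  have key: "\<exists>a b d. c \<le> a \<and> a \<le> b \<and> b \<le> d \<and> d \<le> c + 1 \<and> to_circle a = f (to_circle s) \<and>
      to_circle b = f (to_circle t) \<and> to_circle d = f (to_circle r)"
    if "0 \<le> s" "s \<le> t" "t \<le> r" "r < 1" for s t r
  proof -
    have "weakly_cyclic (map to_circle [0, s, t, r])"
      unfolding weakly_cyclic_def using that by (intro exI[of _ "[0, s, t, r]"]) auto
    then have "weakly_cyclic (map f (map to_circle [0, s, t, r]))"
      using nd unfolding nondecreasing_degree_one_def by blast
    then obtain us where us: "map to_circle us = map f (map to_circle [0, s, t, r])" "sorted us"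
        "us \<noteq> [] \<longrightarrow> last us \<le> hd us + 1"
      unfolding weakly_cyclic_def by blast
    then obtain p a b d where us_eq: "us = [p, a, b, d]"
      by (auto simp: map_eq_Cons_conv)
    then have "to_circle p = to_circle c"
      using us(1) c by simp
    then have int: "p - c \<in> \<int>"
      by (simp add: to_circle_eq_iff)
    have "to_circle (z - (p - c)) = to_circle z" for z
      using Ints_minus[OF int] by (simp add: to_circle_eq_iff)
    then show ?thesis
      using us unfolding us_eq
      by (intro exI[of _ "a - (p - c)"] exI[of _ "b - (p - c)"] exI[of _ "d - (p - c)"]) auto
  qed
  have uex: "\<exists>v. to_circle v = f (to_circle t) \<and> c \<le> v \<and> v < c + 1" for t
  proof -
    obtain w where w: "to_circle w = f (to_circle t)"
      using to_circle_surj by blast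
    have "to_circle (c + frac (w - c)) = to_circle w"
      by (simp add: to_circle_eq_iff frac_def)
    then show ?thesis
      using w frac_lt_1[of "w - c"] by (intro exI[of _ "c + frac (w - c)"]) auto
  qed
  define u where "u t = (SOME v. to_circle v = f (to_circle t) \<and> c \<le> v \<and> v < c + 1)" for t
  have u: "to_circle (u t) = f (to_circle t)" "c \<le> u t" "u t < c + 1" for t
    using someI_ex[OF uex[of t]] unfolding u_def by auto
  have uniq: "a = u t \<or> a = c + 1 \<and> u t = c"
    if a: "to_circle a = f (to_circle t)" "c \<le> a" "a \<le> c + 1" for a t
  proof -
    have "a - u t \<in> \<int>"
      using a(1) u(1)[of t] by (metis to_circle_eq_iff)
    then obtain k :: int where k: "a - u t = of_int k"
      by (auto elim: Ints_cases)
    have "of_int k < (2 :: real)" "of_int k > (-1 :: real)"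
      using k a u[of t] by linarith+
    then have "k = 0 \<or> k = 1"
      by linarith
    then show ?thesis
      using k a u[of t] by auto
  qed
  define F0 where "F0 t = (if u t = c \<and> (\<exists>s. 0 \<le> s \<and> s < t \<and> u s \<noteq> c) then c + 1 else u t)" for t
  have F0_lift: "to_circle (F0 t) = f (to_circle t)" for t
  proof -
    have "to_circle (c + 1) = to_circle c"
      by (simp add: to_circle_eq_iff)
    then show ?thesis
      using u(1)[of t] by (auto simp: F0_def)
  qed
  have F0_bounds: "c \<le> F0 t" "F0 t \<le> c + 1" for t
    using u[of t] by (auto simp: F0_def)
  have F0_0: "F0 0 = c"
    using uniq[OF c] by (auto simp: F0_def)
  have F0_mono: "F0 s \<le> F0 t" if st: "0 \<le> s" "s \<le> t" "t < 1" for s t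
  proof (cases "u s = c \<and> (\<exists>r. 0 \<le> r \<and> r < s \<and> u r \<noteq> c)")
    case True
    then obtain r where r: "0 \<le> r" "r < s" "u r \<noteq> c"
      by blast
    obtain a b d where abd: "c \<le> a" "a \<le> b" "b \<le> d" "d \<le> c + 1" "to_circle a = f (to_circle r)"
        "to_circle b = f (to_circle s)" "to_circle d = f (to_circle t)"
      using key[of r s t] r st by auto
    have "a = u r"
      using uniq[of a r] abd r(3) by auto
    then have "b \<noteq> c"
      using abd(1,2) r(3) by auto
    then have "b = c + 1"
      using uniq[of b s] abd True by auto
    then have "d = c + 1"
      using abd by auto
    then have "u t = c"
      using uniq[of d t] abd u(3)[of t] by auto
    moreover have "r < t"
      using r(2) st(2) by simp
    ultimately have "F0 t = c + 1"
      using r by (auto simp: F0_def)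
    then show ?thesis
      using F0_bounds by simp
  next
    case False
    then have s: "F0 s = u s"
      by (auto simp: F0_def)
    show ?thesis
    proof (cases "u s = c")
      case True
      then show ?thesis
        using s F0_bounds by simp
    next
      case us: False
      show ?thesis
      proof (cases "u t = c")
        case True
        then have "s < t"
          using us st(2) by (cases "s = t") auto
        then have "F0 t = c + 1"
          using True us st(1) by (auto simp: F0_def)
        then show ?thesis
          using F0_bounds by simp
      next
        case ut: False
        obtain a b d where abd: "c \<le> a" "a \<le> b" "b \<le> d" "d \<le> c + 1" "to_circle a = f (to_circle s)"
            "to_circle b = f (to_circle t)" "to_circle d = f (to_circle t)"
          using key[of s t t] st by auto
        have "a = u s" "b = u t"
          using uniq[of a s] uniq[of b t] abd us ut by auto
        then show ?thesis
          using abd s ut by (auto simp: F0_def)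
      qed
    qed
  qed
  define F where "F t = F0 (frac t) + of_int \<lfloor>t\<rfloor>" for t
  have "mono F"
  proof (rule monoI)
    fix s t :: real assume st: "s \<le> t"
    show "F s \<le> F t"
    proof (cases "\<lfloor>s\<rfloor> = \<lfloor>t\<rfloor>")
      case True
      then have "frac s \<le> frac t"
        using st by (simp add: frac_def)
      then show ?thesis
        using True F0_mono[of "frac s" "frac t"] by (simp add: F_def frac_lt_1)
    next
      case False
      then have "\<lfloor>s\<rfloor> + 1 \<le> \<lfloor>t\<rfloor>"
        using floor_mono[OF st] by simp
      then have "real_of_int \<lfloor>s\<rfloor> + 1 \<le> real_of_int \<lfloor>t\<rfloor>"
        by linarith
      then show ?thesis
        using F0_bounds(1)[of "frac t"] F0_bounds(2)[of "frac s"] by (simp add: F_def)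
    qed
  qed
  moreover have "F (t + 1) = F t + 1" for t
    by (simp add: F_def frac_def)
  moreover have "is_lift F f"
  proof -
    have "f (to_circle t) = to_circle (F t)" for t
    proof -
      have "to_circle (frac t) = to_circle t" "to_circle (F t) = to_circle (F0 (frac t))"
        by (simp_all add: to_circle_eq_iff frac_def F_def)
      then show ?thesis
        using F0_lift[of "frac t"] by simp
    qed
    then show ?thesis
      by (simp add: is_lift_def fun_eq_iff)
  qed
  ultimately show "\<exists>F. mono F \<and> (\<forall>t. F (t + 1) = F t + 1) \<and> is_lift F f"
    by blast
qed

definition homeo_Z_real :: "(real \<Rightarrow> real) set"
  where "homeo_Z_real =
    {F. (\<exists>G. homeomorphism UNIV UNIV F G) \<and> strict_mono F \<and> (\<forall>x. F (x + 1) = F x + 1)}"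

text \<open>A homeomorphism of the circle preserves the orientation iff it lifts to an orientation
  preserving homeomorphism of the line.\<close>

definition homeo_circle :: "(circle \<Rightarrow> circle) set"
  where "homeo_circle =
    {f. (\<exists>g. homeomorphism UNIV UNIV f g) \<and> (\<exists>F\<in>homeo_Z_real. is_lift F f)}"

definition homeo_group :: "(circle \<Rightarrow> circle) monoid"
  where "homeo_group = \<lparr>carrier = homeo_circle, mult = (\<circ>), one = id\<rparr>"

definition compact_open_topology :: "('a::topological_space \<Rightarrow> 'b::topological_space) topology"
  where "compact_open_topology =
    topology_generated_by {{f. f ` K \<subseteq> U} | K U. compact K \<and> open U}"

definition homeo_borel :: "(circle \<Rightarrow> circle) measure"
  where "homeo_borel =
    sigma homeo_circle {U. openin (subtopology compact_open_topology homeo_circle) U}"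

section \<open>Probability spaces with a group action, and cocycles\<close>

definition finitely_generated :: "('g, 'm) monoid_scheme \<Rightarrow> bool"
  where "finitely_generated G \<longleftrightarrow> (\<exists>S. finite S \<and> S \<subseteq> carrier G \<and> generate G S = carrier G)"

definition standard_borel :: "'w measure \<Rightarrow> bool"
  where "standard_borel M \<longleftrightarrow>
    (\<exists>X. completely_metrizable_space X \<and> second_countable X \<and> topspace X = space M \<and>
         sets M = sigma_sets (space M) {U. openin X U})"

locale standard_borel_prob_gspace =
  group_action \<Gamma> "space M" act + prob_space M
  for \<Gamma> :: "('g, 'm) monoid_scheme" (structure) and M :: "'w measure" and act :: "'g \<Rightarrow> 'w \<Rightarrow> 'w" +
  assumes standard: "standard_borel M"
    and act_measurable: "\<gamma> \<in> carrier \<Gamma> \<Longrightarrow> act \<gamma> \<in> measurable M M"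
    and act_preserving: "\<gamma> \<in> carrier \<Gamma> \<Longrightarrow> distr M M (act \<gamma>) = M"
    and essentially_free: "AE \<omega> in M. \<forall>\<gamma>\<in>carrier \<Gamma>. \<gamma> \<noteq> \<one> \<longrightarrow> act \<gamma> \<omega> \<noteq> \<omega>"

definition ergodic_action ::
    "('g, 'm) monoid_scheme \<Rightarrow> 'w measure \<Rightarrow> ('g \<Rightarrow> 'w \<Rightarrow> 'w) \<Rightarrow> bool"
  where "ergodic_action \<Gamma> M act \<longleftrightarrow>
    (\<forall>A\<in>sets M. (\<forall>\<gamma>\<in>carrier \<Gamma>. act \<gamma> -` A \<inter> space M = A) \<longrightarrow>
      measure M A = 0 \<or> measure M A = 1)"

definition measurable_cocycle ::
    "('g, 'm) monoid_scheme \<Rightarrow> 'w measure \<Rightarrow> ('g \<Rightarrow> 'w \<Rightarrow> 'w) \<Rightarrow> ('g \<Rightarrow> 'w \<Rightarrow> circle \<Rightarrow> circle) \<Rightarrow> bool"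
  where "measurable_cocycle \<Gamma> M act \<sigma> \<longleftrightarrow>
    (\<lambda>(\<gamma>, \<omega>). \<sigma> \<gamma> \<omega>) \<in> measurable (count_space (carrier \<Gamma>) \<Otimes>\<^sub>M M) homeo_borel \<and>
    (\<forall>\<gamma>\<^sub>1\<in>carrier \<Gamma>. \<forall>\<gamma>\<^sub>2\<in>carrier \<Gamma>. AE \<omega> in M.
      \<sigma> (\<gamma>\<^sub>1 \<otimes>\<^bsub>\<Gamma>\<^esub> \<gamma>\<^sub>2) \<omega> = \<sigma> \<gamma>\<^sub>1 (act \<gamma>\<^sub>2 \<omega>) \<circ> \<sigma> \<gamma>\<^sub>2 \<omega>)"

definition equivariant_family ::
    "('g, 'm) monoid_scheme \<Rightarrow> 'w measure \<Rightarrow> ('g \<Rightarrow> 'w \<Rightarrow> 'w) \<Rightarrow> ('g \<Rightarrow> 'w \<Rightarrow> circle \<Rightarrow> circle) \<Rightarrow>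
      ('w \<Rightarrow> circle) \<Rightarrow> bool"
  where "equivariant_family \<Gamma> M act \<sigma> r \<longleftrightarrow>
    r \<in> measurable M borel \<and>
    (\<forall>\<gamma>\<in>carrier \<Gamma>. AE \<omega> in M. r (act \<gamma> \<omega>) = \<sigma> \<gamma> \<omega> (r \<omega>))"

definition left_semicohomologous ::
    "('g, 'm) monoid_scheme \<Rightarrow> 'w measure \<Rightarrow> ('g \<Rightarrow> 'w \<Rightarrow> 'w) \<Rightarrow> ('g \<Rightarrow> 'w \<Rightarrow> circle \<Rightarrow> circle) \<Rightarrow>
      ('g \<Rightarrow> 'w \<Rightarrow> circle \<Rightarrow> circle) \<Rightarrow> bool"
  where "left_semicohomologous \<Gamma> M act \<sigma>\<^sub>1 \<sigma>\<^sub>2 \<longleftrightarrow>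
    (\<exists>\<phi>. \<phi> \<in> measurable (borel \<Otimes>\<^sub>M M) borel \<and>
      (AE \<omega> in M. nondecreasing_degree_one (\<lambda>x. \<phi> (x, \<omega>))) \<and>
      (\<forall>\<gamma>\<in>carrier \<Gamma>. AE \<omega> in M.
        \<sigma>\<^sub>1 \<gamma> \<omega> \<circ> (\<lambda>x. \<phi> (x, \<omega>)) = (\<lambda>x. \<phi> (x, act \<gamma> \<omega>)) \<circ> \<sigma>\<^sub>2 \<gamma> \<omega>))"

definition right_semicohomologous ::
    "('g, 'm) monoid_scheme \<Rightarrow> 'w measure \<Rightarrow> ('g \<Rightarrow> 'w \<Rightarrow> 'w) \<Rightarrow> ('g \<Rightarrow> 'w \<Rightarrow> circle \<Rightarrow> circle) \<Rightarrow>
      ('g \<Rightarrow> 'w \<Rightarrow> circle \<Rightarrow> circle) \<Rightarrow> bool"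
  where "right_semicohomologous \<Gamma> M act \<sigma>\<^sub>2 \<sigma>\<^sub>1 \<longleftrightarrow> left_semicohomologous \<Gamma> M act \<sigma>\<^sub>1 \<sigma>\<^sub>2"

definition semicohomologous ::
    "('g, 'm) monoid_scheme \<Rightarrow> 'w measure \<Rightarrow> ('g \<Rightarrow> 'w \<Rightarrow> 'w) \<Rightarrow> ('g \<Rightarrow> 'w \<Rightarrow> circle \<Rightarrow> circle) \<Rightarrow>
      ('g \<Rightarrow> 'w \<Rightarrow> circle \<Rightarrow> circle) \<Rightarrow> bool"
  where "semicohomologous \<Gamma> M act \<sigma>\<^sub>1 \<sigma>\<^sub>2 \<longleftrightarrow>
    left_semicohomologous \<Gamma> M act \<sigma>\<^sub>1 \<sigma>\<^sub>2 \<and> right_semicohomologous \<Gamma> M act \<sigma>\<^sub>1 \<sigma>\<^sub>2"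

section \<open>Bounded cohomology\<close>

text \<open>A normed \<open>G\<close>-module is given by the additive group of a ring record \<open>A\<close>, an action \<open>act\<close> of
  \<open>G\<close> on \<open>A\<close> and a norm \<open>nrm\<close>; the multiplication of \<open>A\<close> plays no role. The tuple
  \<open>(g\<^sub>1, \<dots>, g\<^sub>n)\<close> is the list \<open>[g\<^sub>1, \<dots>, g\<^sub>n]\<close>, and cochains are extensional functions, so that
  equality of cochains is equality on \<open>G\<^sup>n\<close>.\<close>

definition tuples :: "('g, 'm) monoid_scheme \<Rightarrow> nat \<Rightarrow> 'g list set"
  where "tuples G n = {gs. length gs = n \<and> set gs \<subseteq> carrier G}"

definition bounded_cochains ::
    "('g, 'm) monoid_scheme \<Rightarrow> ('a, 'k) ring_scheme \<Rightarrow> ('a \<Rightarrow> real) \<Rightarrow> nat \<Rightarrow> ('g list \<Rightarrow> 'a) set"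
  where "bounded_cochains G A nrm n =
    {f \<in> tuples G n \<rightarrow>\<^sub>E carrier A. \<exists>C. \<forall>gs\<in>tuples G n. nrm (f gs) \<le> C}"

definition cochain_group ::
    "('g, 'm) monoid_scheme \<Rightarrow> ('a, 'k) ring_scheme \<Rightarrow> ('a \<Rightarrow> real) \<Rightarrow> nat \<Rightarrow> ('g list \<Rightarrow> 'a) monoid"
  where "cochain_group G A nrm n =
    \<lparr>carrier = bounded_cochains G A nrm n,
     mult = (\<lambda>f h. \<lambda>gs\<in>tuples G n. f gs \<oplus>\<^bsub>A\<^esub> h gs),
     one = (\<lambda>gs\<in>tuples G n. \<zero>\<^bsub>A\<^esub>)\<rparr>"

text \<open>Multiplies the \<open>i\<close>-th and the \<open>(i+1)\<close>-st entry, counting from 1.\<close>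

definition merge_at :: "('g, 'm) monoid_scheme \<Rightarrow> nat \<Rightarrow> 'g list \<Rightarrow> 'g list"
  where "merge_at G i gs = take (i - 1) gs @ [gs ! (i - 1) \<otimes>\<^bsub>G\<^esub> gs ! i] @ drop (i + 1) gs"

definition coboundary ::
    "('g, 'm) monoid_scheme \<Rightarrow> ('a, 'k) ring_scheme \<Rightarrow> ('g \<Rightarrow> 'a \<Rightarrow> 'a) \<Rightarrow> nat \<Rightarrow> ('g list \<Rightarrow> 'a) \<Rightarrow>
      'g list \<Rightarrow> 'a"
  where "coboundary G A act n f = (\<lambda>gs\<in>tuples G (n + 1).
    act (hd gs) (f (tl gs)) \<oplus>\<^bsub>A\<^esub>
    (\<Oplus>\<^bsub>A\<^esub>i\<in>{1..n}. [((-1) ^ i :: int)] \<cdot>\<^bsub>A\<^esub> f (merge_at G i gs)) \<oplus>\<^bsub>A\<^esub>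
    [((-1) ^ (n + 1) :: int)] \<cdot>\<^bsub>A\<^esub> f (butlast gs))"

definition bounded_cocycles ::
    "('g, 'm) monoid_scheme \<Rightarrow> ('a, 'k) ring_scheme \<Rightarrow> ('g \<Rightarrow> 'a \<Rightarrow> 'a) \<Rightarrow> ('a \<Rightarrow> real) \<Rightarrow> nat \<Rightarrow>
      ('g list \<Rightarrow> 'a) set"
  where "bounded_cocycles G A act nrm n =
    kernel (cochain_group G A nrm n) (cochain_group G A nrm (n + 1)) (coboundary G A act n)"

definition bounded_coboundaries ::
    "('g, 'm) monoid_scheme \<Rightarrow> ('a, 'k) ring_scheme \<Rightarrow> ('g \<Rightarrow> 'a \<Rightarrow> 'a) \<Rightarrow> ('a \<Rightarrow> real) \<Rightarrow> nat \<Rightarrow>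
      ('g list \<Rightarrow> 'a) set"
  where "bounded_coboundaries G A act nrm n =
    (case n of
       0 \<Rightarrow> {\<one>\<^bsub>cochain_group G A nrm 0\<^esub>}
     | Suc m \<Rightarrow> coboundary G A act m ` bounded_cochains G A nrm m)"

text \<open>Groups of the group library being written multiplicatively, the zero class is
  \<open>\<one>\<^bsub>bounded_cohomology G A act nrm n\<^esub>\<close>.\<close>

definition bounded_cohomology ::
    "('g, 'm) monoid_scheme \<Rightarrow> ('a, 'k) ring_scheme \<Rightarrow> ('g \<Rightarrow> 'a \<Rightarrow> 'a) \<Rightarrow> ('a \<Rightarrow> real) \<Rightarrow> nat \<Rightarrow>
      ('g list \<Rightarrow> 'a) set monoid"
  where "bounded_cohomology G A act nrm n =
    cochain_group G A nrm n \<lparr>carrier := bounded_cocycles G A act nrm n\<rparr> Mod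
      bounded_coboundaries G A act nrm n"

definition cohomology_class ::
    "('g, 'm) monoid_scheme \<Rightarrow> ('a, 'k) ring_scheme \<Rightarrow> ('g \<Rightarrow> 'a \<Rightarrow> 'a) \<Rightarrow> ('a \<Rightarrow> real) \<Rightarrow> nat \<Rightarrow>
      ('g list \<Rightarrow> 'a) \<Rightarrow> ('g list \<Rightarrow> 'a) set"
  where "cohomology_class G A act nrm n f =
    bounded_coboundaries G A act nrm n
      #>\<^bsub>cochain_group G A nrm n \<lparr>carrier := bounded_cocycles G A act nrm n\<rparr>\<^esub> f"

section \<open>The coefficient module of essentially bounded integer valued functions\<close>

definition ess_bounded_ring :: "'w measure \<Rightarrow> ('w \<Rightarrow> int) ring"
  where "ess_bounded_ring M =
    \<lparr>carrier = {f \<in> measurable M (count_space UNIV). \<exists>C. AE \<omega> in M. \<bar>f \<omega>\<bar> \<le> C},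
     mult = (\<lambda>f g \<omega>. f \<omega> * g \<omega>), one = (\<lambda>\<omega>. 1),
     zero = (\<lambda>\<omega>. 0), add = (\<lambda>f g \<omega>. f \<omega> + g \<omega>)\<rparr>"

definition null_ideal :: "'w measure \<Rightarrow> ('w \<Rightarrow> int) set"
  where "null_ideal M = {f \<in> carrier (ess_bounded_ring M). AE \<omega> in M. f \<omega> = 0}"

definition Linf_ring :: "'w measure \<Rightarrow> ('w \<Rightarrow> int) set ring"
  where "Linf_ring M = ess_bounded_ring M Quot null_ideal M"

definition Linf_class :: "'w measure \<Rightarrow> ('w \<Rightarrow> int) \<Rightarrow> ('w \<Rightarrow> int) set"
  where "Linf_class M f = null_ideal M +>\<^bsub>ess_bounded_ring M\<^esub> f"

definition Linf_norm :: "'w measure \<Rightarrow> ('w \<Rightarrow> int) set \<Rightarrow> real"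
  where "Linf_norm M X = Inf {C. 0 \<le> C \<and> (\<exists>f\<in>X. AE \<omega> in M. \<bar>real_of_int (f \<omega>)\<bar> \<le> C)}"

definition Linf_act ::
    "('g, 'm) monoid_scheme \<Rightarrow> 'w measure \<Rightarrow> ('g \<Rightarrow> 'w \<Rightarrow> 'w) \<Rightarrow> 'g \<Rightarrow> ('w \<Rightarrow> int) set \<Rightarrow>
      ('w \<Rightarrow> int) set"
  where "Linf_act \<Gamma> M act \<gamma> X =
    the_elem ((\<lambda>f. Linf_class M (\<lambda>\<omega>. f (act (inv\<^bsub>\<Gamma>\<^esub> \<gamma>) \<omega>))) ` X)"

definition Linf_H2b ::
    "('g, 'm) monoid_scheme \<Rightarrow> 'w measure \<Rightarrow> ('g \<Rightarrow> 'w \<Rightarrow> 'w) \<Rightarrow> ('g list \<Rightarrow> ('w \<Rightarrow> int) set) set monoid"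
  where "Linf_H2b \<Gamma> M act =
    bounded_cohomology \<Gamma> (Linf_ring M) (Linf_act \<Gamma> M act) (Linf_norm M) 2"

section \<open>The bounded Euler class and its pullback\<close>

definition translation :: "int \<Rightarrow> real \<Rightarrow> real"
  where "translation n = (\<lambda>x. x + of_int n)"

definition lift_section :: "(circle \<Rightarrow> circle) \<Rightarrow> real \<Rightarrow> real"
  where "lift_section f = (THE F. F \<in> homeo_Z_real \<and> is_lift F f \<and> F 0 \<in> {0..<1})"

definition euler_cocycle :: "(circle \<Rightarrow> circle) list \<Rightarrow> int"
  where "euler_cocycle = (\<lambda>fs\<in>tuples homeo_group 2.
    (THE n. lift_section (fs ! 0 \<circ> fs ! 1) \<circ> translation n =
            lift_section (fs ! 0) \<circ> lift_section (fs ! 1)))"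

definition bounded_euler_class :: "((circle \<Rightarrow> circle) list \<Rightarrow> int) set"
  where "bounded_euler_class =
    cohomology_class homeo_group \<Z> (\<lambda>_ k. k) (\<lambda>k. \<bar>real_of_int k\<bar>) 2 euler_cocycle"

definition pullback_cochain ::
    "('g, 'm) monoid_scheme \<Rightarrow> 'w measure \<Rightarrow> ('g \<Rightarrow> 'w \<Rightarrow> 'w) \<Rightarrow> ('g \<Rightarrow> 'w \<Rightarrow> circle \<Rightarrow> circle) \<Rightarrow>
      ((circle \<Rightarrow> circle) list \<Rightarrow> int) \<Rightarrow> 'g list \<Rightarrow> ('w \<Rightarrow> int) set"
  where "pullback_cochain \<Gamma> M act \<sigma> \<psi> = (\<lambda>gs\<in>tuples \<Gamma> 2.
    let \<gamma> = gs ! 0; \<eta> = gs ! 1 in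
    Linf_class M (\<lambda>\<omega>. \<psi>
      [inv\<^bsub>homeo_group\<^esub> (\<sigma> (inv\<^bsub>\<Gamma>\<^esub> \<gamma>) \<omega>),
       inv\<^bsub>homeo_group\<^esub> (\<sigma> (inv\<^bsub>\<Gamma>\<^esub> \<eta>) (act (inv\<^bsub>\<Gamma>\<^esub> \<gamma>) \<omega>))]))"

text \<open>The pullback of a bounded cocycle takes values in measurable functions only if the cocycle
  is measurable along \<open>\<sigma>\<close>, so the induced map is computed on Borel representatives (the
  Euler cocycle is one). The result does not depend on the representative: if \<open>b\<close> is bounded and
  \<open>\<delta> b = \<beta>\<close> is Borel, then \<open>b g = lim (\<Sum>i=1..<n. \<beta> (g\<^sup>i, g)) / n\<close>, so \<open>b\<close> is Borel.\<close>

definition H2b_pullback ::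
    "('g, 'm) monoid_scheme \<Rightarrow> 'w measure \<Rightarrow> ('g \<Rightarrow> 'w \<Rightarrow> 'w) \<Rightarrow> ('g \<Rightarrow> 'w \<Rightarrow> circle \<Rightarrow> circle) \<Rightarrow>
      ((circle \<Rightarrow> circle) list \<Rightarrow> int) set \<Rightarrow> ('g list \<Rightarrow> ('w \<Rightarrow> int) set) set"
  where "H2b_pullback \<Gamma> M act \<sigma> c =
    the_elem
      ((\<lambda>\<psi>. cohomology_class \<Gamma> (Linf_ring M) (Linf_act \<Gamma> M act) (Linf_norm M) 2
              (pullback_cochain \<Gamma> M act \<sigma> \<psi>)) `
       {\<psi> \<in> c. (\<lambda>(f, g). \<psi> [f, g]) \<in> measurable (homeo_borel \<Otimes>\<^sub>M homeo_borel) (count_space UNIV)})"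

end

theory Submission
  imports Defs
begin

text \<open>Write \<open>F \<gamma> \<omega>\<close> for the normalised lift of \<open>\<tau>(\<gamma>, \<omega>) = \<sigma>(\<gamma>\<inverse>, \<omega>)\<inverse>\<close>. These lifts compose along the
  action up to the pulled back Euler cocycle \<open>e\<close>. A primitive \<open>u\<close> of the difference \<open>e\<^sub>1 - e\<^sub>2\<close>
  corrects \<open>F\<^sub>1\<close> so that both families have the same defect, and then
  \<open>sup\<^sub>\<gamma> F\<^sub>1 \<gamma> \<omega> \<circ> (F\<^sub>2 \<gamma> \<omega>)\<inverse>\<close> is a non-decreasing degree one semiconjugacy (Ghys); with the trivial
  family instead of \<open>F\<^sub>2\<close> it produces an equivariant point. Conversely an equivariant point, or a
  semiconjugacy whose lift is unique up to an integer, gives \<open>u\<close> as the integer by which its lift fails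
  to be equivariant. The lift is not unique only where the semiconjugacy is essentially constant; by
  ergodicity this happens almost everywhere or almost nowhere, and the constants would form an
  equivariant family. Since the semiconjugacy may be discontinuous, it is first made right continuous,
  so that its values at rational points decide constancy and give a measurable lift.\<close>


section \<open>The circle and lifts of its homeomorphisms\<close>

text \<open>Boundedness of \<open>u\<close> is what makes the supremum finite: the maps
  \<open>F\<^sub>1 \<gamma> \<omega> \<circ> (F\<^sub>2 \<gamma> \<omega>)\<inverse>\<close> then
  displace points by an amount that does not depend on \<gamma>. Finite generation makes the group
  countable, so that the supremum is Borel and the null sets of all group elements can be collected
  into one. The obstacle in the converse direction is measurability. A lift of the semiconjugacy
  exists for almost every \<omega>, but choosing one says nothing about its dependence on \<omega>,
  whereas \<open>u\<close> must be measurable. Fractional parts of right limits are limits of Borel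
  functions computed on the circle, and the lift is rebuilt from them. Constant maps are excluded
  for a genuine reason: floor and ceiling lift the same constant map and differ by a non-constant
  integer function, so the failure of equivariance is not one integer there.\<close>

definition circle_coord :: "circle \<Rightarrow> real"
  where "circle_coord x = frac (rep_circle x)"

lemma to_circle_circle_coord [simp]: "to_circle (circle_coord x) = x"
proof -
  have "to_circle (frac (rep_circle x)) = to_circle (rep_circle x)"
    by (simp add: to_circle_eq_iff frac_def)
  then show ?thesis
    by (simp add: circle_coord_def Quotient3_abs_rep[OF Quotient3_circle])
qed

lemma frac_eq_iff_diff_Ints: "frac s = frac t \<longleftrightarrow> s - t \<in> \<int>" for s t :: real
proof
  assume "frac s = frac t"
  then have "s - t = of_int (\<lfloor>s\<rfloor> - \<lfloor>t\<rfloor>)"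
    by (simp add: frac_def)
  then show "s - t \<in> \<int>"
    by (metis Ints_of_int)
next
  assume "s - t \<in> \<int>"
  then obtain k where "s = t + of_int k"
    by (metis Ints_cases add.commute diff_add_cancel)
  then show "frac s = frac t"
    by (simp add: frac_def)
qed

lemma circle_coord_to_circle [simp]: "circle_coord (to_circle t) = frac t"
proof -
  have "to_circle (rep_circle (to_circle t)) = to_circle t"
    by (simp add: Quotient3_abs_rep[OF Quotient3_circle])
  then show ?thesis
    by (simp add: circle_coord_def to_circle_eq_iff frac_eq_iff_diff_Ints)
qed

lemma circle_coord_ge_0 [simp]: "0 \<le> circle_coord x"
  and circle_coord_lt_1 [simp]: "circle_coord x < 1"
  by (simp_all add: circle_coord_def frac_lt_1)

lemma to_circle_add_of_int [simp]: "to_circle (t + of_int n) = to_circle t"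
  by (simp add: to_circle_eq_iff)

lemma to_circle_frac [simp]: "to_circle (frac t) = to_circle t"
  by (simp add: to_circle_eq_iff frac_def)

lemma continuous_to_circle: "continuous_on UNIV to_circle"
  by (simp add: continuous_on_open_vimage open_circle_def)

lemma measurable_to_circle [measurable]: "to_circle \<in> borel_measurable borel"
  by (rule borel_measurable_continuous_onI[OF continuous_to_circle])

text \<open>Saturation under integer translations. A union of translates of an open set is open,
  which makes the quotient map open.\<close>

lemma vimage_to_circle_image: "to_circle -` (to_circle ` S) = (\<Union>n. (+) (real_of_int n) ` S)"
proof -
  have "t \<in> (\<Union>n. (+) (real_of_int n) ` S)" if "to_circle t = to_circle s" "s \<in> S" for s t
  proof -
    have "t - s \<in> \<int>"
      using that(1) by (simp add: to_circle_eq_iff)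
    then obtain n where "t - s = of_int n"
      by (rule Ints_cases)
    then have "t = of_int n + s"
      by simp
    then show ?thesis
      using that(2) by blast
  qed
  moreover have "to_circle (real_of_int n + s) \<in> to_circle ` S" if "s \<in> S" for n s
    using that by (metis add.commute imageI to_circle_add_of_int)
  ultimately show ?thesis
    by auto
qed

lemma open_to_circle_image: "open S \<Longrightarrow> open (to_circle ` S)"
  unfolding open_circle_def vimage_to_circle_image
  by (intro open_UN ballI open_translation)

text \<open>The coordinate jumps at the base point, so it is Borel but not continuous. For 0 < c
  \<le> 1 its sublevel set is the open arc over (0, c) together with the base point, and the base
  point is the complement of the open arc over (0, 1).\<close>

lemma measurable_circle_coord [measurable]: "circle_coord \<in> borel_measurable borel"
proof (rule borel_measurableI_less)
  fix c :: real
  consider "c \<le> 0" | "0 < c" "c \<le> 1" | "1 < c"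
    by linarith
  then show "{x \<in> space borel. circle_coord x < c} \<in> sets borel"
  proof cases
    case 1
    then have "{x. circle_coord x < c} = {}"
      using circle_coord_ge_0 by (smt (verit) empty_Collect_eq)
    then show ?thesis
      by simp
  next
    case 2
    have arc: "x \<in> to_circle ` {0<..<b} \<longleftrightarrow> 0 < circle_coord x \<and> circle_coord x < b" if "b \<le> 1" for x b
    proof
      assume "0 < circle_coord x \<and> circle_coord x < b"
      then show "x \<in> to_circle ` {0<..<b}"
        by (intro image_eqI[of _ _ "circle_coord x"]) auto
    qed (use that in \<open>auto simp: frac_eq[THEN iffD2]\<close>)
    have "{x. circle_coord x < c} = to_circle ` {0<..<c} \<union> - to_circle ` {0<..<1}"
      using arc[of c] arc[of 1] 2 circle_coord_ge_0
      by (auto simp: not_less)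
    also have "\<dots> \<in> sets borel"
      by (intro sets.Un borel_comp borel_open open_to_circle_image open_greaterThanLessThan)
    finally show ?thesis
      by simp
  next
    case 3
    then have "{x. circle_coord x < c} = UNIV"
      using circle_coord_lt_1 by (smt (verit) UNIV_eq_I mem_Collect_eq)
    then show ?thesis
      by simp
  qed
qed

text \<open>Stated for arbitrary functions because it also serves the discontinuous lifts of
  non-decreasing degree one maps.\<close>

lemma degree_one_add_of_int:
  fixes F :: "real \<Rightarrow> real"
  assumes "\<And>x. F (x + 1) = F x + 1"
  shows "F (x + of_int n) = F x + of_int n"
proof -
  have nat: "F (x + of_nat m) = F x + of_nat m" for x m
  proof (induction m)
    case (Suc m)
    have "F (x + of_nat (Suc m)) = F ((x + of_nat m) + 1)"
      by (simp add: algebra_simps)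
    then show ?case
      using Suc assms[of "x + of_nat m"] by simp
  qed simp
  show ?thesis
  proof (cases "n \<ge> 0")
    case True
    then show ?thesis
      using nat[of x "nat n"] by simp
  next
    case False
    then show ?thesis
      using nat[of "x + of_int n" "nat (- n)"] by simp
  qed
qed

section \<open>The group of lifts and its order properties\<close>

lemma homeo_Z_real_add_of_int: "F \<in> homeo_Z_real \<Longrightarrow> F (x + of_int n) = F x + of_int n"
  by (rule degree_one_add_of_int) (simp add: homeo_Z_real_def)

lemma homeo_Z_real_add_1: "F \<in> homeo_Z_real \<Longrightarrow> F (x + 1) = F x + 1"
  by (simp add: homeo_Z_real_def)

lemma homeo_Z_real_continuous: "F \<in> homeo_Z_real \<Longrightarrow> continuous_on UNIV F"
  by (auto simp: homeo_Z_real_def homeomorphism_def)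

lemma homeo_Z_real_less_iff: "F \<in> homeo_Z_real \<Longrightarrow> F x < F y \<longleftrightarrow> x < y"
  by (auto simp: homeo_Z_real_def strict_mono_less)

lemma homeo_Z_real_le_iff: "F \<in> homeo_Z_real \<Longrightarrow> F x \<le> F y \<longleftrightarrow> x \<le> y"
  by (auto simp: homeo_Z_real_def strict_mono_less_eq)

lemma homeo_Z_real_eq_iff: "F \<in> homeo_Z_real \<Longrightarrow> F x = F y \<longleftrightarrow> x = y"
  by (auto simp: homeo_Z_real_def strict_mono_eq)

abbreviation inv_fun :: "('a \<Rightarrow> 'b) \<Rightarrow> 'b \<Rightarrow> 'a"
  where "inv_fun \<equiv> inv_into UNIV"

lemma homeo_Z_real_bij: "F \<in> homeo_Z_real \<Longrightarrow> bij F"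
  unfolding homeo_Z_real_def homeomorphism_def
  by (auto simp: bij_def strict_mono_imp_inj_on)

lemma homeo_Z_real_inv_right: "F \<in> homeo_Z_real \<Longrightarrow> F (inv_fun F x) = x"
  by (simp add: bij_is_surj homeo_Z_real_bij surj_f_inv_f)

lemma homeo_Z_real_inv_left: "F \<in> homeo_Z_real \<Longrightarrow> inv_fun F (F x) = x"
  by (simp add: bij_is_inj homeo_Z_real_bij)

text \<open>Over one period a lift oscillates by less than 1. This estimate is behind the uniqueness
  of normalised lifts and behind the uniform bounds on the Euler cocycle and on the primitives
  \<open>u\<close>.\<close>

lemma homeo_Z_real_frac_bounds:
  assumes "F \<in> homeo_Z_real"
  shows "F 0 \<le> F (frac t)" "F (frac t) < F 0 + 1"
  using homeo_Z_real_le_iff[OF assms, of 0 "frac t"] homeo_Z_real_less_iff[OF assms, of "frac t" "0 + 1"]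
    homeo_Z_real_add_1[OF assms, of 0] by (simp_all add: frac_lt_1)

lemma homeo_Z_real_comp: "F \<in> homeo_Z_real \<Longrightarrow> G \<in> homeo_Z_real \<Longrightarrow> F \<circ> G \<in> homeo_Z_real"
  unfolding homeo_Z_real_def
  by (auto simp: strict_mono_o intro!: homeomorphism_compose)

lemma homeo_Z_real_inv: "F \<in> homeo_Z_real \<Longrightarrow> inv_fun F \<in> homeo_Z_real"
proof -
  assume F: "F \<in> homeo_Z_real"
  then obtain G where G: "homeomorphism UNIV UNIV F G"
    by (auto simp: homeo_Z_real_def)
  then have "inv_fun F = G"
    using homeo_Z_real_inv_left[OF F, of "G x" for x] by (auto simp: homeomorphism_def fun_eq_iff)
  then have "homeomorphism UNIV UNIV (inv_fun F) F"
    using G homeomorphism_symD by blast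
  moreover have "strict_mono (inv_fun F)"
    using homeo_Z_real_less_iff[OF F, of "inv_fun F x" "inv_fun F y" for x y]
    by (intro strict_monoI) (simp add: homeo_Z_real_inv_right[OF F])
  moreover have "inv_fun F (x + 1) = inv_fun F x + 1" for x
    using homeo_Z_real_inv_left[OF F, of "inv_fun F x + 1"]
    by (simp add: homeo_Z_real_add_1[OF F] homeo_Z_real_inv_right[OF F])
  ultimately show ?thesis
    by (auto simp: homeo_Z_real_def)
qed

lemma translation_homeo_Z_real: "translation n \<in> homeo_Z_real"
proof -
  have "homeomorphism UNIV UNIV (translation n) (translation (- n))"
    unfolding homeomorphism_def translation_def
    by (auto intro!: continuous_intros surjI[of _ "\<lambda>x. x - of_int n"] surjI[of _ "\<lambda>x. x + of_int n"])
  then show ?thesis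
    by (auto simp: homeo_Z_real_def translation_def strict_mono_def)
qed

section \<open>Lifts of circle homeomorphisms and the normalised section\<close>

lemma is_liftD: "is_lift F f \<Longrightarrow> f (to_circle t) = to_circle (F t)"
  by (auto simp: is_lift_def fun_eq_iff)

lemma is_liftI: "(\<And>t. f (to_circle t) = to_circle (F t)) \<Longrightarrow> is_lift F f"
  by (auto simp: is_lift_def fun_eq_iff)

lemma is_lift_comp: "is_lift F f \<Longrightarrow> is_lift G g \<Longrightarrow> is_lift (F \<circ> G) (f \<circ> g)"
  by (auto simp: is_lift_def fun_eq_iff)

lemma is_lift_translation: "is_lift F f \<Longrightarrow> is_lift (translation n \<circ> F) f"
  by (auto simp: is_lift_def fun_eq_iff translation_def)

text \<open>The inverse of \<open>f\<close> is pushed down from the inverse of its lift, so a lift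
  in \<open>homeo_Z_real\<close> is enough to put \<open>f\<close> into
  \<open>homeo_circle\<close>.\<close>

lemma lift_bij_imp_bij:
  assumes F: "F \<in> homeo_Z_real" and f: "is_lift F f"
  obtains g where "is_lift (inv_fun F) g" "f \<circ> g = id" "g \<circ> f = id"
proof
  define g where "g x = to_circle (inv_fun F (circle_coord x))" for x
  note iF = homeo_Z_real_inv[OF F]
  have g: "g (to_circle t) = to_circle (inv_fun F t)" for t
  proof -
    have "inv_fun F t = inv_fun F (frac t) + of_int \<lfloor>t\<rfloor>"
      using homeo_Z_real_add_of_int[OF iF, of "frac t" "\<lfloor>t\<rfloor>"] by (simp add: frac_def)
    then show ?thesis
      by (simp add: g_def)
  qed
  show "is_lift (inv_fun F) g"
    using g by (rule is_liftI)
  have "f (g x) = x" for x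
    using is_liftD[OF f, of "inv_fun F (circle_coord x)"] homeo_Z_real_inv_right[OF F, of "circle_coord x"]
    by (simp add: g_def)
  then show "f \<circ> g = id"
    by auto
  have "g (f x) = x" for x
    using is_liftD[OF f, of "circle_coord x"] g[of "F (circle_coord x)"] homeo_Z_real_inv_left[OF F, of "circle_coord x"]
    by simp
  then show "g \<circ> f = id"
    by auto
qed

lemma continuous_on_is_lift:
  assumes "continuous_on UNIV F" "is_lift F f"
  shows "continuous_on UNIV f"
proof -
  have "open (f -` B)" if "open B" for B
  proof -
    have "to_circle -` (f -` B) = F -` (to_circle -` B)"
      using is_liftD[OF assms(2)] by auto
    moreover have "open (F -` (to_circle -` B))"
      using assms(1) that by (simp add: continuous_on_open_vimage open_circle_def)
    ultimately show ?thesis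
      by (simp add: open_circle_def)
  qed
  then show ?thesis
    by (simp add: continuous_on_open_vimage)
qed

lemma homeo_circleI:
  assumes F: "F \<in> homeo_Z_real" and f: "is_lift F f"
  shows "f \<in> homeo_circle"
proof -
  obtain g where g: "is_lift (inv_fun F) g" "f \<circ> g = id" "g \<circ> f = id"
    using lift_bij_imp_bij[OF assms] .
  have fg: "f (g x) = x" and gf: "g (f x) = x" for x
    using g(2,3) by (metis comp_apply id_apply)+
  have "range f = UNIV" "range g = UNIV"
    using fg gf by (metis surjI)+
  then have "homeomorphism UNIV UNIV f g"
    unfolding homeomorphism_def
    using continuous_on_is_lift[OF homeo_Z_real_continuous[OF F] f]
      continuous_on_is_lift[OF homeo_Z_real_continuous[OF homeo_Z_real_inv[OF F]] g(1)]
    by (simp add: fg gf)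
  then show ?thesis
    using assms by (auto simp: homeo_circle_def)
qed

text \<open>Two lifts differ by an integer at each point. The normalisation makes them agree at 0,
  and on [0, 1) both stay in the same half-open interval of length 1, so the integer vanishes there
  and, by periodicity, everywhere.\<close>

lemma lift_unique:
  assumes F: "F \<in> homeo_Z_real" "is_lift F f" "F 0 \<in> {0..<1}"
    and G: "G \<in> homeo_Z_real" "is_lift G f" "G 0 \<in> {0..<1}"
  shows "F = G"
proof
  fix t
  have int: "F t - G t \<in> \<int>" for t
    using is_liftD[OF F(2), of t] is_liftD[OF G(2), of t] by (metis to_circle_eq_iff)
  have eq: "F s = G s" if "\<bar>F s - G s\<bar> < 1" for s
    using Ints_nonzero_abs_less1[OF int that] by simp
  have 0: "F 0 = G 0"
    using F(3) G(3) by (intro eq) auto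
  have "F (frac t) = G (frac t)"
  proof (rule eq)
    show "\<bar>F (frac t) - G (frac t)\<bar> < 1"
      using 0 homeo_Z_real_frac_bounds[OF F(1), of t] homeo_Z_real_frac_bounds[OF G(1), of t]
      by linarith
  qed
  then show "F t = G t"
    using homeo_Z_real_add_of_int[OF F(1), of "frac t" "\<lfloor>t\<rfloor>"]
      homeo_Z_real_add_of_int[OF G(1), of "frac t" "\<lfloor>t\<rfloor>"] by (simp add: frac_def)
qed

lemma lift_section_eqI:
  assumes "F \<in> homeo_Z_real" "is_lift F f" "F 0 \<in> {0..<1}"
  shows "lift_section f = F"
  unfolding lift_section_def by (rule the_equality) (use assms lift_unique in blast)+

lemma lift_section:
  assumes "f \<in> homeo_circle"
  shows lift_section_homeo_Z_real: "lift_section f \<in> homeo_Z_real"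
    and is_lift_lift_section: "is_lift (lift_section f) f"
    and lift_section_0: "lift_section f 0 \<in> {0..<1}"
proof -
  obtain F where F: "F \<in> homeo_Z_real" "is_lift F f"
    using assms by (auto simp: homeo_circle_def)
  define G where "G = translation (- \<lfloor>F 0\<rfloor>) \<circ> F"
  have "G 0 = frac (F 0)"
    by (simp add: G_def translation_def frac_def)
  then have G: "G \<in> homeo_Z_real" "is_lift G f" "G 0 \<in> {0..<1}"
    using homeo_Z_real_comp[OF translation_homeo_Z_real F(1)] is_lift_translation[OF F(2)]
    by (simp_all only: G_def) (simp_all add: G_def[symmetric] frac_lt_1)
  then have "lift_section f = G"
    by (rule lift_section_eqI)
  then show "lift_section f \<in> homeo_Z_real" "is_lift (lift_section f) f" "lift_section f 0 \<in> {0..<1}"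
    using G by simp_all
qed

lemma to_circle_lift_section:
  "f \<in> homeo_circle \<Longrightarrow> to_circle (lift_section f t) = f (to_circle t)"
  by (simp add: is_liftD[OF is_lift_lift_section])

text \<open>Translating a lift by minus the floor of its value at 0 normalises it. For a composite
  of two normalised lifts this floor is the value of the Euler cocycle.\<close>

lemma lift_eq_lift_section:
  assumes F: "F \<in> homeo_Z_real" "is_lift F f"
  shows "F t = lift_section f t + of_int \<lfloor>F 0\<rfloor>"
proof -
  define G where "G = translation (- \<lfloor>F 0\<rfloor>) \<circ> F"
  have "G 0 = frac (F 0)"
    by (simp add: G_def translation_def frac_def)
  then have "G \<in> homeo_Z_real" "is_lift G f" "G 0 \<in> {0..<1}"
    using homeo_Z_real_comp[OF translation_homeo_Z_real F(1)] is_lift_translation[OF F(2)]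
    by (simp_all only: G_def) (simp_all add: G_def[symmetric] frac_lt_1)
  then have "lift_section f = G"
    by (rule lift_section_eqI)
  then show ?thesis
    by (simp add: G_def translation_def)
qed

text \<open>Only the values of \<open>f\<close> at two points occur on the right, which makes the
  section measurable in \<open>f\<close>. On [0, 1) the increment of the lift lies in [0, 1), so it
  equals its own fractional part, and that part is visible on the circle.\<close>

lemma lift_section_formula:
  assumes f: "f \<in> homeo_circle"
  shows "lift_section f t = circle_coord (f (to_circle 0)) +
    frac (circle_coord (f (to_circle t)) - circle_coord (f (to_circle 0))) + of_int \<lfloor>t\<rfloor>"
proof -
  define F where "F = lift_section f"
  note F = lift_section[OF f, folded F_def]
  have c: "circle_coord (f (to_circle s)) = frac (F s)" for s
    by (simp add: is_liftD[OF F(2)])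
  have 0: "circle_coord (f (to_circle 0)) = F 0"
    using F(3) by (simp add: c frac_eq)
  have "F (frac t) - F 0 = frac (F (frac t) - F 0)"
    using homeo_Z_real_frac_bounds[OF F(1), of t] by (subst eq_commute) (simp add: frac_eq)
  also have "\<dots> = frac (circle_coord (f (to_circle t)) - F 0)"
  proof -
    have "F (frac t) - circle_coord (f (to_circle t)) \<in> \<int>"
      by (simp add: to_circle_eq_iff[symmetric] is_liftD[OF F(2), symmetric])
    then show ?thesis
      unfolding frac_eq_iff_diff_Ints by simp
  qed
  finally have "F (frac t) = F 0 + frac (circle_coord (f (to_circle t)) - F 0)"
    by simp
  then show ?thesis
    using homeo_Z_real_add_of_int[OF F(1), of "frac t" "\<lfloor>t\<rfloor>"]
    unfolding 0 F_def[symmetric] by (simp add: frac_def)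
qed

lemma homeo_circle_comp:
  assumes "f \<in> homeo_circle" "g \<in> homeo_circle"
  shows "f \<circ> g \<in> homeo_circle"
  using assms by (meson homeo_Z_real_comp homeo_circleI is_lift_comp lift_section)

lemma homeo_circle_inv:
  assumes "f \<in> homeo_circle"
  shows "inv_fun f \<in> homeo_circle" "f \<circ> inv_fun f = id" "inv_fun f \<circ> f = id"
    "is_lift (inv_fun (lift_section f)) (inv_fun f)"
proof -
  obtain g where g: "is_lift (inv_fun (lift_section f)) g" "f \<circ> g = id" "g \<circ> f = id"
    using lift_bij_imp_bij[OF lift_section(1,2)[OF assms]] .
  have "inv_fun f = g"
    using g(2,3) by (simp add: inv_unique_comp)
  then show "inv_fun f \<in> homeo_circle" "f \<circ> inv_fun f = id" "inv_fun f \<circ> f = id"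
    "is_lift (inv_fun (lift_section f)) (inv_fun f)"
    using g homeo_circleI[OF homeo_Z_real_inv[OF lift_section(1)[OF assms]]] by auto
qed

lemma id_homeo_circle: "id \<in> homeo_circle"
proof -
  have "is_lift (translation 0) id"
    by (simp add: is_lift_def translation_def comp_def)
  then show ?thesis
    by (rule homeo_circleI[OF translation_homeo_Z_real])
qed

lemma group_homeo_group: "group homeo_group"
proof (rule groupI)
  fix f assume "f \<in> carrier homeo_group"
  then show "\<exists>g\<in>carrier homeo_group. g \<otimes>\<^bsub>homeo_group\<^esub> f = \<one>\<^bsub>homeo_group\<^esub>"
    using homeo_circle_inv[of f] by (auto simp: homeo_group_def)
qed (auto simp: homeo_group_def homeo_circle_comp id_homeo_circle comp_assoc)

lemma carrier_homeo_group [simp]: "carrier homeo_group = homeo_circle"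
  and mult_homeo_group [simp]: "f \<otimes>\<^bsub>homeo_group\<^esub> g = f \<circ> g"
  by (simp_all add: homeo_group_def)

lemma m_inv_homeo_group [simp]: "f \<in> homeo_circle \<Longrightarrow> inv\<^bsub>homeo_group\<^esub> f = inv_fun f"
  using group.inv_equality[OF group_homeo_group, of "inv_fun f" f] homeo_circle_inv[of f]
  by (simp add: homeo_group_def)

text \<open>A composite of lifts lifts the composite, so it differs from the normalised lift by the
  floor of its value at 0. That value lies in [0, 2): the inner lift sends 0 into [0, 1), where the
  outer one exceeds its own value at 0 by less than 1.\<close>

lemma lift_section_euler_cocycle:
  assumes f: "f \<in> homeo_circle" and g: "g \<in> homeo_circle"
  shows "lift_section f (lift_section g t) = lift_section (f \<circ> g) t + of_int (euler_cocycle [f, g])"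
    and euler_cocycle_eq: "euler_cocycle [f, g] = \<lfloor>lift_section f (lift_section g 0)\<rfloor>"
    and euler_cocycle_range: "euler_cocycle [f, g] \<in> {0..1}"
proof -
  define F where "F = lift_section f"
  define G where "G = lift_section g"
  note F = lift_section[OF f, folded F_def] and G = lift_section[OF g, folded G_def]
  note FG = homeo_Z_real_comp[OF F(1) G(1)]
  define n where "n = \<lfloor>F (G 0)\<rfloor>"
  have eq: "F (G t) = lift_section (f \<circ> g) t + of_int n" for t
    using lift_eq_lift_section[OF FG is_lift_comp[OF F(2) G(2)], of t] by (simp add: n_def)
  have sec: "lift_section (f \<circ> g) (t + of_int m) = lift_section (f \<circ> g) t + of_int m" for t m
    by (intro homeo_Z_real_add_of_int lift_section(1) homeo_circle_comp f g)
  have "(THE m. lift_section (f \<circ> g) \<circ> translation m = F \<circ> G) = n"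
    by (rule the_equality) (auto simp: fun_eq_iff translation_def eq sec)
  moreover have "[f, g] \<in> tuples homeo_group 2"
    using f g by (simp add: tuples_def)
  ultimately have e: "euler_cocycle [f, g] = n"
    by (simp add: euler_cocycle_def F_def G_def)
  show "lift_section f (lift_section g t) = lift_section (f \<circ> g) t + of_int (euler_cocycle [f, g])"
    using eq[of t] by (simp add: e F_def G_def)
  show "euler_cocycle [f, g] = \<lfloor>lift_section f (lift_section g 0)\<rfloor>"
    by (simp add: e n_def F_def G_def)
  have "frac (G 0) = G 0"
    using G(3) by (simp add: frac_eq)
  then have "0 \<le> F (G 0)" "F (G 0) < 2"
    using homeo_Z_real_frac_bounds[OF F(1), of "G 0"] F(3) by auto
  then show "euler_cocycle [f, g] \<in> {0..1}"
    unfolding e n_def by (auto simp: floor_le_iff)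
qed

section \<open>The Borel structure of the homeomorphism group\<close>

text \<open>Cylinder sets for evaluations. There are countably many finite \<open>C\<close> with
  rational entries, and their cylinders turn out to refine every compact-open neighbourhood of a
  homeomorphism.\<close>

definition arc_cylinder :: "(real \<times> real \<times> real) set \<Rightarrow> (circle \<Rightarrow> circle) set"
  where "arc_cylinder C =
    {h \<in> homeo_circle. \<forall>(q, a, b)\<in>C. h (to_circle q) \<in> to_circle ` {a<..<b}}"

lemma arc_cylinder_Un: "arc_cylinder (C \<union> D) = arc_cylinder C \<inter> arc_cylinder D"
  unfolding arc_cylinder_def ball_Un by blast

lemma arc_cylinder_antimono: "C \<subseteq> D \<Longrightarrow> arc_cylinder D \<subseteq> arc_cylinder C"
  by (auto simp: arc_cylinder_def)

text \<open>Monotonicity: control of the two end points controls the arc between them. The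
  conditions on \<open>b\<close>, \<open>c\<close> and \<open>d\<close> place both target arcs in
  one period, in the right order, so that the two image points are lifted with the same integer
  shift.\<close>

lemma arc_cylinder_interval:
  assumes h: "h \<in> arc_cylinder {(p, a, b), (q, c, d)}"
    and pq: "p < q" "q < p + 1" and bc: "b \<le> c" and da: "d \<le> a + 1"
  shows "h ` to_circle ` {p<..<q} \<subseteq> to_circle ` {a<..<d}"
proof -
  have hH: "h \<in> homeo_circle"
    using h by (simp add: arc_cylinder_def)
  define F where "F = lift_section h"
  note F = lift_section[OF hH, folded F_def]
  obtain s where s: "a < s" "s < b" "h (to_circle p) = to_circle s"
    using h by (auto simp: arc_cylinder_def)
  obtain r where r: "c < r" "r < d" "h (to_circle q) = to_circle r"
    using h by (auto simp: arc_cylinder_def)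
  have "F p - s \<in> \<int>" "F q - r \<in> \<int>"
    using s r is_liftD[OF F(2)] by (metis to_circle_eq_iff)+
  then obtain m n where m: "F p = s + of_int m" and n: "F q = r + of_int n"
    by (metis Ints_cases add.commute diff_add_cancel)
  have "F p < F q" "F q < F p + 1"
    using pq homeo_Z_real_less_iff[OF F(1), of p q] homeo_Z_real_less_iff[OF F(1), of q "p + 1"]
    by (simp_all add: homeo_Z_real_add_1[OF F(1)])
  \<comment> \<open>Both \<open>F q - F p\<close> and \<open>r - s\<close> lie in (0, 1), and
    \<open>n - m\<close> is their difference.\<close>
  then have "real_of_int (n - m) < 1" "real_of_int (n - m) > -1"
    using m n s r bc da by simp_all
  then have nm: "n = m"
    by linarith
  show ?thesis
  proof (intro subsetI, elim imageE)
    fix x y t assume xy: "x = h y" "y = to_circle t" "t \<in> {p<..<q}"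
    then have "F p < F t" "F t < F q"
      by (simp_all add: homeo_Z_real_less_iff[OF F(1)])
    then have "F t - of_int m \<in> {a<..<d}"
      using m n nm s r by simp
    moreover have "x = to_circle (F t - of_int m)"
      using xy is_liftD[OF F(2)] to_circle_add_of_int[of "F t" "- m"] by simp
    ultimately show "x \<in> to_circle ` {a<..<d}"
      by blast
  qed
qed

text \<open>Rationals around \<open>F t\<close> are pulled back through the inverse lift. This gives
  rational p < t < q whose images lie in rational intervals (a, b) and (c, d) on either side of
  \<open>F t\<close>, close to it. Two evaluations then control every nearby homeomorphism on a
  whole arc around \<open>x\<close>.\<close>

lemma arc_cylinder_nhd:
  assumes f: "f \<in> homeo_circle" and U: "open U" and x: "f x \<in> U"
  shows "\<exists>N C. open N \<and> x \<in> N \<and> finite C \<and> C \<subseteq> \<rat> \<times> \<rat> \<times> \<rat> \<and> f \<in> arc_cylinder C \<and>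
    (\<forall>h\<in>arc_cylinder C. h ` N \<subseteq> U)"
proof -
  define F where "F = lift_section f"
  note F = lift_section[OF f, folded F_def]
  define t where "t = circle_coord x"
  have xt: "x = to_circle t"
    by (simp add: t_def)
  have "open (to_circle -` U)" "F t \<in> to_circle -` U"
    using U x is_liftD[OF F(2)] by (auto simp: open_circle_def xt)
  then obtain e where e: "e > 0" "ball (F t) e \<subseteq> to_circle -` U"
    by (meson open_contains_ball)
  \<comment> \<open>The cap 1/2 keeps \<open>d - a\<close> below 1, so both target arcs fit into one
    period and \<open>q < p + 1\<close> follows.\<close>
  define e' where "e' = min e (1/2)"
  have e': "e' > 0" "e' \<le> 1/2" "e' \<le> e"
    using e by (auto simp: e'_def)
  have rat: "\<exists>r\<in>\<rat>. u < r \<and> r < v" if "u < v" for u v :: real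
    using Rats_dense_in_real[OF that] by blast
  obtain a where a: "a \<in> \<rat>" "F t - e' < a" "a < F t"
    using rat[of "F t - e'" "F t"] e' by auto
  obtain d where d: "d \<in> \<rat>" "F t < d" "d < F t + e'"
    using rat[of "F t" "F t + e'"] e' by auto
  note iF = homeo_Z_real_inv[OF F(1)]
  have less1: "inv_fun F u < v \<longleftrightarrow> u < F v" and less2: "v < inv_fun F u \<longleftrightarrow> F v < u" for u v
    using homeo_Z_real_less_iff[OF F(1), of "inv_fun F u" v]
      homeo_Z_real_less_iff[OF F(1), of v "inv_fun F u"]
    by (simp_all add: homeo_Z_real_inv_right[OF F(1)])
  obtain p where p: "p \<in> \<rat>" "a < F p" "p < t"
    using rat[of "inv_fun F a" t] a less1 by auto
  obtain q where q: "q \<in> \<rat>" "F q < d" "t < q"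
    using rat[of t "inv_fun F d"] d less2 by auto
  have Fpq: "F p < F t" "F t < F q"
    using p q by (simp_all add: homeo_Z_real_less_iff[OF F(1)])
  obtain b where b: "b \<in> \<rat>" "F p < b" "b < F t"
    using rat[OF Fpq(1)] by auto
  obtain c where c: "c \<in> \<rat>" "F t < c" "c < F q"
    using rat[OF Fpq(2)] by auto
  have "F q < F (p + 1)"
    using p q a d e' by (simp add: homeo_Z_real_add_1[OF F(1)])
  then have pq: "q < p + 1"
    by (simp add: homeo_Z_real_less_iff[OF F(1)])
  define C where "C = {(p, a, b), (q, c, d)}"
  have "f \<in> arc_cylinder C"
    using f p q b c by (auto simp: C_def arc_cylinder_def is_liftD[OF F(2)])
  moreover have "h ` to_circle ` {p<..<q} \<subseteq> U" if "h \<in> arc_cylinder C" for h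
  proof -
    have "h ` to_circle ` {p<..<q} \<subseteq> to_circle ` {a<..<d}"
      by (rule arc_cylinder_interval[OF that[unfolded C_def]]) (use p q a b c d e' pq in auto)
    also have "\<dots> \<subseteq> to_circle ` ball (F t) e"
      using a d e' by (intro image_mono) (auto simp: dist_real_def)
    also have "\<dots> \<subseteq> U"
      using e(2) by auto
    finally show ?thesis .
  qed
  moreover have "open (to_circle ` {p<..<q})" "x \<in> to_circle ` {p<..<q}"
    using p q xt by (auto intro: open_to_circle_image)
  moreover have "finite C" "C \<subseteq> \<rat> \<times> \<rat> \<times> \<rat>"
    using p q a b c d by (auto simp: C_def)
  ultimately show ?thesis
    by (intro exI[of _ "to_circle ` {p<..<q}"] exI[of _ C]) simp
qed

text \<open>For a subbasic set, compactness of \<open>K\<close> selects finitely many of the local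
  neighbourhoods, and their conditions together form one rational cylinder. The topology on
  homeomorphisms is thus detected at rational points.\<close>

lemma compact_open_arc_cylinder:
  assumes "openin compact_open_topology W" "f \<in> W" "f \<in> homeo_circle"
  shows "\<exists>C. finite C \<and> C \<subseteq> \<rat> \<times> \<rat> \<times> \<rat> \<and> f \<in> arc_cylinder C \<and> arc_cylinder C \<subseteq> W"
proof -
  have "generate_topology_on {{f :: circle \<Rightarrow> circle. f ` K \<subseteq> U} | K U. compact K \<and> open U} W"
    using assms(1) by (simp add: compact_open_topology_def openin_topology_generated_by_iff)
  then show ?thesis
    using assms(2)
  proof (induction W)
    case (Int V W)
    then obtain C D where "finite C \<and> C \<subseteq> \<rat> \<times> \<rat> \<times> \<rat> \<and> f \<in> arc_cylinder C \<and> arc_cylinder C \<subseteq> V"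
      "finite D \<and> D \<subseteq> \<rat> \<times> \<rat> \<times> \<rat> \<and> f \<in> arc_cylinder D \<and> arc_cylinder D \<subseteq> W"
      by blast
    then show ?case
      by (intro exI[of _ "C \<union> D"]) (auto simp: arc_cylinder_Un)
  next
    case (UN K)
    then obtain V where "V \<in> K" "f \<in> V"
      by blast
    then show ?case
      using UN.IH[of V] by blast
  next
    case (Basis W)
    then obtain K U where W: "W = {h. h ` K \<subseteq> U}" "compact K" "open U"
      by blast
    have "\<forall>x\<in>K. \<exists>N C. open N \<and> x \<in> N \<and> finite C \<and> C \<subseteq> \<rat> \<times> \<rat> \<times> \<rat> \<and> f \<in> arc_cylinder C \<and>
        (\<forall>h\<in>arc_cylinder C. h ` N \<subseteq> U)"
      using Basis W by (intro ballI arc_cylinder_nhd[OF assms(3)]) auto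
    then obtain N C where NC: "\<And>x. x \<in> K \<Longrightarrow> open (N x) \<and> x \<in> N x \<and> finite (C x) \<and>
        C x \<subseteq> \<rat> \<times> \<rat> \<times> \<rat> \<and> f \<in> arc_cylinder (C x) \<and> (\<forall>h\<in>arc_cylinder (C x). h ` N x \<subseteq> U)"
      by metis
    obtain J where J: "J \<subseteq> K" "finite J" "K \<subseteq> (\<Union>x\<in>J. N x)"
      by (rule compactE_image[OF W(2), of K N]) (use NC in blast)+
    have "arc_cylinder (\<Union>x\<in>J. C x) \<subseteq> W"
    proof
      fix h assume h: "h \<in> arc_cylinder (\<Union>x\<in>J. C x)"
      have "h y \<in> U" if y: "y \<in> K" for y
      proof -
        obtain x where x: "x \<in> J" "y \<in> N x"
          using J(3) y by blast
        then have "h \<in> arc_cylinder (C x)"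
          using h arc_cylinder_antimono[of "C x" "\<Union>x\<in>J. C x"] by blast
        then show ?thesis
          using NC[of x] x J(1) by blast
      qed
      then show "h \<in> W"
        by (auto simp: W)
    qed
    moreover have "f \<in> arc_cylinder (\<Union>x\<in>J. C x)"
      using NC J(1) assms(3) by (fastforce simp: arc_cylinder_def)
    moreover have "finite (\<Union>x\<in>J. C x)" "(\<Union>x\<in>J. C x) \<subseteq> \<rat> \<times> \<rat> \<times> \<rat>"
      using NC J by blast+
    ultimately show ?case
      by blast
  qed auto
qed

section \<open>Measurability of maps into the homeomorphism group\<close>

lemma sets_homeo_borel_gen:
  "{U. openin (subtopology compact_open_topology homeo_circle) U} \<subseteq> Pow homeo_circle"
  using openin_subset by fastforce

lemma space_homeo_borel [simp]: "space homeo_borel = homeo_circle"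
  unfolding homeo_borel_def by (rule space_measure_of[OF sets_homeo_borel_gen])

lemma measurable_homeo_borel_eval:
  assumes f: "f \<in> measurable M homeo_borel"
  shows "(\<lambda>\<omega>. f \<omega> x) \<in> borel_measurable M"
proof (rule borel_measurableI)
  fix U :: "circle set" assume "open U"
  then have "openin compact_open_topology {h :: circle \<Rightarrow> circle. h ` {x} \<subseteq> U}"
    unfolding compact_open_topology_def
    by (intro topology_generated_by_Basis) (use compact_sing in blast)
  then have "openin (subtopology compact_open_topology homeo_circle) (homeo_circle \<inter> {h. h ` {x} \<subseteq> U})"
    by (rule openin_subtopology_Int2)
  then have "homeo_circle \<inter> {h. h ` {x} \<subseteq> U} \<in> sets homeo_borel"
    unfolding homeo_borel_def using sets_homeo_borel_gen by (auto simp: sets_measure_of)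
  then have "f -` (homeo_circle \<inter> {h. h ` {x} \<subseteq> U}) \<inter> space M \<in> sets M"
    using f by (rule measurable_sets[rotated])
  also have "f -` (homeo_circle \<inter> {h. h ` {x} \<subseteq> U}) \<inter> space M = (\<lambda>\<omega>. f \<omega> x) -` U \<inter> space M"
    using measurable_space[OF f] by auto
  finally show "(\<lambda>\<omega>. f \<omega> x) -` U \<inter> space M \<in> sets M" .
qed

text \<open>Converse of the measurability of evaluations: an open set of homeomorphisms is a
  countable union of rational cylinders, and the preimage of a cylinder is a finite intersection of
  conditions on evaluations. Compositions and inverses are later tested pointwise through
  it.\<close>

lemma measurable_homeo_borelI:
  assumes H: "\<And>\<omega>. \<omega> \<in> space M \<Longrightarrow> f \<omega> \<in> homeo_circle"
    and eval: "\<And>x. (\<lambda>\<omega>. f \<omega> x) \<in> borel_measurable M"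
  shows "f \<in> measurable M homeo_borel"
  unfolding homeo_borel_def
proof (rule measurable_measure_of[OF sets_homeo_borel_gen])
  show "f \<in> space M \<rightarrow> homeo_circle"
    using H by blast
  have arc: "to_circle ` {a<..<b} \<in> sets borel" for a b
    by (intro borel_open open_to_circle_image open_greaterThanLessThan)
  have cyl: "f -` arc_cylinder C \<inter> space M \<in> sets M" if "finite C" for C
  proof -
    have "f -` arc_cylinder C \<inter> space M =
      {\<omega> \<in> space M. \<forall>c\<in>C. f \<omega> (to_circle (fst c)) \<in> to_circle ` {fst (snd c)<..<snd (snd c)}}"
      using H by (auto simp: arc_cylinder_def split_beta)
    also have "\<dots> \<in> sets M"
      by (intro sets.sets_Collect_finite_All[OF _ that] measurable_sets_Collect[OF eval])
        (simp add: arc)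
    finally show ?thesis .
  qed
  fix W assume "W \<in> {U. openin (subtopology compact_open_topology homeo_circle) U}"
  then obtain V where V: "openin compact_open_topology V" "W = V \<inter> homeo_circle"
    by (auto simp: openin_subtopology)
  define \<C> where "\<C> = {C. C \<subseteq> \<rat> \<times> \<rat> \<times> \<rat> \<and> finite C \<and> arc_cylinder C \<subseteq> W}"
  have "countable {C. C \<subseteq> \<rat> \<times> \<rat> \<times> (\<rat> :: real set) \<and> finite C}"
    using countable_Collect_finite_subset[OF countable_SIGMA[OF countable_rat countable_SIGMA[OF countable_rat countable_rat]]]
    by (simp add: conj_commute)
  then have count: "countable \<C>"
    by (rule countable_subset[rotated]) (auto simp: \<C>_def)
  have W: "W = (\<Union>C\<in>\<C>. arc_cylinder C)"
  proof
    show "W \<subseteq> (\<Union>C\<in>\<C>. arc_cylinder C)"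
    proof
      fix h assume "h \<in> W"
      then obtain C where C: "finite C" "C \<subseteq> \<rat> \<times> \<rat> \<times> \<rat>" "h \<in> arc_cylinder C" "arc_cylinder C \<subseteq> V"
        using compact_open_arc_cylinder[OF V(1), of h] V(2) by blast
      moreover have "arc_cylinder C \<subseteq> homeo_circle"
        by (auto simp: arc_cylinder_def)
      ultimately show "h \<in> (\<Union>C\<in>\<C>. arc_cylinder C)"
        using V(2) by (auto simp: \<C>_def)
    qed
  qed (auto simp: \<C>_def)
  have "(\<Union>C\<in>\<C>. f -` arc_cylinder C \<inter> space M) \<in> sets M"
    by (rule sets.countable_UN'[OF count]) (auto simp: \<C>_def cyl)
  moreover have "f -` (\<Union>C\<in>\<C>. arc_cylinder C) \<inter> space M = (\<Union>C\<in>\<C>. f -` arc_cylinder C \<inter> space M)"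
    by auto
  ultimately show "f -` W \<inter> space M \<in> sets M"
    by (simp only: W[symmetric])
qed

text \<open>Separate measurability suffices because \<open>F \<omega>\<close> is increasing: a
  strict inequality at \<open>g \<omega>\<close> survives at a slightly larger rational, found below
  the preimage of \<open>c\<close>.\<close>

lemma measurable_homeo_Z_real_eval:
  assumes F: "\<And>\<omega>. \<omega> \<in> space M \<Longrightarrow> F \<omega> \<in> homeo_Z_real"
    and meas: "\<And>t. (\<lambda>\<omega>. F \<omega> t) \<in> borel_measurable M"
    and [measurable]: "g \<in> borel_measurable M"
  shows "(\<lambda>\<omega>. F \<omega> (g \<omega>)) \<in> borel_measurable M"
proof (rule borel_measurableI_less)
  fix c
  note [measurable] = meas
  have "F \<omega> (g \<omega>) < c \<longleftrightarrow> (\<exists>q\<in>\<rat>. g \<omega> < q \<and> F \<omega> q < c)" if "\<omega> \<in> space M" for \<omega>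
  proof
    assume less: "F \<omega> (g \<omega>) < c"
    have iF: "v < inv_fun (F \<omega>) c \<longleftrightarrow> F \<omega> v < c" for v
      using homeo_Z_real_less_iff[OF F[OF that], of v "inv_fun (F \<omega>) c"]
      by (simp add: homeo_Z_real_inv_right[OF F[OF that]])
    then obtain q where "q \<in> \<rat>" "g \<omega> < q" "q < inv_fun (F \<omega>) c"
      using Rats_dense_in_real[of "g \<omega>" "inv_fun (F \<omega>) c"] less by blast
    then show "\<exists>q\<in>\<rat>. g \<omega> < q \<and> F \<omega> q < c"
      using iF by blast
  next
    assume "\<exists>q\<in>\<rat>. g \<omega> < q \<and> F \<omega> q < c"
    then show "F \<omega> (g \<omega>) < c"
      using homeo_Z_real_less_iff[OF F[OF that]] less_trans by blast
  qed
  then have "{\<omega> \<in> space M. F \<omega> (g \<omega>) < c} = (\<Union>q\<in>\<rat>. {\<omega> \<in> space M. g \<omega> < q \<and> F \<omega> q < c})"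
    by auto
  also have "\<dots> \<in> sets M"
    by (intro sets.countable_UN'[OF countable_rat]) auto
  finally show "{\<omega> \<in> space M. F \<omega> (g \<omega>) < c} \<in> sets M" .
qed

text \<open>Monotonicity turns a bound on the inverse into a bound on \<open>F\<close> at a fixed
  point.\<close>

lemma measurable_homeo_Z_real_inv:
  assumes F: "\<And>\<omega>. \<omega> \<in> space M \<Longrightarrow> F \<omega> \<in> homeo_Z_real"
    and meas: "\<And>t. (\<lambda>\<omega>. F \<omega> t) \<in> borel_measurable M"
    and [measurable]: "g \<in> borel_measurable M"
  shows "(\<lambda>\<omega>. inv_fun (F \<omega>) (g \<omega>)) \<in> borel_measurable M"
proof (rule borel_measurableI_less)
  fix c
  note [measurable] = meas
  have "inv_fun (F \<omega>) (g \<omega>) < c \<longleftrightarrow> g \<omega> < F \<omega> c" if "\<omega> \<in> space M" for \<omega>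
    using homeo_Z_real_less_iff[OF F[OF that], of "inv_fun (F \<omega>) (g \<omega>)" c]
    by (simp add: homeo_Z_real_inv_right[OF F[OF that]])
  then have "{\<omega> \<in> space M. inv_fun (F \<omega>) (g \<omega>) < c} = {\<omega> \<in> space M. g \<omega> < F \<omega> c}"
    by auto
  also have "\<dots> \<in> sets M"
    by measurable
  finally show "{\<omega> \<in> space M. inv_fun (F \<omega>) (g \<omega>) < c} \<in> sets M" .
qed

lemma measurable_lift_section_const:
  assumes f: "f \<in> measurable M homeo_borel"
  shows "(\<lambda>\<omega>. lift_section (f \<omega>) t) \<in> borel_measurable M"
proof -
  note [measurable] = measurable_homeo_borel_eval[OF f]
  have "(\<lambda>\<omega>. circle_coord (f \<omega> (to_circle 0)) +
    frac (circle_coord (f \<omega> (to_circle t)) - circle_coord (f \<omega> (to_circle 0))) + of_int \<lfloor>t\<rfloor>)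
    \<in> borel_measurable M"
    unfolding frac_def by measurable
  then show ?thesis
    by (rule measurable_cong[THEN iffD1, rotated])
      (use measurable_space[OF f] lift_section_formula in simp)
qed

lemma measurable_lift_section:
  assumes f: "f \<in> measurable M homeo_borel" and g: "g \<in> borel_measurable M"
  shows "(\<lambda>\<omega>. lift_section (f \<omega>) (g \<omega>)) \<in> borel_measurable M"
  using measurable_space[OF f]
  by (intro measurable_homeo_Z_real_eval[OF _ measurable_lift_section_const[OF f] g] lift_section(1)) simp

lemma homeo_circle_eq_lift_section:
  "f \<in> homeo_circle \<Longrightarrow> f x = to_circle (lift_section f (circle_coord x))"
  by (simp add: to_circle_lift_section)

lemma measurable_homeo_borel_eval2:
  assumes f: "f \<in> measurable M homeo_borel" and [measurable]: "g \<in> borel_measurable M"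
  shows "(\<lambda>\<omega>. f \<omega> (g \<omega>)) \<in> borel_measurable M"
proof -
  have [measurable]: "(\<lambda>\<omega>. lift_section (f \<omega>) (circle_coord (g \<omega>))) \<in> borel_measurable M"
    by (intro measurable_lift_section[OF f]) measurable
  have "(\<lambda>\<omega>. to_circle (lift_section (f \<omega>) (circle_coord (g \<omega>)))) \<in> borel_measurable M"
    by measurable
  then show ?thesis
    by (rule measurable_cong[THEN iffD1, rotated])
      (use measurable_space[OF f] homeo_circle_eq_lift_section in simp)
qed

lemma measurable_homeo_borel_comp:
  assumes f: "f \<in> measurable M homeo_borel" and g: "g \<in> measurable M homeo_borel"
  shows "(\<lambda>\<omega>. f \<omega> \<circ> g \<omega>) \<in> measurable M homeo_borel"
  using measurable_space[OF f] measurable_space[OF g]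
    measurable_homeo_borel_eval2[OF f measurable_homeo_borel_eval[OF g]]
  by (auto intro!: measurable_homeo_borelI homeo_circle_comp)

lemma measurable_homeo_borel_inv:
  assumes f: "f \<in> measurable M homeo_borel"
  shows "(\<lambda>\<omega>. inv_fun (f \<omega>)) \<in> measurable M homeo_borel"
proof (rule measurable_homeo_borelI)
  show "inv_fun (f \<omega>) \<in> homeo_circle" if "\<omega> \<in> space M" for \<omega>
    using measurable_space[OF f that] by (simp add: homeo_circle_inv)
  fix x
  have "(\<lambda>\<omega>. inv_fun (lift_section (f \<omega>)) (circle_coord x)) \<in> borel_measurable M"
    using measurable_space[OF f]
    by (intro measurable_homeo_Z_real_inv[OF _ measurable_lift_section_const[OF f]] lift_section(1)) simp_all
  then have "(\<lambda>\<omega>. to_circle (inv_fun (lift_section (f \<omega>)) (circle_coord x))) \<in> borel_measurable M"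
    by measurable
  moreover have "to_circle (inv_fun (lift_section (f \<omega>)) (circle_coord x)) = inv_fun (f \<omega>) x"
    if "\<omega> \<in> space M" for \<omega>
    using is_liftD[OF homeo_circle_inv(4)[of "f \<omega>"], of "circle_coord x"] measurable_space[OF f that]
    by simp
  ultimately show "(\<lambda>\<omega>. inv_fun (f \<omega>) x) \<in> borel_measurable M"
    by (rule measurable_cong[THEN iffD1, rotated])
qed

lemma measurable_euler_cocycle_comp:
  assumes f: "f \<in> measurable M homeo_borel" and g: "g \<in> measurable M homeo_borel"
  shows "(\<lambda>\<omega>. euler_cocycle [f \<omega>, g \<omega>]) \<in> measurable M (count_space UNIV)"
proof -
  have [measurable]: "(\<lambda>\<omega>. lift_section (f \<omega>) (lift_section (g \<omega>) 0)) \<in> borel_measurable M"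
    by (intro measurable_lift_section[OF f] measurable_lift_section_const[OF g])
  have "(\<lambda>\<omega>. \<lfloor>lift_section (f \<omega>) (lift_section (g \<omega>) 0)\<rfloor>) \<in> measurable M (count_space UNIV)"
    by measurable
  then show ?thesis
    by (rule measurable_cong[THEN iffD1, rotated])
      (use measurable_space[OF f] measurable_space[OF g] euler_cocycle_eq in simp)
qed

lemma measurable_euler_cocycle:
  "(\<lambda>(f, g). euler_cocycle [f, g]) \<in> measurable (homeo_borel \<Otimes>\<^sub>M homeo_borel) (count_space UNIV)"
  unfolding split_beta by (intro measurable_euler_cocycle_comp) measurable

section \<open>Classes of essentially bounded functions\<close>

lemma tuples_2: "[g, h] \<in> tuples G 2 \<longleftrightarrow> g \<in> carrier G \<and> h \<in> carrier G"
  by (auto simp: tuples_def)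

lemma tuples_1: "[g] \<in> tuples G 1 \<longleftrightarrow> g \<in> carrier G"
  by (auto simp: tuples_def)

lemma tuples_2E:
  assumes "gs \<in> tuples G 2"
  obtains g h where "gs = [g, h]" "g \<in> carrier G" "h \<in> carrier G"
  using assms by (auto simp: tuples_def length_Suc_conv numeral_2_eq_2)

lemma tuples_1E:
  assumes "gs \<in> tuples G 1"
  obtains g where "gs = [g]" "g \<in> carrier G"
  using assms by (auto simp: tuples_def length_Suc_conv)

lemma coboundary_1:
  assumes A: "abelian_group A" and g: "g \<in> carrier G" "h \<in> carrier G"
    and f: "act g (f [h]) \<in> carrier A" "f [g \<otimes>\<^bsub>G\<^esub> h] \<in> carrier A" "f [g] \<in> carrier A"
  shows "coboundary G A act 1 f [g, h] = act g (f [h]) \<ominus>\<^bsub>A\<^esub> f [g \<otimes>\<^bsub>G\<^esub> h] \<oplus>\<^bsub>A\<^esub> f [g]"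
proof -
  interpret abelian_group A
    by (rule A)
  have "[(- 1 :: int)] \<cdot>\<^bsub>A\<^esub> f [g \<otimes>\<^bsub>G\<^esub> h] = \<ominus>\<^bsub>A\<^esub> f [g \<otimes>\<^bsub>G\<^esub> h]"
    using add.int_pow_neg[OF f(2), of 1] add.int_pow_1[OF f(2)] by simp
  moreover have "(\<Oplus>\<^bsub>A\<^esub>i\<in>{1..1}. [((-1) ^ i :: int)] \<cdot>\<^bsub>A\<^esub> f (merge_at G i [g, h])) =
      [(- 1 :: int)] \<cdot>\<^bsub>A\<^esub> f [g \<otimes>\<^bsub>G\<^esub> h]"
    using f(2) calculation by (simp add: merge_at_def finsum_insert del: One_nat_def)
  ultimately show ?thesis
    using g f by (simp add: coboundary_def tuples_2 minus_eq numeral_2_eq_2[symmetric])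
qed

lemma carrier_ess_bounded_ring:
  "f \<in> carrier (ess_bounded_ring M) \<longleftrightarrow>
    f \<in> measurable M (count_space UNIV) \<and> (\<exists>C. AE \<omega> in M. \<bar>f \<omega>\<bar> \<le> C)"
  by (simp add: ess_bounded_ring_def)

lemma add_ess_bounded_ring [simp]: "f \<oplus>\<^bsub>ess_bounded_ring M\<^esub> g = (\<lambda>\<omega>. f \<omega> + g \<omega>)"
  and zero_ess_bounded_ring [simp]: "\<zero>\<^bsub>ess_bounded_ring M\<^esub> = (\<lambda>\<omega>. 0)"
  by (simp_all add: ess_bounded_ring_def)

lemma ess_bounded_0: "(\<lambda>\<omega>. 0) \<in> carrier (ess_bounded_ring M)"
  by (auto simp: carrier_ess_bounded_ring)

lemma ess_bounded_add:
  assumes "f \<in> carrier (ess_bounded_ring M)" "g \<in> carrier (ess_bounded_ring M)"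
  shows "(\<lambda>\<omega>. f \<omega> + g \<omega>) \<in> carrier (ess_bounded_ring M)"
proof -
  have [measurable]: "f \<in> measurable M (count_space UNIV)" "g \<in> measurable M (count_space UNIV)"
    using assms by (auto simp: carrier_ess_bounded_ring)
  obtain C D where "AE \<omega> in M. \<bar>f \<omega>\<bar> \<le> C" "AE \<omega> in M. \<bar>g \<omega>\<bar> \<le> D"
    using assms by (auto simp: carrier_ess_bounded_ring)
  then have "AE \<omega> in M. \<bar>f \<omega> + g \<omega>\<bar> \<le> C + D"
    by eventually_elim linarith
  then show ?thesis
    by (auto simp: carrier_ess_bounded_ring)
qed

lemma ess_bounded_minus:
  assumes "f \<in> carrier (ess_bounded_ring M)"
  shows "(\<lambda>\<omega>. - f \<omega>) \<in> carrier (ess_bounded_ring M)"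
proof -
  have [measurable]: "f \<in> measurable M (count_space UNIV)"
    using assms by (auto simp: carrier_ess_bounded_ring)
  show ?thesis
    using assms by (auto simp: carrier_ess_bounded_ring)
qed

lemma ess_bounded_diff:
  assumes "f \<in> carrier (ess_bounded_ring M)" "g \<in> carrier (ess_bounded_ring M)"
  shows "(\<lambda>\<omega>. f \<omega> - g \<omega>) \<in> carrier (ess_bounded_ring M)"
  using ess_bounded_add[OF assms(1) ess_bounded_minus[OF assms(2)]] by simp

lemma Linf_class_eq:
  assumes f: "f \<in> carrier (ess_bounded_ring M)"
  shows "Linf_class M f = {g \<in> carrier (ess_bounded_ring M). AE \<omega> in M. g \<omega> = f \<omega>}"
proof
  show "Linf_class M f \<subseteq> {g \<in> carrier (ess_bounded_ring M). AE \<omega> in M. g \<omega> = f \<omega>}"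
    using f by (auto simp: Linf_class_def a_r_coset_def' null_ideal_def ess_bounded_add)
  show "{g \<in> carrier (ess_bounded_ring M). AE \<omega> in M. g \<omega> = f \<omega>} \<subseteq> Linf_class M f"
  proof
    fix g assume g: "g \<in> {g \<in> carrier (ess_bounded_ring M). AE \<omega> in M. g \<omega> = f \<omega>}"
    then have "(\<lambda>\<omega>. g \<omega> - f \<omega>) \<in> null_ideal M"
      using f by (auto simp: null_ideal_def intro!: ess_bounded_diff)
    then show "g \<in> Linf_class M f"
      by (auto simp: Linf_class_def a_r_coset_def' intro!: bexI[of _ "\<lambda>\<omega>. g \<omega> - f \<omega>"])
  qed
qed

lemma Linf_class_eq_iff:
  assumes "f \<in> carrier (ess_bounded_ring M)" "g \<in> carrier (ess_bounded_ring M)"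
  shows "Linf_class M f = Linf_class M g \<longleftrightarrow> (AE \<omega> in M. f \<omega> = g \<omega>)"
proof
  assume "Linf_class M f = Linf_class M g"
  moreover have "f \<in> Linf_class M f"
    using assms by (simp add: Linf_class_eq)
  ultimately show "AE \<omega> in M. f \<omega> = g \<omega>"
    using assms by (simp add: Linf_class_eq)
next
  assume eq: "AE \<omega> in M. f \<omega> = g \<omega>"
  have "(AE \<omega> in M. h \<omega> = f \<omega>) \<longleftrightarrow> (AE \<omega> in M. h \<omega> = g \<omega>)" for h
    using eq by (auto elim: AE_mp)
  then show "Linf_class M f = Linf_class M g"
    using assms by (simp add: Linf_class_eq)
qed

lemma carrier_Linf_ring: "carrier (Linf_ring M) = Linf_class M ` carrier (ess_bounded_ring M)"
  by (auto simp: Linf_ring_def FactRing_def A_RCOSETS_def' Linf_class_def)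

lemma zero_Linf_ring: "\<zero>\<^bsub>Linf_ring M\<^esub> = Linf_class M (\<lambda>\<omega>. 0)"
  by (simp add: Linf_ring_def FactRing_def Linf_class_eq[OF ess_bounded_0] null_ideal_def)

lemma add_Linf_class:
  assumes f: "f \<in> carrier (ess_bounded_ring M)" and g: "g \<in> carrier (ess_bounded_ring M)"
  shows "Linf_class M f \<oplus>\<^bsub>Linf_ring M\<^esub> Linf_class M g = Linf_class M (\<lambda>\<omega>. f \<omega> + g \<omega>)"
proof -
  have "Linf_class M f \<oplus>\<^bsub>Linf_ring M\<^esub> Linf_class M g =
    {(\<lambda>\<omega>. h \<omega> + k \<omega>) |h k. h \<in> Linf_class M f \<and> k \<in> Linf_class M g}"
    by (auto simp: Linf_ring_def FactRing_def set_add_def')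
  also have "\<dots> = Linf_class M (\<lambda>\<omega>. f \<omega> + g \<omega>)"
  proof
    show "{(\<lambda>\<omega>. h \<omega> + k \<omega>) |h k. h \<in> Linf_class M f \<and> k \<in> Linf_class M g} \<subseteq>
        Linf_class M (\<lambda>\<omega>. f \<omega> + g \<omega>)"
      using f g by (auto simp: Linf_class_eq ess_bounded_add)
    show "Linf_class M (\<lambda>\<omega>. f \<omega> + g \<omega>) \<subseteq>
        {(\<lambda>\<omega>. h \<omega> + k \<omega>) |h k. h \<in> Linf_class M f \<and> k \<in> Linf_class M g}"
    proof
      fix x assume "x \<in> Linf_class M (\<lambda>\<omega>. f \<omega> + g \<omega>)"
      then have x: "x \<in> carrier (ess_bounded_ring M)" "AE \<omega> in M. x \<omega> = f \<omega> + g \<omega>"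
        using f g by (auto simp: Linf_class_eq ess_bounded_add)
      have "(\<lambda>\<omega>. x \<omega> - g \<omega>) \<in> Linf_class M f" "g \<in> Linf_class M g"
        using f g x by (auto simp: Linf_class_eq intro!: ess_bounded_diff)
      then show "x \<in> {(\<lambda>\<omega>. h \<omega> + k \<omega>) |h k. h \<in> Linf_class M f \<and> k \<in> Linf_class M g}"
        by (intro CollectI exI[of _ "\<lambda>\<omega>. x \<omega> - g \<omega>"] exI[of _ g]) auto
    qed
  qed
  finally show ?thesis .
qed

lemma abelian_group_Linf_ring: "abelian_group (Linf_ring M)"
proof (rule abelian_groupI)
  fix X assume "X \<in> carrier (Linf_ring M)"
  then obtain f where f: "f \<in> carrier (ess_bounded_ring M)" "X = Linf_class M f"
    by (auto simp: carrier_Linf_ring)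
  then have "Linf_class M (\<lambda>\<omega>. - f \<omega>) \<oplus>\<^bsub>Linf_ring M\<^esub> X = \<zero>\<^bsub>Linf_ring M\<^esub>"
    by (simp add: add_Linf_class ess_bounded_minus zero_Linf_ring)
  then show "\<exists>Y\<in>carrier (Linf_ring M). Y \<oplus>\<^bsub>Linf_ring M\<^esub> X = \<zero>\<^bsub>Linf_ring M\<^esub>"
    using f by (auto simp: carrier_Linf_ring ess_bounded_minus)
qed (auto simp: carrier_Linf_ring zero_Linf_ring add_Linf_class ess_bounded_add ess_bounded_0 ac_simps)

lemma minus_Linf_class:
  assumes "f \<in> carrier (ess_bounded_ring M)" "g \<in> carrier (ess_bounded_ring M)"
  shows "Linf_class M f \<ominus>\<^bsub>Linf_ring M\<^esub> Linf_class M g = Linf_class M (\<lambda>\<omega>. f \<omega> - g \<omega>)"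
proof -
  interpret abelian_group "Linf_ring M"
    by (rule abelian_group_Linf_ring)
  have "\<ominus>\<^bsub>Linf_ring M\<^esub> Linf_class M g = Linf_class M (\<lambda>\<omega>. - g \<omega>)"
    using assms
    by (intro minus_equality) (auto simp: add_Linf_class ess_bounded_minus zero_Linf_ring carrier_Linf_ring)
  then show ?thesis
    using assms by (simp add: minus_eq add_Linf_class ess_bounded_minus)
qed

lemma Linf_norm_le:
  assumes f: "f \<in> carrier (ess_bounded_ring M)" and "0 \<le> C" "AE \<omega> in M. \<bar>real_of_int (f \<omega>)\<bar> \<le> C"
  shows "Linf_norm M (Linf_class M f) \<le> C"
  unfolding Linf_norm_def
proof (rule cInf_lower)
  have "f \<in> Linf_class M f"
    using f by (simp add: Linf_class_eq)
  then show "C \<in> {C. 0 \<le> C \<and> (\<exists>f\<in>Linf_class M f. AE \<omega> in M. \<bar>real_of_int (f \<omega>)\<bar> \<le> C)}"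
    using assms by blast
  show "bdd_below {C. 0 \<le> C \<and> (\<exists>f\<in>Linf_class M f. AE \<omega> in M. \<bar>real_of_int (f \<omega>)\<bar> \<le> C)}"
    by (rule bdd_belowI[of _ 0]) auto
qed

text \<open>The strict inequality supplies a competitor below \<open>C\<close> in the infimum that
  defines the norm. Applied with a bound raised by 1, it turns a norm bound into a bound almost
  everywhere.\<close>

lemma AE_le_Linf_norm:
  assumes f: "f \<in> carrier (ess_bounded_ring M)" and C: "Linf_norm M (Linf_class M f) < C"
  shows "AE \<omega> in M. \<bar>real_of_int (f \<omega>)\<bar> \<le> C"
proof -
  let ?S = "{C. 0 \<le> C \<and> (\<exists>f\<in>Linf_class M f. AE \<omega> in M. \<bar>real_of_int (f \<omega>)\<bar> \<le> C)}"
  obtain D where D: "AE \<omega> in M. \<bar>f \<omega>\<bar> \<le> D"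
    using f by (auto simp: carrier_ess_bounded_ring)
  have "AE \<omega> in M. \<bar>real_of_int (f \<omega>)\<bar> \<le> real_of_int \<bar>D\<bar>"
    using D by eventually_elim linarith
  moreover have "f \<in> Linf_class M f"
    using f by (simp add: Linf_class_eq)
  ultimately have "real_of_int \<bar>D\<bar> \<in> ?S"
    by auto
  then have "?S \<noteq> {}"
    by blast
  then obtain B where "B \<in> ?S" "B < C"
    using cInf_lessD[OF _ C[unfolded Linf_norm_def]] by blast
  then obtain g where "AE \<omega> in M. g \<omega> = f \<omega>" "AE \<omega> in M. \<bar>real_of_int (g \<omega>)\<bar> \<le> B"
    using f by (auto simp: Linf_class_eq)
  then show ?thesis
    by eventually_elim (use \<open>B < C\<close> in auto)
qed

section \<open>Degree two bounded cohomology with essentially bounded coefficients\<close>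

context standard_borel_prob_gspace
begin

lemma group_\<Gamma>: "group \<Gamma>"
  using group_hom group_hom.axioms(1) by blast

lemma act_space: "\<gamma> \<in> carrier \<Gamma> \<Longrightarrow> \<omega> \<in> space M \<Longrightarrow> act \<gamma> \<omega> \<in> space M"
  using element_image by blast

lemma act_inv_act [simp]:
  assumes "\<gamma> \<in> carrier \<Gamma>" "\<omega> \<in> space M"
  shows "act (inv \<gamma>) (act \<gamma> \<omega>) = \<omega>"
  using orbit_sym_aux[OF assms refl] .

lemma act_act_inv [simp]:
  assumes "\<gamma> \<in> carrier \<Gamma>" "\<omega> \<in> space M"
  shows "act \<gamma> (act (inv \<gamma>) \<omega>) = \<omega>"
  using orbit_sym_aux[OF group.inv_closed[OF group_\<Gamma> assms(1)] assms(2) refl]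
  by (simp add: group.inv_inv[OF group_\<Gamma> assms(1)])

lemma AE_act:
  assumes "\<gamma> \<in> carrier \<Gamma>" "AE \<omega> in M. P \<omega>"
  shows "AE \<omega> in M. P (act \<gamma> \<omega>)"
  by (rule AE_distrD[OF act_measurable[OF assms(1)]]) (simp only: act_preserving[OF assms(1)] assms(2))

lemma AE_act_iff:
  assumes "\<gamma> \<in> carrier \<Gamma>"
  shows "(AE \<omega> in M. P (act \<gamma> \<omega>)) \<longleftrightarrow> (AE \<omega> in M. P \<omega>)"
proof
  assume "AE \<omega> in M. P (act \<gamma> \<omega>)"
  then have "AE \<omega> in M. P (act \<gamma> (act (inv \<gamma>) \<omega>))"
    using assms AE_act[of "inv \<gamma>" "\<lambda>\<omega>. P (act \<gamma> \<omega>)"] group.inv_closed[OF group_\<Gamma>] by blast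
  then show "AE \<omega> in M. P \<omega>"
    using AE_space by eventually_elim (simp add: assms)
qed (rule AE_act[OF assms])

lemma ess_bounded_act:
  assumes "f \<in> carrier (ess_bounded_ring M)" "\<gamma> \<in> carrier \<Gamma>"
  shows "(\<lambda>\<omega>. f (act \<gamma> \<omega>)) \<in> carrier (ess_bounded_ring M)"
  using assms measurable_compose[OF act_measurable, of \<gamma> f "count_space UNIV"]
    AE_act[OF assms(2), of "\<lambda>\<omega>. \<bar>f \<omega>\<bar> \<le> C" for C]
  by (auto simp: carrier_ess_bounded_ring)

text \<open>Representatives that agree almost everywhere still do so after translation, because the
  action preserves the measure. The set under \<open>the_elem\<close> is therefore a
  singleton.\<close>

lemma Linf_act_class:
  assumes f: "f \<in> carrier (ess_bounded_ring M)" and \<gamma>: "\<gamma> \<in> carrier \<Gamma>"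
  shows "Linf_act \<Gamma> M act \<gamma> (Linf_class M f) = Linf_class M (\<lambda>\<omega>. f (act (inv \<gamma>) \<omega>))"
proof -
  have i: "inv \<gamma> \<in> carrier \<Gamma>"
    using \<gamma> by (simp add: group.inv_closed[OF group_\<Gamma>])
  have "(\<lambda>g. Linf_class M (\<lambda>\<omega>. g (act (inv \<gamma>) \<omega>))) ` Linf_class M f =
    {Linf_class M (\<lambda>\<omega>. f (act (inv \<gamma>) \<omega>))}"
  proof -
    have "Linf_class M (\<lambda>\<omega>. g (act (inv \<gamma>) \<omega>)) = Linf_class M (\<lambda>\<omega>. f (act (inv \<gamma>) \<omega>))"
      if "g \<in> Linf_class M f" for g
      using that f i AE_act[OF i, of "\<lambda>\<omega>. g \<omega> = f \<omega>"]
      by (auto simp: Linf_class_eq_iff ess_bounded_act Linf_class_eq[OF f])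
    moreover have "f \<in> Linf_class M f"
      using f by (simp add: Linf_class_eq)
    ultimately show ?thesis
      by blast
  qed
  then show ?thesis
    unfolding Linf_act_def by simp
qed

text \<open>Cochains with values in classes are represented by families of functions, which turns
  cohomological identities into equations almost everywhere.\<close>

definition cochain1 :: "('g \<Rightarrow> 'w \<Rightarrow> int) \<Rightarrow> 'g list \<Rightarrow> ('w \<Rightarrow> int) set"
  where "cochain1 u = (\<lambda>gs\<in>tuples \<Gamma> 1. Linf_class M (u (hd gs)))"

definition cochain2 :: "('g \<Rightarrow> 'g \<Rightarrow> 'w \<Rightarrow> int) \<Rightarrow> 'g list \<Rightarrow> ('w \<Rightarrow> int) set"
  where "cochain2 E = (\<lambda>gs\<in>tuples \<Gamma> 2. Linf_class M (E (gs ! 0) (gs ! 1)))"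

text \<open>One constant serves all group elements, as boundedness of a cochain in the sup norm
  requires; the exceptional null set may depend on \<gamma>.\<close>

definition uniformly_bounded :: "('g \<Rightarrow> 'w \<Rightarrow> int) \<Rightarrow> bool"
  where "uniformly_bounded u \<longleftrightarrow> (\<exists>C. \<forall>\<gamma>\<in>carrier \<Gamma>.
    u \<gamma> \<in> measurable M (count_space UNIV) \<and> (AE \<omega> in M. \<bar>u \<gamma> \<omega>\<bar> \<le> C))"

definition delta1 :: "('g \<Rightarrow> 'w \<Rightarrow> int) \<Rightarrow> 'g \<Rightarrow> 'g \<Rightarrow> 'w \<Rightarrow> int"
  where "delta1 u \<gamma> \<eta> \<omega> = u \<eta> (act (inv \<gamma>) \<omega>) - u (\<gamma> \<otimes> \<eta>) \<omega> + u \<gamma> \<omega>"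

lemma uniformly_boundedD:
  "uniformly_bounded u \<Longrightarrow> \<gamma> \<in> carrier \<Gamma> \<Longrightarrow> u \<gamma> \<in> carrier (ess_bounded_ring M)"
  by (auto simp: uniformly_bounded_def carrier_ess_bounded_ring)

lemma ess_bounded_delta1:
  assumes "uniformly_bounded u" "\<gamma> \<in> carrier \<Gamma>" "\<eta> \<in> carrier \<Gamma>"
  shows "delta1 u \<gamma> \<eta> \<in> carrier (ess_bounded_ring M)"
proof -
  have "(\<lambda>\<omega>. u \<eta> (act (inv \<gamma>) \<omega>) + - u (\<gamma> \<otimes> \<eta>) \<omega> + u \<gamma> \<omega>) \<in> carrier (ess_bounded_ring M)"
    using assms group.inv_closed[OF group_\<Gamma>] monoid.m_closed[OF group.is_monoid[OF group_\<Gamma>]]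
    by (intro ess_bounded_add ess_bounded_minus ess_bounded_act uniformly_boundedD) auto
  then show ?thesis
    by (simp add: delta1_def[abs_def])
qed

text \<open>Representatives are chosen separately for each \<gamma>. The norm bound becomes a common
  essential bound, with 1 lost to the strict inequality in \<open>AE_le_Linf_norm\<close>.\<close>

lemma bounded_cochains_1:
  "bounded_cochains \<Gamma> (Linf_ring M) (Linf_norm M) 1 = cochain1 ` {u. uniformly_bounded u}"
proof
  show "cochain1 ` {u. uniformly_bounded u} \<subseteq> bounded_cochains \<Gamma> (Linf_ring M) (Linf_norm M) 1"
  proof clarify
    fix u assume u: "uniformly_bounded u"
    then obtain C where C: "\<And>\<gamma>. \<gamma> \<in> carrier \<Gamma> \<Longrightarrow> AE \<omega> in M. \<bar>u \<gamma> \<omega>\<bar> \<le> C"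
      by (auto simp: uniformly_bounded_def)
    have "Linf_norm M (Linf_class M (u \<gamma>)) \<le> real_of_int \<bar>C\<bar>" if "\<gamma> \<in> carrier \<Gamma>" for \<gamma>
    proof (rule Linf_norm_le[OF uniformly_boundedD[OF u that]])
      show "AE \<omega> in M. \<bar>real_of_int (u \<gamma> \<omega>)\<bar> \<le> real_of_int \<bar>C\<bar>"
        using C[OF that] by eventually_elim linarith
    qed simp
    then show "cochain1 u \<in> bounded_cochains \<Gamma> (Linf_ring M) (Linf_norm M) 1"
      using uniformly_boundedD[OF u]
      by (auto simp: bounded_cochains_def cochain1_def carrier_Linf_ring elim!: tuples_1E[simplified]
          intro!: exI[of _ "real_of_int \<bar>C\<bar>"])
  qed
  show "bounded_cochains \<Gamma> (Linf_ring M) (Linf_norm M) 1 \<subseteq> cochain1 ` {u. uniformly_bounded u}"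
  proof
    fix c assume c: "c \<in> bounded_cochains \<Gamma> (Linf_ring M) (Linf_norm M) 1"
    then obtain C where "\<forall>gs\<in>tuples \<Gamma> 1. Linf_norm M (c gs) \<le> C"
      by (auto simp: bounded_cochains_def)
    then have C: "Linf_norm M (c [\<gamma>]) \<le> C" if "\<gamma> \<in> carrier \<Gamma>" for \<gamma>
      using tuples_1[THEN iffD2, OF that] by blast
    have "\<forall>\<gamma>\<in>carrier \<Gamma>. \<exists>f. f \<in> carrier (ess_bounded_ring M) \<and> c [\<gamma>] = Linf_class M f"
    proof
      fix \<gamma> assume \<gamma>: "\<gamma> \<in> carrier \<Gamma>"
      have "c \<in> tuples \<Gamma> 1 \<rightarrow>\<^sub>E carrier (Linf_ring M)"
        using c by (simp add: bounded_cochains_def)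
      then have "c [\<gamma>] \<in> carrier (Linf_ring M)"
        by (rule PiE_mem) (rule tuples_1[THEN iffD2, OF \<gamma>])
      then show "\<exists>f. f \<in> carrier (ess_bounded_ring M) \<and> c [\<gamma>] = Linf_class M f"
        by (auto simp: carrier_Linf_ring)
    qed
    then obtain u where u: "\<And>\<gamma>. \<gamma> \<in> carrier \<Gamma> \<Longrightarrow>
        u \<gamma> \<in> carrier (ess_bounded_ring M) \<and> c [\<gamma>] = Linf_class M (u \<gamma>)"
      by metis
    have "AE \<omega> in M. \<bar>u \<gamma> \<omega>\<bar> \<le> \<lceil>C + 1\<rceil>" if "\<gamma> \<in> carrier \<Gamma>" for \<gamma>
    proof -
      have "AE \<omega> in M. \<bar>real_of_int (u \<gamma> \<omega>)\<bar> \<le> C + 1"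
        using C[OF that] u[OF that] by (intro AE_le_Linf_norm) auto
      then show ?thesis
        by eventually_elim linarith
    qed
    then have "uniformly_bounded u"
      using u by (auto simp: uniformly_bounded_def carrier_ess_bounded_ring)
    moreover have "c = cochain1 u"
      using c u by (auto simp: bounded_cochains_def cochain1_def fun_eq_iff PiE_iff extensional_def
          elim!: tuples_1E[simplified])
    ultimately show "c \<in> cochain1 ` {u. uniformly_bounded u}"
      by blast
  qed
qed

lemma coboundary_cochain1:
  assumes u: "uniformly_bounded u"
  shows "coboundary \<Gamma> (Linf_ring M) (Linf_act \<Gamma> M act) 1 (cochain1 u) = cochain2 (delta1 u)"
proof
  fix gs
  note [simp] = group.inv_closed[OF group_\<Gamma>] monoid.m_closed[OF group.is_monoid[OF group_\<Gamma>]]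
  show "coboundary \<Gamma> (Linf_ring M) (Linf_act \<Gamma> M act) 1 (cochain1 u) gs = cochain2 (delta1 u) gs"
  proof (cases "gs \<in> tuples \<Gamma> 2")
    case True
    then obtain \<gamma> \<eta> where gs: "gs = [\<gamma>, \<eta>]" "\<gamma> \<in> carrier \<Gamma>" "\<eta> \<in> carrier \<Gamma>"
      by (rule tuples_2E)
    note ub = uniformly_boundedD[OF u]
    have c: "cochain1 u [\<kappa>] = Linf_class M (u \<kappa>)" if "\<kappa> \<in> carrier \<Gamma>" for \<kappa>
      using that by (simp add: cochain1_def tuples_1[simplified])
    have a: "Linf_act \<Gamma> M act \<gamma> (Linf_class M (u \<eta>)) = Linf_class M (\<lambda>\<omega>. u \<eta> (act (inv \<gamma>) \<omega>))"
      using gs ub by (simp add: Linf_act_class)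
    have m: "(\<lambda>\<omega>. u \<eta> (act (inv \<gamma>) \<omega>) - u (\<gamma> \<otimes> \<eta>) \<omega>) \<in> carrier (ess_bounded_ring M)"
      using ess_bounded_add[OF ess_bounded_act[OF ub, of \<eta> "inv \<gamma>"] ess_bounded_minus[OF ub, of "\<gamma> \<otimes> \<eta>"]] gs
      by simp
    have "coboundary \<Gamma> (Linf_ring M) (Linf_act \<Gamma> M act) 1 (cochain1 u) [\<gamma>, \<eta>] =
      Linf_act \<Gamma> M act \<gamma> (cochain1 u [\<eta>]) \<ominus>\<^bsub>Linf_ring M\<^esub> cochain1 u [\<gamma> \<otimes> \<eta>]
        \<oplus>\<^bsub>Linf_ring M\<^esub> cochain1 u [\<gamma>]"
      using gs ub ess_bounded_act[OF ub]
      by (intro coboundary_1[OF abelian_group_Linf_ring])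
        (auto simp: a c carrier_Linf_ring)
    also have "\<dots> = Linf_class M (delta1 u \<gamma> \<eta>)"
      using gs ub ess_bounded_act[OF ub] m
      by (simp add: a c minus_Linf_class add_Linf_class delta1_def[abs_def])
    finally show ?thesis
      using gs by (simp add: cochain2_def tuples_2)
  next
    case False
    then show ?thesis
      by (simp add: coboundary_def cochain2_def numeral_2_eq_2)
  qed
qed

lemma bounded_coboundaries_2:
  "bounded_coboundaries \<Gamma> (Linf_ring M) (Linf_act \<Gamma> M act) (Linf_norm M) 2 =
    (\<lambda>u. cochain2 (delta1 u)) ` {u. uniformly_bounded u}"
proof -
  have "bounded_coboundaries \<Gamma> (Linf_ring M) (Linf_act \<Gamma> M act) (Linf_norm M) 2 =
      coboundary \<Gamma> (Linf_ring M) (Linf_act \<Gamma> M act) 1 ` cochain1 ` {u. uniformly_bounded u}"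
    unfolding bounded_coboundaries_def bounded_cochains_1[symmetric] by (simp add: numeral_2_eq_2)
  also have "\<dots> = (\<lambda>u. cochain2 (delta1 u)) ` {u. uniformly_bounded u}"
    unfolding image_image by (rule image_cong) (auto simp: coboundary_cochain1[simplified])
  finally show ?thesis .
qed

abbreviation ess_bounded2 :: "('g \<Rightarrow> 'g \<Rightarrow> 'w \<Rightarrow> int) \<Rightarrow> bool"
  where "ess_bounded2 E \<equiv>
    (\<forall>\<gamma>\<in>carrier \<Gamma>. \<forall>\<eta>\<in>carrier \<Gamma>. E \<gamma> \<eta> \<in> carrier (ess_bounded_ring M))"

lemma cochain2_eq_iff:
  assumes "ess_bounded2 E" "ess_bounded2 E'"
  shows "cochain2 E = cochain2 E' \<longleftrightarrow>
    (\<forall>\<gamma>\<in>carrier \<Gamma>. \<forall>\<eta>\<in>carrier \<Gamma>. AE \<omega> in M. E \<gamma> \<eta> \<omega> = E' \<gamma> \<eta> \<omega>)"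
proof -
  have "cochain2 E = cochain2 E' \<longleftrightarrow>
      (\<forall>\<gamma>\<in>carrier \<Gamma>. \<forall>\<eta>\<in>carrier \<Gamma>. Linf_class M (E \<gamma> \<eta>) = Linf_class M (E' \<gamma> \<eta>))"
  proof
    assume eq: "cochain2 E = cochain2 E'"
    show "\<forall>\<gamma>\<in>carrier \<Gamma>. \<forall>\<eta>\<in>carrier \<Gamma>. Linf_class M (E \<gamma> \<eta>) = Linf_class M (E' \<gamma> \<eta>)"
    proof (intro ballI)
      fix \<gamma> \<eta> assume "\<gamma> \<in> carrier \<Gamma>" "\<eta> \<in> carrier \<Gamma>"
      then show "Linf_class M (E \<gamma> \<eta>) = Linf_class M (E' \<gamma> \<eta>)"
        using fun_cong[OF eq, of "[\<gamma>, \<eta>]"] by (simp add: cochain2_def tuples_2)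
    qed
  next
    assume "\<forall>\<gamma>\<in>carrier \<Gamma>. \<forall>\<eta>\<in>carrier \<Gamma>. Linf_class M (E \<gamma> \<eta>) = Linf_class M (E' \<gamma> \<eta>)"
    then show "cochain2 E = cochain2 E'"
      unfolding cochain2_def by (intro restrict_ext) (auto elim!: tuples_2E)
  qed
  then show ?thesis
    using assms by (simp add: Linf_class_eq_iff)
qed

lemma cohomology_class_cochain2:
  assumes E: "ess_bounded2 E"
  shows "cohomology_class \<Gamma> (Linf_ring M) (Linf_act \<Gamma> M act) (Linf_norm M) 2 (cochain2 E) =
    (\<lambda>u. cochain2 (\<lambda>\<gamma> \<eta> \<omega>. delta1 u \<gamma> \<eta> \<omega> + E \<gamma> \<eta> \<omega>)) ` {u. uniformly_bounded u}"
proof -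
  have "(\<lambda>gs\<in>tuples \<Gamma> 2. cochain2 (delta1 u) gs \<oplus>\<^bsub>Linf_ring M\<^esub> cochain2 E gs) =
      cochain2 (\<lambda>\<gamma> \<eta> \<omega>. delta1 u \<gamma> \<eta> \<omega> + E \<gamma> \<eta> \<omega>)" if "uniformly_bounded u" for u
    unfolding cochain2_def using that E
    by (intro restrict_ext) (auto simp: tuples_2 add_Linf_class ess_bounded_delta1 elim!: tuples_2E)
  then show ?thesis
    unfolding cohomology_class_def r_coset_def bounded_coboundaries_2
    by (auto simp: cochain_group_def)
qed

lemma delta1_add: "delta1 (\<lambda>\<gamma> \<omega>. u \<gamma> \<omega> + v \<gamma> \<omega>) \<gamma> \<eta> \<omega> = delta1 u \<gamma> \<eta> \<omega> + delta1 v \<gamma> \<eta> \<omega>"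
  and delta1_minus: "delta1 (\<lambda>\<gamma> \<omega>. - u \<gamma> \<omega>) \<gamma> \<eta> \<omega> = - delta1 u \<gamma> \<eta> \<omega>"
  by (simp_all add: delta1_def)

lemma uniformly_bounded_add:
  assumes "uniformly_bounded u" "uniformly_bounded v"
  shows "uniformly_bounded (\<lambda>\<gamma> \<omega>. u \<gamma> \<omega> + v \<gamma> \<omega>)"
proof -
  obtain C D where CD: "\<And>\<gamma>. \<gamma> \<in> carrier \<Gamma> \<Longrightarrow> u \<gamma> \<in> measurable M (count_space UNIV)"
    "\<And>\<gamma>. \<gamma> \<in> carrier \<Gamma> \<Longrightarrow> v \<gamma> \<in> measurable M (count_space UNIV)"
    "\<And>\<gamma>. \<gamma> \<in> carrier \<Gamma> \<Longrightarrow> AE \<omega> in M. \<bar>u \<gamma> \<omega>\<bar> \<le> C"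
    "\<And>\<gamma>. \<gamma> \<in> carrier \<Gamma> \<Longrightarrow> AE \<omega> in M. \<bar>v \<gamma> \<omega>\<bar> \<le> D"
    using assms by (auto simp: uniformly_bounded_def)
  have "AE \<omega> in M. \<bar>u \<gamma> \<omega> + v \<gamma> \<omega>\<bar> \<le> C + D" if "\<gamma> \<in> carrier \<Gamma>" for \<gamma>
    using CD(3)[OF that] CD(4)[OF that] by eventually_elim linarith
  moreover have "(\<lambda>\<omega>. u \<gamma> \<omega> + v \<gamma> \<omega>) \<in> measurable M (count_space UNIV)" if "\<gamma> \<in> carrier \<Gamma>" for \<gamma>
  proof -
    note [measurable] = CD(1)[OF that] CD(2)[OF that]
    show ?thesis by measurable
  qed
  ultimately show ?thesis
    unfolding uniformly_bounded_def by blast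
qed

lemma uniformly_bounded_minus:
  assumes "uniformly_bounded u"
  shows "uniformly_bounded (\<lambda>\<gamma> \<omega>. - u \<gamma> \<omega>)"
proof -
  have meas: "(\<lambda>\<omega>. - u \<gamma> \<omega>) \<in> measurable M (count_space UNIV)"
    if [measurable]: "u \<gamma> \<in> measurable M (count_space UNIV)" for \<gamma>
    by measurable
  obtain C where "\<forall>\<gamma>\<in>carrier \<Gamma>. u \<gamma> \<in> measurable M (count_space UNIV) \<and> (AE \<omega> in M. \<bar>u \<gamma> \<omega>\<bar> \<le> C)"
    using assms by (auto simp: uniformly_bounded_def)
  then show ?thesis
    unfolding uniformly_bounded_def using meas by (intro exI[of _ C]) auto
qed

lemma uniformly_bounded_0: "uniformly_bounded (\<lambda>\<gamma> \<omega>. 0)"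
  by (auto simp: uniformly_bounded_def)

text \<open>The interface between cohomology and dynamics. A class is a coset of the coboundaries:
  membership of \<open>cochain2 E\<close> in its own coset, through the zero primitive, yields
  \<open>u\<close>, and conversely \<open>u\<close> and \<open>- u\<close> give the two
  inclusions.\<close>

lemma cohomology_class_eq_iff:
  assumes E: "ess_bounded2 E" and E': "ess_bounded2 E'"
  shows "cohomology_class \<Gamma> (Linf_ring M) (Linf_act \<Gamma> M act) (Linf_norm M) 2 (cochain2 E) =
      cohomology_class \<Gamma> (Linf_ring M) (Linf_act \<Gamma> M act) (Linf_norm M) 2 (cochain2 E') \<longleftrightarrow>
    (\<exists>u. uniformly_bounded u \<and> (\<forall>\<gamma>\<in>carrier \<Gamma>. \<forall>\<eta>\<in>carrier \<Gamma>. AE \<omega> in M.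
      E \<gamma> \<eta> \<omega> = delta1 u \<gamma> \<eta> \<omega> + E' \<gamma> \<eta> \<omega>))"
    (is "?K E = ?K E' \<longleftrightarrow> (\<exists>u. ?R E E' u)")
proof
  have bdd: "ess_bounded2 (\<lambda>\<gamma> \<eta> \<omega>. delta1 u \<gamma> \<eta> \<omega> + F \<gamma> \<eta> \<omega>)"
    if "uniformly_bounded u" "ess_bounded2 F" for u F
    using that by (auto intro: ess_bounded_add[OF ess_bounded_delta1])
  {
    assume "?K E = ?K E'"
    moreover have "cochain2 E \<in> ?K E"
      unfolding cohomology_class_cochain2[OF E]
      by (rule image_eqI[of _ _ "\<lambda>\<gamma> \<omega>. 0"]) (simp_all add: uniformly_bounded_0 delta1_def[abs_def])
    ultimately have "cochain2 E \<in> ?K E'"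
      by simp
    then obtain u where u: "uniformly_bounded u"
        "cochain2 E = cochain2 (\<lambda>\<gamma> \<eta> \<omega>. delta1 u \<gamma> \<eta> \<omega> + E' \<gamma> \<eta> \<omega>)"
      unfolding cohomology_class_cochain2[OF E'] by blast
    then have "?R E E' u"
      using cochain2_eq_iff[OF E bdd[OF u(1) E']] by simp
    then show "\<exists>u. ?R E E' u"
      by blast
  }
  have sub: "?K F \<subseteq> ?K F'" if F: "ess_bounded2 F" and F': "ess_bounded2 F'" and R: "?R F F' u" for F F' u
    unfolding cohomology_class_cochain2[OF F] cohomology_class_cochain2[OF F']
  proof (clarify, rule image_eqI)
    fix v assume v: "uniformly_bounded v"
    show w: "(\<lambda>\<gamma> \<omega>. v \<gamma> \<omega> + u \<gamma> \<omega>) \<in> {u. uniformly_bounded u}"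
      using v R by (simp add: uniformly_bounded_add)
    show "cochain2 (\<lambda>\<gamma> \<eta> \<omega>. delta1 v \<gamma> \<eta> \<omega> + F \<gamma> \<eta> \<omega>) =
        cochain2 (\<lambda>\<gamma> \<eta> \<omega>. delta1 (\<lambda>\<gamma> \<omega>. v \<gamma> \<omega> + u \<gamma> \<omega>) \<gamma> \<eta> \<omega> + F' \<gamma> \<eta> \<omega>)"
      using R
      by (subst cochain2_eq_iff[OF bdd[OF v F] bdd[OF w[simplified] F']]) (auto simp: delta1_add)
  qed
  assume "\<exists>u. ?R E E' u"
  then obtain u where u: "?R E E' u"
    by blast
  have "AE \<omega> in M. E' \<gamma> \<eta> \<omega> = delta1 (\<lambda>\<gamma> \<omega>. - u \<gamma> \<omega>) \<gamma> \<eta> \<omega> + E \<gamma> \<eta> \<omega>"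
    if "\<gamma> \<in> carrier \<Gamma>" "\<eta> \<in> carrier \<Gamma>" for \<gamma> \<eta>
  proof -
    have "AE \<omega> in M. E \<gamma> \<eta> \<omega> = delta1 u \<gamma> \<eta> \<omega> + E' \<gamma> \<eta> \<omega>"
      using u that by blast
    then show ?thesis
      by eventually_elim (simp add: delta1_minus)
  qed
  then have "?R E' E (\<lambda>\<gamma> \<omega>. - u \<gamma> \<omega>)"
    using u by (simp add: uniformly_bounded_minus)
  then show "?K E = ?K E'"
    using sub[OF E E' u] sub[OF E' E] by blast
qed

lemma one_Linf_H2b:
  "\<one>\<^bsub>Linf_H2b \<Gamma> M act\<^esub> =
    cohomology_class \<Gamma> (Linf_ring M) (Linf_act \<Gamma> M act) (Linf_norm M) 2 (cochain2 (\<lambda>\<gamma> \<eta> \<omega>. 0))"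
  by (simp add: Linf_H2b_def bounded_cohomology_def FactGroup_def bounded_coboundaries_2
      cohomology_class_cochain2 ess_bounded_0)

end

section \<open>The parametrized Euler class\<close>

lemma coboundary_int_ring:
  assumes "f \<in> homeo_circle" "g \<in> homeo_circle"
  shows "coboundary homeo_group \<Z> (\<lambda>_ k. k) 1 c [f, g] = c [g] - c [f \<circ> g] + c [f]"
proof -
  have "coboundary homeo_group \<Z> (\<lambda>_ k. k) 1 c [f, g] =
      (\<lambda>_ k. k) f (c [g]) \<ominus>\<^bsub>\<Z>\<^esub> c [f \<otimes>\<^bsub>homeo_group\<^esub> g] \<oplus>\<^bsub>\<Z>\<^esub> c [f]"
    by (rule coboundary_1) (use assms in \<open>auto intro: int.abelian_group_axioms\<close>)
  then show ?thesis
    by (simp add: int_a_minus_eq)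
qed

lemma bounded_euler_class_eq:
  "bounded_euler_class =
    (\<lambda>c. \<lambda>gs\<in>tuples homeo_group 2.
      coboundary homeo_group \<Z> (\<lambda>_ k. k) 1 c gs + euler_cocycle gs) `
    bounded_cochains homeo_group \<Z> (\<lambda>k. \<bar>real_of_int k\<bar>) 1"
  by (auto simp: bounded_euler_class_def cohomology_class_def r_coset_def bounded_coboundaries_def
      cochain_group_def numeral_2_eq_2)

lemma bounded_euler_classE:
  assumes "\<psi> \<in> bounded_euler_class"
  obtains b C where "\<And>f. f \<in> homeo_circle \<Longrightarrow> \<bar>b f\<bar> \<le> (C :: int)"
    "\<And>f g. f \<in> homeo_circle \<Longrightarrow> g \<in> homeo_circle \<Longrightarrow>
      \<psi> [f, g] = b g - b (f \<circ> g) + b f + euler_cocycle [f, g]"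
proof -
  obtain c where c: "c \<in> bounded_cochains homeo_group \<Z> (\<lambda>k. \<bar>real_of_int k\<bar>) 1"
    and \<psi>: "\<psi> = (\<lambda>gs\<in>tuples homeo_group 2.
      coboundary homeo_group \<Z> (\<lambda>_ k. k) 1 c gs + euler_cocycle gs)"
    using assms unfolding bounded_euler_class_eq by blast
  obtain C where C: "\<forall>gs\<in>tuples homeo_group 1. \<bar>real_of_int (c gs)\<bar> \<le> C"
    using c by (auto simp: bounded_cochains_def)
  have "\<bar>c [f]\<bar> \<le> \<lceil>C\<rceil>" if "f \<in> homeo_circle" for f
  proof -
    have "\<bar>real_of_int (c [f])\<bar> \<le> C"
      using C tuples_1[of f homeo_group] that by auto
    then show ?thesis
      by linarith
  qed
  moreover have "\<psi> [f, g] = c [g] - c [f \<circ> g] + c [f] + euler_cocycle [f, g]"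
    if "f \<in> homeo_circle" "g \<in> homeo_circle" for f g
    using that by (simp add: \<psi> tuples_2 coboundary_int_ring[simplified])
  ultimately show ?thesis
    using that[of "\<lambda>f. c [f]"] by blast
qed

lemma euler_cocycle_in_class: "euler_cocycle \<in> bounded_euler_class"
  unfolding bounded_euler_class_eq
proof (rule image_eqI)
  show "(\<lambda>gs\<in>tuples homeo_group 1. 0) \<in> bounded_cochains homeo_group \<Z> (\<lambda>k. \<bar>real_of_int k\<bar>) 1"
    by (auto simp: bounded_cochains_def intro!: exI[of _ 0])
  show "euler_cocycle = (\<lambda>gs\<in>tuples homeo_group 2.
      coboundary homeo_group \<Z> (\<lambda>_ k. k) 1 (\<lambda>gs\<in>tuples homeo_group 1. 0) gs + euler_cocycle gs)"
  proof
    fix gs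
    show "euler_cocycle gs = (\<lambda>gs\<in>tuples homeo_group 2.
      coboundary homeo_group \<Z> (\<lambda>_ k. k) 1 (\<lambda>gs\<in>tuples homeo_group 1. 0) gs + euler_cocycle gs) gs"
    proof (cases "gs \<in> tuples homeo_group 2")
      case True
      then obtain f g where "gs = [f, g]" "f \<in> homeo_circle" "g \<in> homeo_circle"
        by (auto elim: tuples_2E)
      then show ?thesis
        using True coboundary_int_ring[of f g "\<lambda>gs\<in>tuples homeo_group 1. 0"] homeo_circle_comp[of f g]
        by (simp add: tuples_1[simplified])
    next
      case False
      then show ?thesis
        by (simp add: euler_cocycle_def)
    qed
  qed
qed

text \<open>The cocycle identity telescopes along the powers of \<open>f\<close>, so that \<open>b f\<close> is the nearest
  integer to an average of Borel functions.\<close>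

lemma measurable_bounded_primitive:
  assumes b: "\<And>f. f \<in> homeo_circle \<Longrightarrow> \<bar>b f\<bar> \<le> (C :: int)"
    and \<beta>: "\<And>f g. f \<in> homeo_circle \<Longrightarrow> g \<in> homeo_circle \<Longrightarrow> \<beta> f g = b g - b (f \<circ> g) + b f"
    and meas: "(\<lambda>(f, g). \<beta> f g) \<in> measurable (homeo_borel \<Otimes>\<^sub>M homeo_borel) (count_space UNIV)"
    and f: "f \<in> measurable M homeo_borel"
  shows "(\<lambda>\<omega>. b (f \<omega>)) \<in> measurable M (count_space UNIV)"
proof -
  have C: "0 \<le> C"
    using b[OF id_homeo_circle] by linarith
  have pow: "(\<lambda>\<omega>. f \<omega> ^^ n) \<in> measurable M homeo_borel" for n
  proof (induction n)
    case 0
    show ?case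
      by (rule measurable_homeo_borelI) (simp_all add: id_homeo_circle[unfolded id_def])
  next
    case (Suc n)
    then show ?case
      using measurable_homeo_borel_comp[OF f Suc] by (simp add: comp_def)
  qed
  have \<beta>_meas: "(\<lambda>\<omega>. \<beta> (f \<omega> ^^ n) (f \<omega>)) \<in> measurable M (count_space UNIV)" for n
    using measurable_compose[OF measurable_Pair[OF pow[of n] f] meas] by simp
  \<comment> \<open>After telescoping, the sum is \<open>n\<close> times \<open>b f\<close> plus an
    error in [-2C, 2C]. Shifted by 2C the error lies in [0, 4C], below \<open>n\<close>, so integer
    division returns \<open>b f\<close> exactly.\<close>
  define n where "n = 4 * nat C + 1"
  define S where "S \<omega> = (\<Sum>i<n. \<beta> (f \<omega> ^^ Suc i) (f \<omega>))" for \<omega>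
  have "(\<lambda>\<omega>. \<Sum>i<m. \<beta> (f \<omega> ^^ Suc i) (f \<omega>)) \<in> measurable M (count_space UNIV)" for m
  proof (induction m)
    case (Suc m)
    note [measurable] = Suc \<beta>_meas[of "Suc m"]
    show ?case
      unfolding sum.lessThan_Suc by measurable
  qed simp
  then have [measurable]: "S \<in> measurable M (count_space UNIV)"
    by (simp add: S_def[abs_def] del: funpow.simps)
  have "(\<lambda>\<omega>. (S \<omega> + 2 * C) div int n) \<in> measurable M (count_space UNIV)"
    by measurable
  moreover have "(S \<omega> + 2 * C) div int n = b (f \<omega>)" if "\<omega> \<in> space M" for \<omega>
  proof -
    have H: "f \<omega> ^^ i \<in> homeo_circle" for i
      using measurable_space[OF pow that] by simp
    have f1: "f \<omega> \<in> homeo_circle"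
      using H[of 1] by simp
    have "(\<Sum>i<m. \<beta> (f \<omega> ^^ Suc i) (f \<omega>)) = int m * b (f \<omega>) + b (f \<omega>) - b (f \<omega> ^^ Suc m)" for m
    proof (induction m)
      case (Suc m)
      have "\<beta> (f \<omega> ^^ Suc m) (f \<omega>) = b (f \<omega>) - b (f \<omega> ^^ Suc (Suc m)) + b (f \<omega> ^^ Suc m)"
        using \<beta>[OF H f1, of "Suc m"] by (simp only: funpow_Suc_right[symmetric])
      then show ?case
        using Suc by (simp add: algebra_simps del: funpow.simps)
    qed simp
    then have "S \<omega> = int n * b (f \<omega>) + b (f \<omega>) - b (f \<omega> ^^ Suc n)"
      by (simp only: S_def)
    moreover have "\<bar>b (f \<omega>)\<bar> \<le> C" "\<bar>b (f \<omega> ^^ Suc n)\<bar> \<le> C"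
      using b[OF f1] b[OF H] by blast+
    ultimately have "S \<omega> + 2 * C = b (f \<omega>) * int n + (b (f \<omega>) - b (f \<omega> ^^ Suc n) + 2 * C)"
      "0 \<le> b (f \<omega>) - b (f \<omega> ^^ Suc n) + 2 * C" "b (f \<omega>) - b (f \<omega> ^^ Suc n) + 2 * C < int n"
      using C by (auto simp: n_def)
    then show ?thesis
      by (metis div_mult_self3 div_pos_pos_trivial add.commute add.right_neutral of_nat_0_le_iff less_le_trans not_less order_le_less)
  qed
  ultimately show ?thesis
    by (rule measurable_cong[THEN iffD1, rotated])
qed

context standard_borel_prob_gspace
begin

text \<open>Almost everywhere this is
  \<open>\<sigma> \<gamma> (act (inv \<gamma>) \<omega>)\<close>, the map from the fibre over
  \<gamma>\<inverse>\<omega> to the fibre over \<omega>. It is the entry at which the pullback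
  evaluates cochains, and in this form the cocycle identity matches the action on functions.\<close>

definition tau :: "('g \<Rightarrow> 'w \<Rightarrow> circle \<Rightarrow> circle) \<Rightarrow> 'g \<Rightarrow> 'w \<Rightarrow> circle \<Rightarrow> circle"
  where "tau \<sigma> \<gamma> \<omega> = inv\<^bsub>homeo_group\<^esub> (\<sigma> (inv\<^bsub>\<Gamma>\<^esub> \<gamma>) \<omega>)"

definition pull ::
    "('g \<Rightarrow> 'w \<Rightarrow> circle \<Rightarrow> circle) \<Rightarrow> ((circle \<Rightarrow> circle) list \<Rightarrow> int) \<Rightarrow> 'g \<Rightarrow> 'g \<Rightarrow> 'w \<Rightarrow> int"
  where "pull \<sigma> \<psi> \<gamma> \<eta> \<omega> = \<psi> [tau \<sigma> \<gamma> \<omega>, tau \<sigma> \<eta> (act (inv\<^bsub>\<Gamma>\<^esub> \<gamma>) \<omega>)]"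

lemma pullback_cochain_eq: "pullback_cochain \<Gamma> M act \<sigma> \<psi> = cochain2 (pull \<sigma> \<psi>)"
  by (simp add: pullback_cochain_def cochain2_def pull_def[abs_def] tau_def Let_def)

lemma inv_carrier [simp]: "\<gamma> \<in> carrier \<Gamma> \<Longrightarrow> inv \<gamma> \<in> carrier \<Gamma>"
  by (rule group.inv_closed[OF group_\<Gamma>])

lemma mult_carrier [simp]: "\<gamma> \<in> carrier \<Gamma> \<Longrightarrow> \<eta> \<in> carrier \<Gamma> \<Longrightarrow> \<gamma> \<otimes> \<eta> \<in> carrier \<Gamma>"
  by (rule monoid.m_closed[OF group.is_monoid[OF group_\<Gamma>]])

lemma inv_inv_carrier [simp]: "\<gamma> \<in> carrier \<Gamma> \<Longrightarrow> inv (inv \<gamma>) = \<gamma>"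
  by (rule group.inv_inv[OF group_\<Gamma>])

lemma measurable_cocycle_const:
  assumes "measurable_cocycle \<Gamma> M act \<sigma>" "\<gamma> \<in> carrier \<Gamma>"
  shows "\<sigma> \<gamma> \<in> measurable M homeo_borel"
proof -
  have "(\<lambda>\<omega>. (\<gamma>, \<omega>)) \<in> measurable M (count_space (carrier \<Gamma>) \<Otimes>\<^sub>M M)"
    using assms(2) by (intro measurable_Pair) auto
  then have "(\<lambda>\<omega>. (\<lambda>(\<gamma>, \<omega>). \<sigma> \<gamma> \<omega>) (\<gamma>, \<omega>)) \<in> measurable M homeo_borel"
    by (rule measurable_compose) (use assms(1) in \<open>simp add: measurable_cocycle_def\<close>)
  then show ?thesis
    by simp
qed

lemma cocycle_homeo_circle:
  "measurable_cocycle \<Gamma> M act \<sigma> \<Longrightarrow> \<gamma> \<in> carrier \<Gamma> \<Longrightarrow> \<omega> \<in> space M \<Longrightarrow> \<sigma> \<gamma> \<omega> \<in> homeo_circle"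
  using measurable_space[OF measurable_cocycle_const] by simp

lemma tau_eq:
  assumes "measurable_cocycle \<Gamma> M act \<sigma>" "\<gamma> \<in> carrier \<Gamma>" "\<omega> \<in> space M"
  shows "tau \<sigma> \<gamma> \<omega> = inv_fun (\<sigma> (inv \<gamma>) \<omega>)"
  using cocycle_homeo_circle[OF assms(1), of "inv \<gamma>" \<omega>] assms(2,3) by (simp add: tau_def)

lemma measurable_tau:
  assumes \<sigma>: "measurable_cocycle \<Gamma> M act \<sigma>" and \<gamma>: "\<gamma> \<in> carrier \<Gamma>"
  shows "tau \<sigma> \<gamma> \<in> measurable M homeo_borel"
proof -
  have "(\<lambda>\<omega>. inv_fun (\<sigma> (inv \<gamma>) \<omega>)) \<in> measurable M homeo_borel"
    using \<gamma> by (intro measurable_homeo_borel_inv measurable_cocycle_const[OF \<sigma>]) simp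
  then show ?thesis
    by (rule measurable_cong[THEN iffD1, rotated]) (simp add: tau_eq[OF \<sigma> \<gamma>])
qed

lemma tau_homeo_circle:
  "measurable_cocycle \<Gamma> M act \<sigma> \<Longrightarrow> \<gamma> \<in> carrier \<Gamma> \<Longrightarrow> \<omega> \<in> space M \<Longrightarrow> tau \<sigma> \<gamma> \<omega> \<in> homeo_circle"
  using measurable_space[OF measurable_tau] by simp

lemma measurable_tau_act:
  assumes \<sigma>: "measurable_cocycle \<Gamma> M act \<sigma>" and "\<gamma> \<in> carrier \<Gamma>" "\<eta> \<in> carrier \<Gamma>"
  shows "(\<lambda>\<omega>. tau \<sigma> \<eta> (act (inv \<gamma>) \<omega>)) \<in> measurable M homeo_borel"
  by (rule measurable_compose[OF act_measurable measurable_tau[OF \<sigma>]]) (use assms in auto)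

text \<open>Inverting the group elements reverses their order, and so does inverting the
  homeomorphisms; together they restore the order \<gamma>, \<eta>.\<close>

lemma AE_tau_mult:
  assumes \<sigma>: "measurable_cocycle \<Gamma> M act \<sigma>" and \<gamma>: "\<gamma> \<in> carrier \<Gamma>" and \<eta>: "\<eta> \<in> carrier \<Gamma>"
  shows "AE \<omega> in M. tau \<sigma> (\<gamma> \<otimes> \<eta>) \<omega> = tau \<sigma> \<gamma> \<omega> \<circ> tau \<sigma> \<eta> (act (inv \<gamma>) \<omega>)"
proof -
  have "AE \<omega> in M. \<sigma> (inv \<eta> \<otimes> inv \<gamma>) \<omega> = \<sigma> (inv \<eta>) (act (inv \<gamma>) \<omega>) \<circ> \<sigma> (inv \<gamma>) \<omega>"
    using \<sigma> \<gamma> \<eta> by (simp add: measurable_cocycle_def)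
  then show ?thesis
    using AE_space
  proof eventually_elim
    case (elim \<omega>)
    have "act (inv \<gamma>) \<omega> \<in> space M"
      using elim \<gamma> by (simp add: act_space)
    then have "\<sigma> (inv \<eta>) (act (inv \<gamma>) \<omega>) \<in> carrier homeo_group" "\<sigma> (inv \<gamma>) \<omega> \<in> carrier homeo_group"
      using elim \<gamma> \<eta> by (simp_all add: cocycle_homeo_circle[OF \<sigma>])
    from group.inv_mult_group[OF group_homeo_group this] show ?case
      using elim by (simp only: tau_def group.inv_mult_group[OF group_\<Gamma> \<gamma> \<eta>] mult_homeo_group)
  qed
qed

text \<open>The cocycle identity at (1, 1) makes \<open>\<sigma> \<one> \<omega>\<close> idempotent,
  hence the identity since it is invertible. The identity at (\<gamma>, \<gamma>\<inverse>) then
  exhibits the inverse.\<close>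

lemma AE_tau_eq:
  assumes \<sigma>: "measurable_cocycle \<Gamma> M act \<sigma>" and \<gamma>: "\<gamma> \<in> carrier \<Gamma>"
  shows "AE \<omega> in M. \<sigma> \<gamma> (act (inv \<gamma>) \<omega>) = tau \<sigma> \<gamma> \<omega>"
proof -
  interpret group \<Gamma>
    by (rule group_\<Gamma>)
  have coc: "AE \<omega> in M. \<sigma> (\<alpha> \<otimes> \<beta>) \<omega> = \<sigma> \<alpha> (act \<beta> \<omega>) \<circ> \<sigma> \<beta> \<omega>"
    if "\<alpha> \<in> carrier \<Gamma>" "\<beta> \<in> carrier \<Gamma>" for \<alpha> \<beta>
    using \<sigma> that unfolding measurable_cocycle_def by blast
  show ?thesis
    using coc[OF one_closed one_closed] coc[OF \<gamma> inv_closed[OF \<gamma>]] AE_space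
  proof eventually_elim
    case (elim \<omega>)
    have "act \<one> \<omega> = \<omega>"
      using elim by (simp add: id_eq_one[symmetric])
    then have 1: "\<sigma> \<one> \<omega> = \<sigma> \<one> \<omega> \<circ> \<sigma> \<one> \<omega>"
      using elim by simp
    have "\<sigma> \<one> \<omega> \<in> homeo_circle"
      using elim by (simp add: cocycle_homeo_circle[OF \<sigma>])
    note h = homeo_circle_inv[OF this]
    have "id = inv_fun (\<sigma> \<one> \<omega>) \<circ> (\<sigma> \<one> \<omega> \<circ> \<sigma> \<one> \<omega>)"
      using h(3) 1 by simp
    also have "\<dots> = \<sigma> \<one> \<omega>"
      unfolding comp_assoc[symmetric] h(3) by simp
    finally have "\<sigma> \<gamma> (act (inv \<gamma>) \<omega>) \<circ> \<sigma> (inv \<gamma>) \<omega> = id"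
      using elim \<gamma> by simp
    moreover have s: "\<sigma> (inv \<gamma>) \<omega> \<in> homeo_circle"
      using elim \<gamma> by (simp add: cocycle_homeo_circle[OF \<sigma>])
    ultimately have "\<sigma> \<gamma> (act (inv \<gamma>) \<omega>) = id \<circ> inv_fun (\<sigma> (inv \<gamma>) \<omega>)"
      using homeo_circle_inv(2)[OF s] by (metis comp_assoc comp_id)
    then show ?case
      using elim \<gamma> by (simp add: tau_eq[OF \<sigma>])
  qed
qed

lemma ess_bounded2_euler:
  assumes \<sigma>: "measurable_cocycle \<Gamma> M act \<sigma>"
  shows "ess_bounded2 (pull \<sigma> euler_cocycle)"
proof (intro ballI)
  fix \<gamma> \<eta> assume g: "\<gamma> \<in> carrier \<Gamma>" "\<eta> \<in> carrier \<Gamma>"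
  have "pull \<sigma> euler_cocycle \<gamma> \<eta> \<in> measurable M (count_space UNIV)"
    unfolding pull_def[abs_def] using g
    by (intro measurable_euler_cocycle_comp measurable_tau[OF \<sigma>] measurable_tau_act[OF \<sigma>])
  moreover have "AE \<omega> in M. \<bar>pull \<sigma> euler_cocycle \<gamma> \<eta> \<omega>\<bar> \<le> 1"
    using AE_space
  proof eventually_elim
    case (elim \<omega>)
    then have "act (inv \<gamma>) \<omega> \<in> space M"
      using g by (simp add: act_space)
    then show ?case
      using euler_cocycle_range[of "tau \<sigma> \<gamma> \<omega>" "tau \<sigma> \<eta> (act (inv \<gamma>) \<omega>)"] elim g
      by (simp add: pull_def tau_homeo_circle[OF \<sigma>] abs_le_iff)
  qed
  ultimately show "pull \<sigma> euler_cocycle \<gamma> \<eta> \<in> carrier (ess_bounded_ring M)"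
    by (auto simp: carrier_ess_bounded_ring)
qed

text \<open>Independence of the representative. Another Borel representative differs from the Euler
  cocycle by the coboundary of a bounded function \<open>b\<close> on the group;
  \<open>measurable_bounded_primitive\<close> makes \<open>b\<close> measurable along
  \<open>tau\<close>, so its pullback is a bounded primitive of the difference.\<close>

lemma cohomology_class_pull:
  assumes \<sigma>: "measurable_cocycle \<Gamma> M act \<sigma>" and \<psi>: "\<psi> \<in> bounded_euler_class"
    and meas: "(\<lambda>(f, g). \<psi> [f, g]) \<in> measurable (homeo_borel \<Otimes>\<^sub>M homeo_borel) (count_space UNIV)"
  shows "cohomology_class \<Gamma> (Linf_ring M) (Linf_act \<Gamma> M act) (Linf_norm M) 2 (cochain2 (pull \<sigma> \<psi>)) =
    cohomology_class \<Gamma> (Linf_ring M) (Linf_act \<Gamma> M act) (Linf_norm M) 2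
      (cochain2 (pull \<sigma> euler_cocycle))"
proof -
  obtain b C where b: "\<And>f. f \<in> homeo_circle \<Longrightarrow> \<bar>b f\<bar> \<le> (C :: int)"
    "\<And>f g. f \<in> homeo_circle \<Longrightarrow> g \<in> homeo_circle \<Longrightarrow>
      \<psi> [f, g] = b g - b (f \<circ> g) + b f + euler_cocycle [f, g]"
    using bounded_euler_classE[OF \<psi>] by metis
  have "(\<lambda>x. (case x of (f, g) \<Rightarrow> \<psi> [f, g]) - (case x of (f, g) \<Rightarrow> euler_cocycle [f, g]))
      \<in> measurable (homeo_borel \<Otimes>\<^sub>M homeo_borel) (count_space UNIV)"
    using meas measurable_euler_cocycle by measurable
  then have \<beta>: "(\<lambda>(f, g). \<psi> [f, g] - euler_cocycle [f, g])
      \<in> measurable (homeo_borel \<Otimes>\<^sub>M homeo_borel) (count_space UNIV)"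
    by (simp add: split_beta)
  define u where "u \<gamma> \<omega> = b (tau \<sigma> \<gamma> \<omega>)" for \<gamma> \<omega>
  have u_meas: "u \<gamma> \<in> measurable M (count_space UNIV)" if "\<gamma> \<in> carrier \<Gamma>" for \<gamma>
    unfolding u_def[abs_def]
    by (rule measurable_bounded_primitive[OF b(1) _ \<beta> measurable_tau[OF \<sigma> that]]) (simp_all add: b(2) comp_def)
  have "AE \<omega> in M. \<bar>u \<gamma> \<omega>\<bar> \<le> C" if "\<gamma> \<in> carrier \<Gamma>" for \<gamma>
    using AE_space by eventually_elim (simp add: u_def b(1) tau_homeo_circle[OF \<sigma> that])
  then have u: "uniformly_bounded u"
    using u_meas unfolding uniformly_bounded_def by blast
  have eq: "AE \<omega> in M. pull \<sigma> \<psi> \<gamma> \<eta> \<omega> = delta1 u \<gamma> \<eta> \<omega> + pull \<sigma> euler_cocycle \<gamma> \<eta> \<omega>"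
    if g: "\<gamma> \<in> carrier \<Gamma>" "\<eta> \<in> carrier \<Gamma>" for \<gamma> \<eta>
    using AE_tau_mult[OF \<sigma> g] AE_space
  proof eventually_elim
    case (elim \<omega>)
    then have "act (inv \<gamma>) \<omega> \<in> space M"
      using g by (simp add: act_space)
    then show ?case
      using elim g by (simp add: pull_def b(2) tau_homeo_circle[OF \<sigma>] delta1_def u_def)
  qed
  have "ess_bounded2 (pull \<sigma> \<psi>)"
  proof (intro ballI)
    fix \<gamma> \<eta> assume g: "\<gamma> \<in> carrier \<Gamma>" "\<eta> \<in> carrier \<Gamma>"
    have "(\<lambda>\<omega>. delta1 u \<gamma> \<eta> \<omega> + pull \<sigma> euler_cocycle \<gamma> \<eta> \<omega>) \<in> carrier (ess_bounded_ring M)"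
      using ess_bounded2_euler[OF \<sigma>] g ess_bounded_delta1[OF u g] by (intro ess_bounded_add) auto
    then obtain D where D: "AE \<omega> in M. \<bar>delta1 u \<gamma> \<eta> \<omega> + pull \<sigma> euler_cocycle \<gamma> \<eta> \<omega>\<bar> \<le> D"
      by (auto simp: carrier_ess_bounded_ring)
    have "AE \<omega> in M. \<bar>pull \<sigma> \<psi> \<gamma> \<eta> \<omega>\<bar> \<le> D"
      using D eq[OF g] by eventually_elim simp
    moreover have "pull \<sigma> \<psi> \<gamma> \<eta> \<in> measurable M (count_space UNIV)"
      using measurable_compose[OF measurable_Pair[OF measurable_tau[OF \<sigma> g(1)] measurable_tau_act[OF \<sigma> g]] meas]
      by (simp add: pull_def[abs_def])
    ultimately show "pull \<sigma> \<psi> \<gamma> \<eta> \<in> carrier (ess_bounded_ring M)"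
      by (auto simp: carrier_ess_bounded_ring)
  qed
  then show ?thesis
    using cohomology_class_eq_iff[OF _ ess_bounded2_euler[OF \<sigma>], of "pull \<sigma> \<psi>"] u eq by blast
qed

text \<open>The Euler cocycle is itself a Borel representative, so the set of candidate classes is
  nonempty and, by \<open>cohomology_class_pull\<close>, a singleton.\<close>

lemma H2b_pullback_euler:
  assumes \<sigma>: "measurable_cocycle \<Gamma> M act \<sigma>"
  shows "H2b_pullback \<Gamma> M act \<sigma> bounded_euler_class =
    cohomology_class \<Gamma> (Linf_ring M) (Linf_act \<Gamma> M act) (Linf_norm M) 2
      (cochain2 (pull \<sigma> euler_cocycle))"
proof -
  have "(\<lambda>\<psi>. cohomology_class \<Gamma> (Linf_ring M) (Linf_act \<Gamma> M act) (Linf_norm M) 2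
              (pullback_cochain \<Gamma> M act \<sigma> \<psi>)) `
      {\<psi> \<in> bounded_euler_class.
        (\<lambda>(f, g). \<psi> [f, g]) \<in> measurable (homeo_borel \<Otimes>\<^sub>M homeo_borel) (count_space UNIV)} =
    {cohomology_class \<Gamma> (Linf_ring M) (Linf_act \<Gamma> M act) (Linf_norm M) 2
      (cochain2 (pull \<sigma> euler_cocycle))}" (is "?f ` ?S = {?c}")
  proof -
    have "euler_cocycle \<in> ?S"
      using euler_cocycle_in_class measurable_euler_cocycle by blast
    moreover have "?f \<psi> = ?c" if "\<psi> \<in> ?S" for \<psi>
      using that cohomology_class_pull[OF \<sigma>, of \<psi>] by (simp add: pullback_cochain_eq)
    ultimately show ?thesis
      by blast
  qed
  then show ?thesis
    unfolding H2b_pullback_def by simp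
qed

lemma H2b_pullback_eq_iff:
  assumes "measurable_cocycle \<Gamma> M act \<sigma>\<^sub>1" "measurable_cocycle \<Gamma> M act \<sigma>\<^sub>2"
  shows "H2b_pullback \<Gamma> M act \<sigma>\<^sub>1 bounded_euler_class = H2b_pullback \<Gamma> M act \<sigma>\<^sub>2 bounded_euler_class \<longleftrightarrow>
    (\<exists>u. uniformly_bounded u \<and> (\<forall>\<gamma>\<in>carrier \<Gamma>. \<forall>\<eta>\<in>carrier \<Gamma>. AE \<omega> in M.
      pull \<sigma>\<^sub>1 euler_cocycle \<gamma> \<eta> \<omega> = delta1 u \<gamma> \<eta> \<omega> + pull \<sigma>\<^sub>2 euler_cocycle \<gamma> \<eta> \<omega>))"
  unfolding H2b_pullback_euler[OF assms(1)] H2b_pullback_euler[OF assms(2)]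
  by (rule cohomology_class_eq_iff[OF ess_bounded2_euler[OF assms(1)] ess_bounded2_euler[OF assms(2)]])

lemma H2b_pullback_eq_one_iff:
  assumes "measurable_cocycle \<Gamma> M act \<sigma>"
  shows "H2b_pullback \<Gamma> M act \<sigma> bounded_euler_class = \<one>\<^bsub>Linf_H2b \<Gamma> M act\<^esub> \<longleftrightarrow>
    (\<exists>u. uniformly_bounded u \<and> (\<forall>\<gamma>\<in>carrier \<Gamma>. \<forall>\<eta>\<in>carrier \<Gamma>. AE \<omega> in M.
      pull \<sigma> euler_cocycle \<gamma> \<eta> \<omega> = delta1 u \<gamma> \<eta> \<omega>))"
  unfolding H2b_pullback_euler[OF assms] one_Linf_H2b
  using cohomology_class_eq_iff[OF ess_bounded2_euler[OF assms], of "\<lambda>\<gamma> \<eta> \<omega>. 0"]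
  by (simp add: ess_bounded_0)

end

section \<open>Equivariant points and semiconjugacies\<close>

lemma countable_carrier_if_finitely_generated:
  assumes "finitely_generated G"
  shows "countable (carrier G)"
proof -
  obtain S where S: "finite S" "generate G S = carrier G"
    using assms by (auto simp: finitely_generated_def)
  \<comment> \<open>Products of bracketing depth at most \<open>n\<close> in the generators, their
    inverses and 1; doubling the words at each stage matches the product rule of
    \<open>generate\<close>.\<close>
  define A where "A n = ((\<lambda>A. A \<union> (\<lambda>(a, b). a \<otimes>\<^bsub>G\<^esub> b) ` (A \<times> A)) ^^ n)
    ({\<one>\<^bsub>G\<^esub>} \<union> S \<union> m_inv G ` S)" for n
  have A_Suc: "A (Suc n) = A n \<union> (\<lambda>(a, b). a \<otimes>\<^bsub>G\<^esub> b) ` (A n \<times> A n)" for n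
    by (simp add: A_def)
  have count: "countable (A n)" for n
  proof (induction n)
    case 0
    show ?case
      using S(1) by (simp add: A_def countable_finite)
  next
    case (Suc n)
    then show ?case
      by (simp add: A_Suc)
  qed
  have A_mono: "A m \<subseteq> A n" if "m \<le> n" for m n
    using that by (rule lift_Suc_mono_le[rotated]) (auto simp: A_Suc)
  have "g \<in> (\<Union>n. A n)" if "g \<in> generate G S" for g
    using that
  proof induction
    case (eng h k)
    then obtain m n where "h \<in> A m" "k \<in> A n"
      by blast
    then have "h \<in> A (max m n)" "k \<in> A (max m n)"
      using A_mono[of m "max m n"] A_mono[of n "max m n"] by auto
    then have "h \<otimes>\<^bsub>G\<^esub> k \<in> A (Suc (max m n))"
      by (auto simp: A_Suc)
    then show ?case
      by blast
  qed (auto simp: A_def intro!: exI[of _ 0])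
  then have "carrier G \<subseteq> (\<Union>n. A n)"
    using S(2) by blast
  then show ?thesis
    using count by (meson countable_UN countableI_type countable_subset)
qed

text \<open>The displacement is periodic, and over one period it stays within 1 of its value at
  0.\<close>

lemma homeo_Z_real_dist:
  assumes F: "F \<in> homeo_Z_real" and C: "\<bar>F 0\<bar> \<le> C"
  shows "\<bar>F t - t\<bar> \<le> C + 1"
proof -
  have "F t = F (frac t) + of_int \<lfloor>t\<rfloor>"
    using homeo_Z_real_add_of_int[OF F, of "frac t" "\<lfloor>t\<rfloor>"] by (simp add: frac_def)
  moreover have "F (frac t) - frac t = F t - t"
    using calculation by (simp add: frac_def)
  ultimately show ?thesis
    using homeo_Z_real_frac_bounds[OF F, of t] C frac_ge_0[of t] frac_lt_1[of t] by linarith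
qed

lemma homeo_Z_real_inv_dist:
  assumes F: "F \<in> homeo_Z_real" and C: "\<bar>F 0\<bar> \<le> C"
  shows "\<bar>inv_fun F t - t\<bar> \<le> C + 1"
  using homeo_Z_real_dist[OF assms, of "inv_fun F t"] by (simp add: homeo_Z_real_inv_right[OF F])

lemma homeo_Z_real_add_const:
  assumes "F \<in> homeo_Z_real"
  shows "(\<lambda>t. F t + of_int n) \<in> homeo_Z_real"
  using homeo_Z_real_comp[OF translation_homeo_Z_real[of n] assms]
  by (simp add: translation_def comp_def)

text \<open>Increasing continuous maps commute with bounded suprema; this moves a lift inside the
  supremum in Ghys' construction.\<close>

lemma homeo_Z_real_cSUP:
  assumes F: "F \<in> homeo_Z_real" and "I \<noteq> {}" "bdd_above (f ` I)"
  shows "F (SUP i\<in>I. f i) = (SUP i\<in>I. F (f i))"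
proof -
  have "F (Sup (f ` I)) = (SUP x\<in>f ` I. F x)"
  proof (rule continuous_at_Sup_mono)
    show "mono F"
      by (rule monoI) (simp add: homeo_Z_real_le_iff[OF F])
    show "continuous (at_left (Sup (f ` I))) F"
      using homeo_Z_real_continuous[OF F]
      by (meson UNIV_I continuous_at_imp_continuous_at_within continuous_on_eq_continuous_at open_UNIV)
  qed (use assms in auto)
  then show ?thesis
    by (simp add: image_image)
qed

section \<open>Normalised lifts along the action and their use for both implications\<close>

context standard_borel_prob_gspace
begin

definition tau_lift :: "('g \<Rightarrow> 'w \<Rightarrow> circle \<Rightarrow> circle) \<Rightarrow> 'g \<Rightarrow> 'w \<Rightarrow> real \<Rightarrow> real"
  where "tau_lift \<sigma> \<gamma> \<omega> = lift_section (tau \<sigma> \<gamma> \<omega>)"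

lemma act_inv_space [simp]: "\<gamma> \<in> carrier \<Gamma> \<Longrightarrow> \<omega> \<in> space M \<Longrightarrow> act (inv \<gamma>) \<omega> \<in> space M"
  by (simp add: act_space)

lemma act_inv_mult:
  assumes "\<gamma> \<in> carrier \<Gamma>" "\<eta> \<in> carrier \<Gamma>" "\<omega> \<in> space M"
  shows "act (inv (\<gamma> \<otimes> \<eta>)) \<omega> = act (inv \<eta>) (act (inv \<gamma>) \<omega>)"
  using assms by (simp add: group.inv_mult_group[OF group_\<Gamma>] composition_rule)

lemma AE_act_inv: "\<gamma> \<in> carrier \<Gamma> \<Longrightarrow> AE \<omega> in M. P \<omega> \<Longrightarrow> AE \<omega> in M. P (act (inv \<gamma>) \<omega>)"
  by (rule AE_act) simp_all

context
  fixes \<sigma>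
  assumes \<sigma>: "measurable_cocycle \<Gamma> M act \<sigma>"
begin

lemma
  assumes "\<gamma> \<in> carrier \<Gamma>" "\<omega> \<in> space M"
  shows tau_lift_homeo_Z_real: "tau_lift \<sigma> \<gamma> \<omega> \<in> homeo_Z_real"
    and tau_lift_0: "0 \<le> tau_lift \<sigma> \<gamma> \<omega> 0" "tau_lift \<sigma> \<gamma> \<omega> 0 < 1"
    and to_circle_tau_lift: "to_circle (tau_lift \<sigma> \<gamma> \<omega> t) = tau \<sigma> \<gamma> \<omega> (to_circle t)"
  using lift_section[OF tau_homeo_circle[OF \<sigma> assms]]
    to_circle_lift_section[OF tau_homeo_circle[OF \<sigma> assms]] by (simp_all add: tau_lift_def)

lemma measurable_tau_lift:
  assumes "\<gamma> \<in> carrier \<Gamma>" "g \<in> borel_measurable M"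
  shows "(\<lambda>\<omega>. tau_lift \<sigma> \<gamma> \<omega> (g \<omega>)) \<in> borel_measurable M"
  unfolding tau_lift_def by (rule measurable_lift_section[OF measurable_tau[OF \<sigma> assms(1)] assms(2)])

lemma AE_tau_lift_mult:
  assumes g: "\<gamma> \<in> carrier \<Gamma>" "\<eta> \<in> carrier \<Gamma>"
  shows "AE \<omega> in M. \<forall>t. tau_lift \<sigma> \<gamma> \<omega> (tau_lift \<sigma> \<eta> (act (inv \<gamma>) \<omega>) t) =
    tau_lift \<sigma> (\<gamma> \<otimes> \<eta>) \<omega> t + of_int (pull \<sigma> euler_cocycle \<gamma> \<eta> \<omega>)"
  using AE_tau_mult[OF \<sigma> g] AE_space
proof eventually_elim
  case (elim \<omega>)
  show ?case
    unfolding tau_lift_def pull_def elim(1)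
    using lift_section_euler_cocycle(1)[OF tau_homeo_circle[OF \<sigma> g(1) elim(2)]
        tau_homeo_circle[OF \<sigma> g(2) act_inv_space[OF g(1) elim(2)]]] by blast
qed

text \<open>With \<open>s\<close> in [0, 1) lifting \<open>r\<close>, equivariance holds up to an
  integer \<open>u \<gamma> \<omega>\<close>. Applying the lifts of \<eta> and \<gamma> in turn, or
  the lift of the product, to the same point exhibits the Euler cocycle as the coboundary of
  \<open>u\<close>.\<close>

lemma trivial_euler_if_equivariant_point:
  assumes [measurable]: "r \<in> borel_measurable M"
    and r: "\<And>\<gamma>. \<gamma> \<in> carrier \<Gamma> \<Longrightarrow> AE \<omega> in M. r \<omega> = tau \<sigma> \<gamma> \<omega> (r (act (inv \<gamma>) \<omega>))"
  shows "\<exists>u. uniformly_bounded u \<and> (\<forall>\<gamma>\<in>carrier \<Gamma>. \<forall>\<eta>\<in>carrier \<Gamma>. AE \<omega> in M.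
      pull \<sigma> euler_cocycle \<gamma> \<eta> \<omega> = delta1 u \<gamma> \<eta> \<omega>)"
proof -
  define s where "s \<omega> = circle_coord (r \<omega>)" for \<omega>
  have s: "0 \<le> s \<omega>" "s \<omega> < 1" for \<omega>
    by (simp_all add: s_def)
  have [measurable]: "s \<in> borel_measurable M"
    unfolding s_def[abs_def] by measurable
  define u where "u \<gamma> \<omega> = \<lfloor>tau_lift \<sigma> \<gamma> \<omega> (s (act (inv \<gamma>) \<omega>))\<rfloor>" for \<gamma> \<omega>
  have eq: "AE \<omega> in M. tau_lift \<sigma> \<gamma> \<omega> (s (act (inv \<gamma>) \<omega>)) = s \<omega> + of_int (u \<gamma> \<omega>)"
    if \<gamma>: "\<gamma> \<in> carrier \<Gamma>" for \<gamma>
    using r[OF \<gamma>] AE_space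
  proof eventually_elim
    case (elim \<omega>)
    have "to_circle (tau_lift \<sigma> \<gamma> \<omega> (s (act (inv \<gamma>) \<omega>))) = r \<omega>"
      using elim by (simp add: to_circle_tau_lift[OF \<gamma>] s_def)
    then have "frac (tau_lift \<sigma> \<gamma> \<omega> (s (act (inv \<gamma>) \<omega>))) = s \<omega>"
      by (metis circle_coord_to_circle s_def)
    then show ?case
      by (simp add: u_def frac_def)
  qed
  have "uniformly_bounded u"
    unfolding uniformly_bounded_def
  \<comment> \<open>Whatever \<gamma> is, the normalised lift sends [0, 1) into [0, 2), so 2 bounds
    the floor uniformly.\<close>
  proof (intro exI[of _ 2] ballI conjI)
    fix \<gamma> assume \<gamma>: "\<gamma> \<in> carrier \<Gamma>"
    have "(\<lambda>\<omega>. s (act (inv \<gamma>) \<omega>)) \<in> borel_measurable M"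
      by (rule measurable_compose[OF act_measurable]) (use \<gamma> in auto)
    note [measurable] = measurable_tau_lift[OF \<gamma> this]
    show "u \<gamma> \<in> measurable M (count_space UNIV)"
      unfolding u_def[abs_def] by measurable
    show "AE \<omega> in M. \<bar>u \<gamma> \<omega>\<bar> \<le> 2"
      using AE_space
    proof eventually_elim
      case (elim \<omega>)
      have "frac (s (act (inv \<gamma>) \<omega>)) = s (act (inv \<gamma>) \<omega>)"
        using s by (simp add: frac_eq)
      then have "0 \<le> tau_lift \<sigma> \<gamma> \<omega> (s (act (inv \<gamma>) \<omega>))" "tau_lift \<sigma> \<gamma> \<omega> (s (act (inv \<gamma>) \<omega>)) < 2"
        using homeo_Z_real_frac_bounds[OF tau_lift_homeo_Z_real[OF \<gamma> elim], of "s (act (inv \<gamma>) \<omega>)"]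
          tau_lift_0[OF \<gamma> elim] by simp_all
      then show ?case
        unfolding u_def by linarith
    qed
  qed
  moreover have "AE \<omega> in M. pull \<sigma> euler_cocycle \<gamma> \<eta> \<omega> = delta1 u \<gamma> \<eta> \<omega>"
    if g: "\<gamma> \<in> carrier \<Gamma>" "\<eta> \<in> carrier \<Gamma>" for \<gamma> \<eta>
    using AE_tau_lift_mult[OF g] eq[OF g(1)] AE_act_inv[OF g(1) eq[OF g(2)]] eq[OF mult_carrier[OF g]] AE_space
  proof eventually_elim
    case (elim \<omega>)
    let ?t = "s (act (inv \<eta>) (act (inv \<gamma>) \<omega>))"
    have "tau_lift \<sigma> \<gamma> \<omega> (tau_lift \<sigma> \<eta> (act (inv \<gamma>) \<omega>) ?t) =
        s \<omega> + of_int (u \<gamma> \<omega>) + of_int (u \<eta> (act (inv \<gamma>) \<omega>))"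
      using elim by (simp add: homeo_Z_real_add_of_int[OF tau_lift_homeo_Z_real[OF g(1)]])
    moreover have "tau_lift \<sigma> (\<gamma> \<otimes> \<eta>) \<omega> ?t = s \<omega> + of_int (u (\<gamma> \<otimes> \<eta>) \<omega>)"
      using elim g by (simp add: act_inv_mult)
    ultimately have "s \<omega> + of_int (u \<gamma> \<omega>) + of_int (u \<eta> (act (inv \<gamma>) \<omega>)) =
        s \<omega> + of_int (u (\<gamma> \<otimes> \<eta>) \<omega>) + of_int (pull \<sigma> euler_cocycle \<gamma> \<eta> \<omega>)"
      using elim(1)[rule_format, of ?t] by linarith
    then have "real_of_int (pull \<sigma> euler_cocycle \<gamma> \<eta> \<omega>) = real_of_int (delta1 u \<gamma> \<eta> \<omega>)"
      by (simp add: delta1_def)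
    then show ?case
      by (simp only: of_int_eq_iff)
  qed
  ultimately show ?thesis
    by blast
qed

end

text \<open>Substitution of \<gamma>\<inverse>\<omega> for \<omega>, legitimate since the action
  preserves null sets. The predicate is left abstract so that equivariant families and
  semicohomologies are both instances.\<close>

lemma AE_cocycle_tau_iff:
  assumes \<sigma>\<^sub>1: "measurable_cocycle \<Gamma> M act \<sigma>\<^sub>1" and \<sigma>\<^sub>2: "measurable_cocycle \<Gamma> M act \<sigma>\<^sub>2"
    and \<gamma>: "\<gamma> \<in> carrier \<Gamma>"
  shows "(AE \<omega> in M. P (act \<gamma> \<omega>) \<omega> (\<sigma>\<^sub>1 \<gamma> \<omega>) (\<sigma>\<^sub>2 \<gamma> \<omega>)) \<longleftrightarrow>
    (AE \<omega> in M. P \<omega> (act (inv \<gamma>) \<omega>) (tau \<sigma>\<^sub>1 \<gamma> \<omega>) (tau \<sigma>\<^sub>2 \<gamma> \<omega>))"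
proof -
  have "(AE \<omega> in M. P (act \<gamma> \<omega>) \<omega> (\<sigma>\<^sub>1 \<gamma> \<omega>) (\<sigma>\<^sub>2 \<gamma> \<omega>)) \<longleftrightarrow>
    (AE \<omega> in M. P (act \<gamma> (act (inv \<gamma>) \<omega>)) (act (inv \<gamma>) \<omega>) (\<sigma>\<^sub>1 \<gamma> (act (inv \<gamma>) \<omega>)) (\<sigma>\<^sub>2 \<gamma> (act (inv \<gamma>) \<omega>)))"
    using AE_act_iff[of "inv \<gamma>" "\<lambda>\<omega>. P (act \<gamma> \<omega>) \<omega> (\<sigma>\<^sub>1 \<gamma> \<omega>) (\<sigma>\<^sub>2 \<gamma> \<omega>)"] \<gamma> by simp
  also have "\<dots> \<longleftrightarrow> (AE \<omega> in M. P \<omega> (act (inv \<gamma>) \<omega>) (tau \<sigma>\<^sub>1 \<gamma> \<omega>) (tau \<sigma>\<^sub>2 \<gamma> \<omega>))"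
  proof (rule eventually_subst)
    show "AE \<omega> in M. P (act \<gamma> (act (inv \<gamma>) \<omega>)) (act (inv \<gamma>) \<omega>)
        (\<sigma>\<^sub>1 \<gamma> (act (inv \<gamma>) \<omega>)) (\<sigma>\<^sub>2 \<gamma> (act (inv \<gamma>) \<omega>)) =
      P \<omega> (act (inv \<gamma>) \<omega>) (tau \<sigma>\<^sub>1 \<gamma> \<omega>) (tau \<sigma>\<^sub>2 \<gamma> \<omega>)"
      using AE_tau_eq[OF \<sigma>\<^sub>1 \<gamma>] AE_tau_eq[OF \<sigma>\<^sub>2 \<gamma>] AE_space
      by eventually_elim (use \<gamma> in simp)
  qed
  finally show ?thesis .
qed

lemma equivariant_family_iff:
  assumes \<sigma>: "measurable_cocycle \<Gamma> M act \<sigma>"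
  shows "equivariant_family \<Gamma> M act \<sigma> r \<longleftrightarrow> r \<in> borel_measurable M \<and>
    (\<forall>\<gamma>\<in>carrier \<Gamma>. AE \<omega> in M. r \<omega> = tau \<sigma> \<gamma> \<omega> (r (act (inv \<gamma>) \<omega>)))"
  unfolding equivariant_family_def
  using AE_cocycle_tau_iff[OF \<sigma> \<sigma>, of _ "\<lambda>\<omega>' \<omega> f g. r \<omega>' = f (r \<omega>)"] by simp

lemma semicohomology_tau_iff:
  assumes \<sigma>\<^sub>1: "measurable_cocycle \<Gamma> M act \<sigma>\<^sub>1" and \<sigma>\<^sub>2: "measurable_cocycle \<Gamma> M act \<sigma>\<^sub>2"
    and \<gamma>: "\<gamma> \<in> carrier \<Gamma>"
  shows "(AE \<omega> in M. \<sigma>\<^sub>1 \<gamma> \<omega> \<circ> (\<lambda>x. \<phi> (x, \<omega>)) = (\<lambda>x. \<phi> (x, act \<gamma> \<omega>)) \<circ> \<sigma>\<^sub>2 \<gamma> \<omega>) \<longleftrightarrow>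
    (AE \<omega> in M. \<forall>x. tau \<sigma>\<^sub>1 \<gamma> \<omega> (\<phi> (x, act (inv \<gamma>) \<omega>)) = \<phi> (tau \<sigma>\<^sub>2 \<gamma> \<omega> x, \<omega>))"
  using AE_cocycle_tau_iff[OF \<sigma>\<^sub>1 \<sigma>\<^sub>2 \<gamma>, of "\<lambda>\<omega>' \<omega> f g. f \<circ> (\<lambda>x. \<phi> (x, \<omega>)) = (\<lambda>x. \<phi> (x, \<omega>')) \<circ> g"]
  by (simp add: fun_eq_iff)

text \<open>A semicohomology transports points from fibre to fibre:
  \<open>\<lambda>\<omega>. \<phi> (r \<omega>, \<omega>)\<close> inherits equivariance from
  \<open>r\<close>.\<close>

lemma equivariant_family_semicohomologous:
  assumes r: "equivariant_family \<Gamma> M act \<sigma>\<^sub>1 r" and sc: "left_semicohomologous \<Gamma> M act \<sigma>\<^sub>2 \<sigma>\<^sub>1"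
  shows "\<exists>r. equivariant_family \<Gamma> M act \<sigma>\<^sub>2 r"
proof -
  obtain \<phi> where \<phi>: "\<phi> \<in> measurable (borel \<Otimes>\<^sub>M M) borel"
    "\<And>\<gamma>. \<gamma> \<in> carrier \<Gamma> \<Longrightarrow> AE \<omega> in M.
        \<sigma>\<^sub>2 \<gamma> \<omega> \<circ> (\<lambda>x. \<phi> (x, \<omega>)) = (\<lambda>x. \<phi> (x, act \<gamma> \<omega>)) \<circ> \<sigma>\<^sub>1 \<gamma> \<omega>"
    using sc by (auto simp: left_semicohomologous_def)
  have rm: "r \<in> measurable M borel"
    using r by (simp add: equivariant_family_def)
  have "(\<lambda>\<omega>. \<phi> (r \<omega>, \<omega>)) \<in> measurable M borel"
    by (rule measurable_compose[OF measurable_Pair[OF rm measurable_ident_sets[OF refl]] \<phi>(1)])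
  moreover have "AE \<omega> in M. \<phi> (r (act \<gamma> \<omega>), act \<gamma> \<omega>) = \<sigma>\<^sub>2 \<gamma> \<omega> (\<phi> (r \<omega>, \<omega>))" if \<gamma>: "\<gamma> \<in> carrier \<Gamma>" for \<gamma>
  proof -
    have "AE \<omega> in M. r (act \<gamma> \<omega>) = \<sigma>\<^sub>1 \<gamma> \<omega> (r \<omega>)"
      using r \<gamma> by (simp add: equivariant_family_def)
    then show ?thesis
      using \<phi>(2)[OF \<gamma>] by eventually_elim (simp add: fun_eq_iff)
  qed
  ultimately show ?thesis
    unfolding equivariant_family_def by blast
qed

text \<open>Ghys' construction: \<open>\<Phi> = sup (F \<gamma> \<circ> (K \<gamma>)\<inverse>)\<close> over \<open>\<gamma>\<close> conjugates \<open>K\<close> into \<open>F\<close>, because the two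
  families are projective with the same integer defect \<open>e\<close>.\<close>

lemma sup_semiconjugacy:
  fixes F K :: "'g \<Rightarrow> 'w \<Rightarrow> real \<Rightarrow> real"
  assumes count: "countable (carrier \<Gamma>)"
    and F: "\<And>\<gamma> \<omega>. \<gamma> \<in> carrier \<Gamma> \<Longrightarrow> \<omega> \<in> space M \<Longrightarrow> F \<gamma> \<omega> \<in> homeo_Z_real"
    and K: "\<And>\<gamma> \<omega>. \<gamma> \<in> carrier \<Gamma> \<Longrightarrow> \<omega> \<in> space M \<Longrightarrow> K \<gamma> \<omega> \<in> homeo_Z_real"
    and F_meas: "\<And>\<gamma> t. \<gamma> \<in> carrier \<Gamma> \<Longrightarrow> (\<lambda>\<omega>. F \<gamma> \<omega> t) \<in> borel_measurable M"
    and K_meas: "\<And>\<gamma> t. \<gamma> \<in> carrier \<Gamma> \<Longrightarrow> (\<lambda>\<omega>. K \<gamma> \<omega> t) \<in> borel_measurable M"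
    and F_bdd: "\<And>\<gamma>. \<gamma> \<in> carrier \<Gamma> \<Longrightarrow> AE \<omega> in M. \<bar>F \<gamma> \<omega> 0\<bar> \<le> C"
    and K_bdd: "\<And>\<gamma>. \<gamma> \<in> carrier \<Gamma> \<Longrightarrow> AE \<omega> in M. \<bar>K \<gamma> \<omega> 0\<bar> \<le> C"
    and F_mult: "\<And>\<gamma> \<eta>. \<gamma> \<in> carrier \<Gamma> \<Longrightarrow> \<eta> \<in> carrier \<Gamma> \<Longrightarrow> AE \<omega> in M. \<forall>t.
      F \<gamma> \<omega> (F \<eta> (act (inv \<gamma>) \<omega>) t) = F (\<gamma> \<otimes> \<eta>) \<omega> t + of_int (e \<gamma> \<eta> \<omega>)"
    and K_mult: "\<And>\<gamma> \<eta>. \<gamma> \<in> carrier \<Gamma> \<Longrightarrow> \<eta> \<in> carrier \<Gamma> \<Longrightarrow> AE \<omega> in M. \<forall>t.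
      K \<gamma> \<omega> (K \<eta> (act (inv \<gamma>) \<omega>) t) = K (\<gamma> \<otimes> \<eta>) \<omega> t + of_int (e \<gamma> \<eta> \<omega>)"
  shows "\<exists>\<Phi> :: real \<times> 'w \<Rightarrow> real. \<Phi> \<in> borel_measurable (borel \<Otimes>\<^sub>M M) \<and>
    (AE \<omega> in M. mono (\<lambda>t. \<Phi> (t, \<omega>)) \<and> (\<forall>t. \<Phi> (t + 1, \<omega>) = \<Phi> (t, \<omega>) + 1)) \<and>
    (\<forall>\<gamma>\<in>carrier \<Gamma>. AE \<omega> in M. \<forall>t. F \<gamma> \<omega> (\<Phi> (t, act (inv \<gamma>) \<omega>)) = \<Phi> (K \<gamma> \<omega> t, \<omega>))"
proof -
  have ne: "carrier \<Gamma> \<noteq> {}"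
    using monoid.one_closed[OF group.is_monoid[OF group_\<Gamma>]] by blast
  define T where "T \<gamma> t \<omega> = F \<gamma> \<omega> (inv_fun (K \<gamma> \<omega>) t)" for \<gamma> t \<omega>
  \<comment> \<open>Off a null set, \<open>inv_fun (K \<gamma> \<omega>)\<close> and
    \<open>F \<gamma> \<omega>\<close> each displace a point by at most \<open>C + 1\<close>, for
    every \<gamma>.\<close>
  define B where "B t = t + 2 * (C + 1)" for t
  \<comment> \<open>The truncation makes the supremum finite on the exceptional null set as well.\<close>
  define \<Phi> where "\<Phi> = (\<lambda>(t, \<omega>). SUP \<gamma>\<in>carrier \<Gamma>. min (T \<gamma> t \<omega>) (B t))"
  have good: "AE \<omega> in M. \<forall>\<gamma>\<in>carrier \<Gamma>. \<bar>F \<gamma> \<omega> 0\<bar> \<le> C \<and> \<bar>K \<gamma> \<omega> 0\<bar> \<le> C"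
    using F_bdd K_bdd by (simp add: AE_ball_countable[OF count])
  have T_le: "T \<gamma> t \<omega> \<le> B t"
    if "\<forall>\<gamma>\<in>carrier \<Gamma>. \<bar>F \<gamma> \<omega> 0\<bar> \<le> C \<and> \<bar>K \<gamma> \<omega> 0\<bar> \<le> C" "\<gamma> \<in> carrier \<Gamma>" "\<omega> \<in> space M" for \<gamma> t \<omega>
    using homeo_Z_real_dist[OF F[OF that(2,3)], of C "inv_fun (K \<gamma> \<omega>) t"]
      homeo_Z_real_inv_dist[OF K[OF that(2,3)], of C t] that(1,2)
    unfolding T_def B_def by fastforce
  have \<Phi>_eq: "\<Phi> (t, \<omega>) = (SUP \<gamma>\<in>carrier \<Gamma>. T \<gamma> t \<omega>)"
    if "\<forall>\<gamma>\<in>carrier \<Gamma>. \<bar>F \<gamma> \<omega> 0\<bar> \<le> C \<and> \<bar>K \<gamma> \<omega> 0\<bar> \<le> C" "\<omega> \<in> space M" for t \<omega>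
    unfolding \<Phi>_def using T_le[OF that(1) _ that(2)] by (auto intro!: SUP_cong simp: min_absorb1)
  have bdd: "bdd_above ((\<lambda>\<gamma>. T \<gamma> t \<omega>) ` carrier \<Gamma>)"
    if "\<forall>\<gamma>\<in>carrier \<Gamma>. \<bar>F \<gamma> \<omega> 0\<bar> \<le> C \<and> \<bar>K \<gamma> \<omega> 0\<bar> \<le> C" "\<omega> \<in> space M" for t \<omega>
    using T_le[OF that(1) _ that(2)] by (intro bdd_aboveI2[where M = "B t"])
  have "\<Phi> \<in> borel_measurable (borel \<Otimes>\<^sub>M M)"
    unfolding \<Phi>_def split_beta
  proof (rule borel_measurable_cSUP[OF count])
    fix \<gamma> assume \<gamma>: "\<gamma> \<in> carrier \<Gamma>"
    have meas: "(\<lambda>p. F \<gamma> (snd p) t) \<in> borel_measurable (borel \<Otimes>\<^sub>M M)"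
      "(\<lambda>p. K \<gamma> (snd p) t) \<in> borel_measurable (borel \<Otimes>\<^sub>M M)" for t
      by (rule measurable_compose[OF measurable_snd F_meas[OF \<gamma>]]
          measurable_compose[OF measurable_snd K_meas[OF \<gamma>]])+
    have "(\<lambda>p. inv_fun (K \<gamma> (snd p)) (fst p)) \<in> borel_measurable (borel \<Otimes>\<^sub>M M)"
      by (rule measurable_homeo_Z_real_inv[OF K[OF \<gamma>] meas(2) measurable_fst]) (auto simp: space_pair_measure)
    then have [measurable]: "(\<lambda>p. T \<gamma> (fst p) (snd p)) \<in> borel_measurable (borel \<Otimes>\<^sub>M M)"
      unfolding T_def
      by (rule measurable_homeo_Z_real_eval[OF F[OF \<gamma>] meas(1), rotated]) (auto simp: space_pair_measure)
    show "(\<lambda>p. min (T \<gamma> (fst p) (snd p)) (B (fst p))) \<in> borel_measurable (borel \<Otimes>\<^sub>M M)"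
      unfolding B_def by measurable
  next
    fix p :: "real \<times> 'w"
    show "bdd_above ((\<lambda>\<gamma>. min (T \<gamma> (fst p) (snd p)) (B (fst p))) ` carrier \<Gamma>)"
      by (rule bdd_aboveI2[where M = "B (fst p)"]) simp
  qed
  moreover have "AE \<omega> in M. mono (\<lambda>t. \<Phi> (t, \<omega>)) \<and> (\<forall>t. \<Phi> (t + 1, \<omega>) = \<Phi> (t, \<omega>) + 1)"
    using good AE_space
  proof eventually_elim
    case (elim \<omega>)
    have "\<Phi> (s, \<omega>) \<le> \<Phi> (t, \<omega>)" if "s \<le> t" for s t
      unfolding \<Phi>_eq[OF elim]
    proof (rule cSUP_mono[OF ne bdd[OF elim]])
      fix \<gamma> assume \<gamma>: "\<gamma> \<in> carrier \<Gamma>"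
      then have "T \<gamma> s \<omega> \<le> T \<gamma> t \<omega>"
        unfolding T_def using that elim
        by (simp add: homeo_Z_real_le_iff[OF F] homeo_Z_real_le_iff[OF homeo_Z_real_inv[OF K]])
      then show "\<exists>\<eta>\<in>carrier \<Gamma>. T \<gamma> s \<omega> \<le> T \<eta> t \<omega>"
        using \<gamma> by blast
    qed
    moreover have "\<Phi> (t + 1, \<omega>) = \<Phi> (t, \<omega>) + 1" for t
    proof -
      have "T \<gamma> (t + 1) \<omega> = translation 1 (T \<gamma> t \<omega>)" if "\<gamma> \<in> carrier \<Gamma>" for \<gamma>
        unfolding T_def translation_def using that elim
        by (simp add: homeo_Z_real_add_1[OF F] homeo_Z_real_add_1[OF homeo_Z_real_inv[OF K]])
      then have "\<Phi> (t + 1, \<omega>) = (SUP \<gamma>\<in>carrier \<Gamma>. translation 1 (T \<gamma> t \<omega>))"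
        unfolding \<Phi>_eq[OF elim] by (intro SUP_cong) auto
      also have "\<dots> = translation 1 (\<Phi> (t, \<omega>))"
        unfolding \<Phi>_eq[OF elim]
        by (rule homeo_Z_real_cSUP[OF translation_homeo_Z_real ne bdd[OF elim], symmetric])
      finally show ?thesis
        by (simp add: translation_def)
    qed
    ultimately show ?case
      by (auto intro: monoI)
  qed
  moreover have "AE \<omega> in M. \<forall>t. F \<gamma> \<omega> (\<Phi> (t, act (inv \<gamma>) \<omega>)) = \<Phi> (K \<gamma> \<omega> t, \<omega>)" if \<gamma>: "\<gamma> \<in> carrier \<Gamma>" for \<gamma>
  proof -
    have "AE \<omega> in M. \<forall>\<eta>\<in>carrier \<Gamma>. \<forall>t.
      F \<gamma> \<omega> (F \<eta> (act (inv \<gamma>) \<omega>) t) = F (\<gamma> \<otimes> \<eta>) \<omega> t + of_int (e \<gamma> \<eta> \<omega>)"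
      using F_mult[OF \<gamma>] by (simp only: AE_ball_countable[OF count]) blast
    moreover have "AE \<omega> in M. \<forall>\<eta>\<in>carrier \<Gamma>. \<forall>t.
      K \<gamma> \<omega> (K \<eta> (act (inv \<gamma>) \<omega>) t) = K (\<gamma> \<otimes> \<eta>) \<omega> t + of_int (e \<gamma> \<eta> \<omega>)"
      using K_mult[OF \<gamma>] by (simp only: AE_ball_countable[OF count]) blast
    ultimately show ?thesis
      using good AE_act_inv[OF \<gamma> good] AE_space
    proof eventually_elim
      case (elim \<omega>)
      let ?\<omega> = "act (inv \<gamma>) \<omega>"
      have sp: "?\<omega> \<in> space M"
        using elim(5) \<gamma> by simp
      show ?case
      proof
        fix t
        \<comment> \<open>The integer \<open>e \<gamma> \<eta> \<omega>\<close> enters through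
          \<open>K\<close> as a shift of the argument \<open>s\<close> and through \<open>F\<close>
          as a shift of the value. Since lifts commute with integer translations, the two shifts
          match.\<close>
        have "F \<gamma> \<omega> (T \<eta> t ?\<omega>) = T (\<gamma> \<otimes> \<eta>) (K \<gamma> \<omega> t) \<omega>" if \<eta>: "\<eta> \<in> carrier \<Gamma>" for \<eta>
        proof -
          define s where "s = inv_fun (K \<eta> ?\<omega>) t"
          have "K \<gamma> \<omega> t = K \<gamma> \<omega> (K \<eta> ?\<omega> s)"
            by (simp add: s_def homeo_Z_real_inv_right[OF K[OF \<eta> sp]])
          also have "\<dots> = K (\<gamma> \<otimes> \<eta>) \<omega> (s + of_int (e \<gamma> \<eta> \<omega>))"
            using elim \<gamma> \<eta> by (simp add: homeo_Z_real_add_of_int[OF K])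
          finally have "inv_fun (K (\<gamma> \<otimes> \<eta>) \<omega>) (K \<gamma> \<omega> t) = s + of_int (e \<gamma> \<eta> \<omega>)"
            using elim \<gamma> \<eta> by (simp add: homeo_Z_real_inv_left[OF K])
          moreover have "F \<gamma> \<omega> (F \<eta> ?\<omega> s) = F (\<gamma> \<otimes> \<eta>) \<omega> (s + of_int (e \<gamma> \<eta> \<omega>))"
            using elim \<gamma> \<eta> by (simp add: homeo_Z_real_add_of_int[OF F])
          ultimately show ?thesis
            by (simp add: T_def s_def)
        qed
        then have "F \<gamma> \<omega> (\<Phi> (t, ?\<omega>)) = (SUP \<eta>\<in>carrier \<Gamma>. T (\<gamma> \<otimes> \<eta>) (K \<gamma> \<omega> t) \<omega>)"
          unfolding \<Phi>_eq[OF elim(4) sp] homeo_Z_real_cSUP[OF F[OF \<gamma> elim(5)] ne bdd[OF elim(4) sp]]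
          by (intro SUP_cong) auto
        also have "\<dots> = (SUP \<eta>\<in>(\<lambda>\<eta>. \<gamma> \<otimes> \<eta>) ` carrier \<Gamma>. T \<eta> (K \<gamma> \<omega> t) \<omega>)"
          by (simp add: image_image)
        \<comment> \<open>Left translation only permutes the index set, which leaves the supremum
          unchanged.\<close>
        also have "(\<lambda>\<eta>. \<gamma> \<otimes> \<eta>) ` carrier \<Gamma> = carrier \<Gamma>"
          by (rule group.surj_const_mult[OF group_\<Gamma> \<gamma>])
        finally show "F \<gamma> \<omega> (\<Phi> (t, ?\<omega>)) = \<Phi> (K \<gamma> \<omega> t, \<omega>)"
          by (simp add: \<Phi>_eq[OF elim(3,5)])
      qed
    qed
  qed
  ultimately show ?thesis
    by blast
qed

text \<open>Lowering the lifts by \<open>u\<close> lowers their composition defect by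
  \<open>delta1 u\<close>, so \<open>e\<close> replaces the Euler cocycle. The later choices of
  \<open>e\<close> are the Euler cocycle of the other cocycle and 0.\<close>

lemma twisted_tau_lift:
  assumes \<sigma>: "measurable_cocycle \<Gamma> M act \<sigma>" and u: "uniformly_bounded u"
    and eq: "\<forall>\<gamma>\<in>carrier \<Gamma>. \<forall>\<eta>\<in>carrier \<Gamma>. AE \<omega> in M.
      pull \<sigma> euler_cocycle \<gamma> \<eta> \<omega> = delta1 u \<gamma> \<eta> \<omega> + e \<gamma> \<eta> \<omega>"
  defines "F \<equiv> \<lambda>\<gamma> \<omega> t. tau_lift \<sigma> \<gamma> \<omega> t + of_int (- u \<gamma> \<omega>)"
  shows "\<And>\<gamma> \<omega>. \<gamma> \<in> carrier \<Gamma> \<Longrightarrow> \<omega> \<in> space M \<Longrightarrow> F \<gamma> \<omega> \<in> homeo_Z_real"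
    and "\<And>\<gamma> t. \<gamma> \<in> carrier \<Gamma> \<Longrightarrow> (\<lambda>\<omega>. F \<gamma> \<omega> t) \<in> borel_measurable M"
    and "\<exists>C. \<forall>\<gamma>\<in>carrier \<Gamma>. AE \<omega> in M. \<bar>F \<gamma> \<omega> 0\<bar> \<le> C"
    and "\<And>\<gamma> \<eta>. \<gamma> \<in> carrier \<Gamma> \<Longrightarrow> \<eta> \<in> carrier \<Gamma> \<Longrightarrow> AE \<omega> in M. \<forall>t.
      F \<gamma> \<omega> (F \<eta> (act (inv \<gamma>) \<omega>) t) = F (\<gamma> \<otimes> \<eta>) \<omega> t + of_int (e \<gamma> \<eta> \<omega>)"
proof -
  obtain C where C: "\<And>\<gamma>. \<gamma> \<in> carrier \<Gamma> \<Longrightarrow> u \<gamma> \<in> measurable M (count_space UNIV)"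
    "\<And>\<gamma>. \<gamma> \<in> carrier \<Gamma> \<Longrightarrow> AE \<omega> in M. \<bar>u \<gamma> \<omega>\<bar> \<le> C"
    using u by (auto simp: uniformly_bounded_def)
  show "F \<gamma> \<omega> \<in> homeo_Z_real" if "\<gamma> \<in> carrier \<Gamma>" "\<omega> \<in> space M" for \<gamma> \<omega>
    unfolding F_def by (intro homeo_Z_real_add_const tau_lift_homeo_Z_real[OF \<sigma>] that)
  show "(\<lambda>\<omega>. F \<gamma> \<omega> t) \<in> borel_measurable M" if "\<gamma> \<in> carrier \<Gamma>" for \<gamma> t
  proof -
    note [measurable] = C(1)[OF that] measurable_tau_lift[OF \<sigma> that measurable_const[of t]]
    have [measurable]: "(\<lambda>\<omega>. real_of_int (- u \<gamma> \<omega>)) \<in> borel_measurable M"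
      by measurable
    show ?thesis
      unfolding F_def by measurable
  qed
  have "AE \<omega> in M. \<bar>F \<gamma> \<omega> 0\<bar> \<le> of_int C + 1" if "\<gamma> \<in> carrier \<Gamma>" for \<gamma>
    using C(2)[OF that] AE_space
  proof eventually_elim
    case (elim \<omega>)
    then show ?case
      using tau_lift_0[OF \<sigma> that elim(2)] unfolding F_def by linarith
  qed
  then show "\<exists>C. \<forall>\<gamma>\<in>carrier \<Gamma>. AE \<omega> in M. \<bar>F \<gamma> \<omega> 0\<bar> \<le> C"
    by blast
  show "AE \<omega> in M. \<forall>t. F \<gamma> \<omega> (F \<eta> (act (inv \<gamma>) \<omega>) t) = F (\<gamma> \<otimes> \<eta>) \<omega> t + of_int (e \<gamma> \<eta> \<omega>)"
    if g: "\<gamma> \<in> carrier \<Gamma>" "\<eta> \<in> carrier \<Gamma>" for \<gamma> \<eta>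
    using AE_tau_lift_mult[OF \<sigma> g] eq[rule_format, OF g] AE_space
  proof eventually_elim
    case (elim \<omega>)
    then show ?case
      unfolding F_def homeo_Z_real_add_of_int[OF tau_lift_homeo_Z_real[OF \<sigma> g(1) elim(3)]]
      by (simp add: delta1_def)
  qed
qed

text \<open>The corrected lifts of \<open>\<sigma>\<^sub>1\<close> and the plain lifts of
  \<open>\<sigma>\<^sub>2\<close> have the same defect, so \<open>sup_semiconjugacy\<close> applies.
  The correction is integral and disappears on the circle, where the resulting map intertwines the
  original cocycles. Exchanging the cocycles gives the other half of semicohomology.\<close>

lemma left_semicohomologous_if_euler_eq:
  assumes \<sigma>\<^sub>1: "measurable_cocycle \<Gamma> M act \<sigma>\<^sub>1" and \<sigma>\<^sub>2: "measurable_cocycle \<Gamma> M act \<sigma>\<^sub>2"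
    and count: "countable (carrier \<Gamma>)"
    and eq: "H2b_pullback \<Gamma> M act \<sigma>\<^sub>1 bounded_euler_class = H2b_pullback \<Gamma> M act \<sigma>\<^sub>2 bounded_euler_class"
  shows "left_semicohomologous \<Gamma> M act \<sigma>\<^sub>1 \<sigma>\<^sub>2"
proof -
  obtain u where u: "uniformly_bounded u" and eq':
    "\<forall>\<gamma>\<in>carrier \<Gamma>. \<forall>\<eta>\<in>carrier \<Gamma>. AE \<omega> in M.
      pull \<sigma>\<^sub>1 euler_cocycle \<gamma> \<eta> \<omega> = delta1 u \<gamma> \<eta> \<omega> + pull \<sigma>\<^sub>2 euler_cocycle \<gamma> \<eta> \<omega>"
    using eq unfolding H2b_pullback_eq_iff[OF \<sigma>\<^sub>1 \<sigma>\<^sub>2] by blast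
  define F where "F \<gamma> \<omega> t = tau_lift \<sigma>\<^sub>1 \<gamma> \<omega> t + of_int (- u \<gamma> \<omega>)" for \<gamma> \<omega> t
  note F = twisted_tau_lift[OF \<sigma>\<^sub>1 u eq', folded F_def]
  obtain C where C: "\<And>\<gamma>. \<gamma> \<in> carrier \<Gamma> \<Longrightarrow> AE \<omega> in M. \<bar>F \<gamma> \<omega> 0\<bar> \<le> C"
    using F(3) by blast
  \<comment> \<open>A common bound for both families is needed; the normalised lifts of
    \<open>\<sigma>\<^sub>2\<close> send 0 into [0, 1), which accounts for the 1.\<close>
  have FC: "AE \<omega> in M. \<bar>F \<gamma> \<omega> 0\<bar> \<le> max C 1" if "\<gamma> \<in> carrier \<Gamma>" for \<gamma>
    using C[OF that] by eventually_elim linarith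
  have KM: "(\<lambda>\<omega>. tau_lift \<sigma>\<^sub>2 \<gamma> \<omega> t) \<in> borel_measurable M" if "\<gamma> \<in> carrier \<Gamma>" for \<gamma> t
    using that by (intro measurable_tau_lift[OF \<sigma>\<^sub>2]) auto
  have KC: "AE \<omega> in M. \<bar>tau_lift \<sigma>\<^sub>2 \<gamma> \<omega> 0\<bar> \<le> max C 1" if "\<gamma> \<in> carrier \<Gamma>" for \<gamma>
    using AE_space
  proof eventually_elim
    case (elim \<omega>)
    then show ?case
      using tau_lift_0[OF \<sigma>\<^sub>2 that elim] by linarith
  qed
  have Km: "AE \<omega> in M. \<forall>t. tau_lift \<sigma>\<^sub>2 \<gamma> \<omega> (tau_lift \<sigma>\<^sub>2 \<eta> (act (inv \<gamma>) \<omega>) t) =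
      tau_lift \<sigma>\<^sub>2 (\<gamma> \<otimes> \<eta>) \<omega> t + of_int (pull \<sigma>\<^sub>2 euler_cocycle \<gamma> \<eta> \<omega>)"
    if "\<gamma> \<in> carrier \<Gamma>" "\<eta> \<in> carrier \<Gamma>" for \<gamma> \<eta>
    using that by (rule AE_tau_lift_mult[OF \<sigma>\<^sub>2])
  have K: "tau_lift \<sigma>\<^sub>2 \<gamma> \<omega> \<in> homeo_Z_real" if "\<gamma> \<in> carrier \<Gamma>" "\<omega> \<in> space M" for \<gamma> \<omega>
    using that by (rule tau_lift_homeo_Z_real[OF \<sigma>\<^sub>2])
  have "\<exists>\<Phi> :: real \<times> 'w \<Rightarrow> real. \<Phi> \<in> borel_measurable (borel \<Otimes>\<^sub>M M) \<and>
    (AE \<omega> in M. mono (\<lambda>t. \<Phi> (t, \<omega>)) \<and> (\<forall>t. \<Phi> (t + 1, \<omega>) = \<Phi> (t, \<omega>) + 1)) \<and>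
    (\<forall>\<gamma>\<in>carrier \<Gamma>. AE \<omega> in M. \<forall>t.
      F \<gamma> \<omega> (\<Phi> (t, act (inv \<gamma>) \<omega>)) = \<Phi> (tau_lift \<sigma>\<^sub>2 \<gamma> \<omega> t, \<omega>))"
    by (rule sup_semiconjugacy[where e = "pull \<sigma>\<^sub>2 euler_cocycle" and C = "max C 1"])
      (fact count F(1) K F(2) KM FC KC F(4) Km)+
  then obtain \<Phi> where \<Phi>: "\<Phi> \<in> borel_measurable (borel \<Otimes>\<^sub>M M)"
    "AE \<omega> in M. mono (\<lambda>t. \<Phi> (t, \<omega>)) \<and> (\<forall>t. \<Phi> (t + 1, \<omega>) = \<Phi> (t, \<omega>) + 1)"
    "\<And>\<gamma>. \<gamma> \<in> carrier \<Gamma> \<Longrightarrow>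
      AE \<omega> in M. \<forall>t. F \<gamma> \<omega> (\<Phi> (t, act (inv \<gamma>) \<omega>)) = \<Phi> (tau_lift \<sigma>\<^sub>2 \<gamma> \<omega> t, \<omega>)"
    by blast
  \<comment> \<open>Descent through \<open>circle_coord\<close> is jointly Borel on the whole
    product. \<Phi> lifts the result only where it has degree one, that is almost
    everywhere.\<close>
  define \<phi> where "\<phi> = (\<lambda>(x, \<omega>). to_circle (\<Phi> (circle_coord x, \<omega>)))"
  have lift: "\<phi> (to_circle t, \<omega>) = to_circle (\<Phi> (t, \<omega>))" if "\<forall>t. \<Phi> (t + 1, \<omega>) = \<Phi> (t, \<omega>) + 1" for t \<omega>
    using degree_one_add_of_int[of "\<lambda>t. \<Phi> (t, \<omega>)" "frac t" "\<lfloor>t\<rfloor>"] that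
    by (simp add: \<phi>_def frac_def)
  have "\<phi> \<in> measurable (borel \<Otimes>\<^sub>M M) borel"
  proof -
    have "(\<lambda>p. (circle_coord (fst p), snd p)) \<in> measurable (borel \<Otimes>\<^sub>M M) (borel \<Otimes>\<^sub>M M)"
      by (intro measurable_Pair) measurable
    from measurable_compose[OF this \<Phi>(1)] show ?thesis
      unfolding \<phi>_def split_beta by (rule measurable_compose[OF _ measurable_to_circle])
  qed
  moreover have "AE \<omega> in M. nondecreasing_degree_one (\<lambda>x. \<phi> (x, \<omega>))"
    using \<Phi>(2)
  proof eventually_elim
    case (elim \<omega>)
    then show ?case
      unfolding nondecreasing_degree_one_iff_lift
      by (intro exI[of _ "\<lambda>t. \<Phi> (t, \<omega>)"]) (simp add: is_liftI lift)
  qed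
  moreover have "AE \<omega> in M. \<forall>x. tau \<sigma>\<^sub>1 \<gamma> \<omega> (\<phi> (x, act (inv \<gamma>) \<omega>)) = \<phi> (tau \<sigma>\<^sub>2 \<gamma> \<omega> x, \<omega>)"
    if \<gamma>: "\<gamma> \<in> carrier \<Gamma>" for \<gamma>
    using \<Phi>(2) AE_act_inv[OF \<gamma> \<Phi>(2)] \<Phi>(3)[OF \<gamma>] AE_space
  proof eventually_elim
    case (elim \<omega>)
    show ?case
    proof
      fix x
      define t where "t = circle_coord x"
      have x: "x = to_circle t"
        by (simp add: t_def)
      have "tau \<sigma>\<^sub>1 \<gamma> \<omega> (\<phi> (x, act (inv \<gamma>) \<omega>)) = to_circle (tau_lift \<sigma>\<^sub>1 \<gamma> \<omega> (\<Phi> (t, act (inv \<gamma>) \<omega>)))"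
        using elim(2,4) \<gamma> by (simp add: x lift to_circle_tau_lift[OF \<sigma>\<^sub>1])
      also have "\<dots> = to_circle (F \<gamma> \<omega> (\<Phi> (t, act (inv \<gamma>) \<omega>)))"
        unfolding F_def by (rule to_circle_add_of_int[symmetric])
      also have "\<dots> = \<phi> (tau \<sigma>\<^sub>2 \<gamma> \<omega> x, \<omega>)"
        using elim \<gamma> by (simp add: x lift flip: to_circle_tau_lift[OF \<sigma>\<^sub>2])
      finally show "tau \<sigma>\<^sub>1 \<gamma> \<omega> (\<phi> (x, act (inv \<gamma>) \<omega>)) = \<phi> (tau \<sigma>\<^sub>2 \<gamma> \<omega> x, \<omega>)" .
    qed
  qed
  ultimately show ?thesis
    unfolding left_semicohomologous_def
    using semicohomology_tau_iff[OF \<sigma>\<^sub>1 \<sigma>\<^sub>2, of _ \<phi>] by blast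
qed

lemma equivariant_family_if_euler_trivial:
  assumes \<sigma>: "measurable_cocycle \<Gamma> M act \<sigma>" and count: "countable (carrier \<Gamma>)"
    and one: "H2b_pullback \<Gamma> M act \<sigma> bounded_euler_class = \<one>\<^bsub>Linf_H2b \<Gamma> M act\<^esub>"
  shows "\<exists>r. equivariant_family \<Gamma> M act \<sigma> r"
proof -
  obtain u where u: "uniformly_bounded u" and eq:
    "\<forall>\<gamma>\<in>carrier \<Gamma>. \<forall>\<eta>\<in>carrier \<Gamma>. AE \<omega> in M.
      pull \<sigma> euler_cocycle \<gamma> \<eta> \<omega> = delta1 u \<gamma> \<eta> \<omega>"
    using one unfolding H2b_pullback_eq_one_iff[OF \<sigma>] by blast
  then have eq': "\<forall>\<gamma>\<in>carrier \<Gamma>. \<forall>\<eta>\<in>carrier \<Gamma>. AE \<omega> in M.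
      pull \<sigma> euler_cocycle \<gamma> \<eta> \<omega> = delta1 u \<gamma> \<eta> \<omega> + 0"
    by simp
  define F where "F \<gamma> \<omega> t = tau_lift \<sigma> \<gamma> \<omega> t + of_int (- u \<gamma> \<omega>)" for \<gamma> \<omega> t
  note F = twisted_tau_lift[OF \<sigma> u eq', folded F_def]
  obtain C where C: "\<And>\<gamma>. \<gamma> \<in> carrier \<Gamma> \<Longrightarrow> AE \<omega> in M. \<bar>F \<gamma> \<omega> 0\<bar> \<le> C"
    using F(3) by blast
  have FC: "AE \<omega> in M. \<bar>F \<gamma> \<omega> 0\<bar> \<le> max C 0" if "\<gamma> \<in> carrier \<Gamma>" for \<gamma>
    using C[OF that] by eventually_elim linarith
  have id: "(\<lambda>t. t) \<in> homeo_Z_real"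
    using translation_homeo_Z_real[of 0] by (simp add: translation_def[abs_def])
  have "\<exists>\<Phi> :: real \<times> 'w \<Rightarrow> real. \<Phi> \<in> borel_measurable (borel \<Otimes>\<^sub>M M) \<and>
    (AE \<omega> in M. mono (\<lambda>t. \<Phi> (t, \<omega>)) \<and> (\<forall>t. \<Phi> (t + 1, \<omega>) = \<Phi> (t, \<omega>) + 1)) \<and>
    (\<forall>\<gamma>\<in>carrier \<Gamma>. AE \<omega> in M. \<forall>t. F \<gamma> \<omega> (\<Phi> (t, act (inv \<gamma>) \<omega>)) = \<Phi> ((\<lambda>_ _ t. t) \<gamma> \<omega> t, \<omega>))"
  proof (rule sup_semiconjugacy[where e = "\<lambda>_ _ _. 0" and C = "max C 0"])
    show "AE \<omega> in M. \<forall>t. F \<gamma> \<omega> (F \<eta> (act (inv \<gamma>) \<omega>) t) = F (\<gamma> \<otimes> \<eta>) \<omega> t + of_int 0"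
      if "\<gamma> \<in> carrier \<Gamma>" "\<eta> \<in> carrier \<Gamma>" for \<gamma> \<eta>
      using that by (rule F(4))
  qed (fact count F(1) F(2) FC | simp add: id)+
  then obtain \<Phi> :: "real \<times> 'w \<Rightarrow> real" where \<Phi>: "\<Phi> \<in> borel_measurable (borel \<Otimes>\<^sub>M M)"
    "\<And>\<gamma>. \<gamma> \<in> carrier \<Gamma> \<Longrightarrow> AE \<omega> in M. \<forall>t. F \<gamma> \<omega> (\<Phi> (t, act (inv \<gamma>) \<omega>)) = \<Phi> (t, \<omega>)"
    by blast
  \<comment> \<open>With the identity in the place of \<open>K\<close>, every section of \<Phi> at a
    fixed \<open>t\<close> projects to an equivariant family; 0 is an arbitrary choice.\<close>
  define r where "r \<omega> = to_circle (\<Phi> (0, \<omega>))" for \<omega>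
  have "(\<lambda>\<omega>. (0, \<omega>)) \<in> measurable M (borel \<Otimes>\<^sub>M M)"
    by measurable
  from measurable_compose[OF this \<Phi>(1)] have "r \<in> borel_measurable M"
    unfolding r_def[abs_def] by measurable
  moreover have "AE \<omega> in M. r \<omega> = tau \<sigma> \<gamma> \<omega> (r (act (inv \<gamma>) \<omega>))" if \<gamma>: "\<gamma> \<in> carrier \<Gamma>" for \<gamma>
    using \<Phi>(2)[OF \<gamma>] AE_space
  proof eventually_elim
    case (elim \<omega>)
    have "r \<omega> = to_circle (F \<gamma> \<omega> (\<Phi> (0, act (inv \<gamma>) \<omega>)))"
      using elim by (simp add: r_def)
    also have "\<dots> = to_circle (tau_lift \<sigma> \<gamma> \<omega> (\<Phi> (0, act (inv \<gamma>) \<omega>)))"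
      unfolding F_def by (rule to_circle_add_of_int)
    finally show ?case
      using elim \<gamma> by (simp add: r_def to_circle_tau_lift[OF \<sigma>])
  qed
  ultimately show ?thesis
    using equivariant_family_iff[OF \<sigma>] by blast
qed

end

section \<open>Right limits of non-decreasing degree one maps\<close>

definition degree_one_map :: "(real \<Rightarrow> real) \<Rightarrow> bool"
  where "degree_one_map P \<longleftrightarrow> mono P \<and> (\<forall>t. P (t + 1) = P t + 1)"

definition right_limit :: "(real \<Rightarrow> real) \<Rightarrow> real \<Rightarrow> real"
  where "right_limit P t = (INF s\<in>{t<..}. P s)"

text \<open>For monotone \<open>Q\<close> the second clause is right continuity in order
  form.\<close>

definition right_regular :: "(real \<Rightarrow> real) \<Rightarrow> bool"
  where "right_regular Q \<longleftrightarrow> degree_one_map Q \<and> (\<forall>t a. Q t < a \<longrightarrow> (\<exists>s>t. Q s < a))"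

lemma right_limit_le:
  assumes "mono P" "t < s"
  shows "right_limit P t \<le> P s"
  unfolding right_limit_def
  by (rule cINF_lower[OF bdd_belowI2[of _ "P t"]]) (use assms in \<open>auto intro: monoD\<close>)

lemma right_limit_greatest: "(\<And>s. t < s \<Longrightarrow> c \<le> P s) \<Longrightarrow> c \<le> right_limit P t"
  unfolding right_limit_def by (rule cINF_greatest) auto

lemma right_limit_less:
  assumes "right_limit P t < a"
  shows "\<exists>s>t. P s < a"
proof (rule ccontr)
  assume "\<not> (\<exists>s>t. P s < a)"
  then have "a \<le> right_limit P t"
    by (intro right_limit_greatest) (meson not_less)
  then show False
    using assms by simp
qed

lemma tendsto_right_limit:
  assumes P: "mono P"
  shows "(P \<longlongrightarrow> right_limit P t) (at_right t)"
proof (rule order_tendstoI)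
  fix a assume "a < right_limit P t"
  then show "eventually (\<lambda>s. a < P s) (at_right t)"
    using right_limit_le[OF P] eventually_at_right_less[of t]
    by (auto elim!: eventually_mono intro: less_le_trans)
next
  fix a assume "right_limit P t < a"
  then obtain b where "t < b" "P b < a"
    using right_limit_less by blast
  then have "P s < a" if "s < b" for s
    using monoD[OF P, of s b] that by simp
  then show "eventually (\<lambda>s. P s < a) (at_right t)"
    unfolding eventually_at_right[OF \<open>t < b\<close>] using \<open>t < b\<close> by blast
qed

lemma right_regular_right_limit:
  assumes P: "degree_one_map P"
  shows "right_regular (right_limit P)"
proof -
  have mono: "mono P" and per: "\<And>t. P (t + 1) = P t + 1"
    using P by (auto simp: degree_one_map_def)
  have "mono (right_limit P)"
    by (intro monoI right_limit_greatest right_limit_le[OF mono]) simp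
  moreover have "right_limit P (t + 1) = right_limit P t + 1" for t
  proof (rule antisym)
    have "right_limit P (t + 1) - 1 \<le> right_limit P t"
    proof (rule right_limit_greatest)
      fix s assume "t < s"
      then show "right_limit P (t + 1) - 1 \<le> P s"
        using right_limit_le[OF mono, of "t + 1" "s + 1"] per[of s] by simp
    qed
    then show "right_limit P (t + 1) \<le> right_limit P t + 1"
      by simp
    show "right_limit P t + 1 \<le> right_limit P (t + 1)"
    proof (rule right_limit_greatest)
      fix s assume "t + 1 < s"
      then show "right_limit P t + 1 \<le> P s"
        using right_limit_le[OF mono, of t "s - 1"] per[of "s - 1"] by simp
    qed
  qed
  moreover have "\<exists>s>t. right_limit P s < a" if less: "right_limit P t < a" for t a
  proof -
    obtain b where b: "t < b" "P b < a"
      using right_limit_less[OF less] by blast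
    obtain s where s: "t < s" "s < b"
      using dense[OF b(1)] by blast
    then show ?thesis
      using right_limit_le[OF mono s(2)] b(2) by (intro exI[of _ s]) simp
  qed
  ultimately show ?thesis
    by (simp add: right_regular_def degree_one_map_def)
qed

text \<open>The values approach the right limit from above and \<open>frac\<close> is right
  continuous, so its jumps at integers do no harm. The limit is thereby computed from circle values
  alone, independently of the choice of lift.\<close>

lemma tendsto_frac_right_limit:
  assumes P: "mono P"
  shows "(\<lambda>n. frac (P (t + 1 / real (Suc n)))) \<longlonglongrightarrow> frac (right_limit P t)"
proof -
  have "filterlim (\<lambda>n. t + 1 / real (Suc n)) (at_right t) sequentially"
    unfolding filterlim_at
    using tendsto_add[OF tendsto_const LIMSEQ_inverse_real_of_nat, of t]
    by (auto simp: inverse_eq_divide)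
  then have lim: "(\<lambda>n. P (t + 1 / real (Suc n))) \<longlonglongrightarrow> right_limit P t"
    by (rule filterlim_compose[OF tendsto_right_limit[OF P]])
  have "right_limit P t < of_int \<lfloor>right_limit P t\<rfloor> + 1"
    by linarith
  then have "eventually (\<lambda>n. P (t + 1 / real (Suc n)) < of_int \<lfloor>right_limit P t\<rfloor> + 1) sequentially"
    using order_tendstoD(2)[OF lim] by blast
  then have "eventually (\<lambda>n. P (t + 1 / real (Suc n)) - of_int \<lfloor>right_limit P t\<rfloor> =
      frac (P (t + 1 / real (Suc n)))) sequentially"
  proof eventually_elim
    case (elim n)
    have "right_limit P t \<le> P (t + 1 / real (Suc n))"
      by (rule right_limit_le[OF P]) simp
    then have "\<lfloor>P (t + 1 / real (Suc n))\<rfloor> = \<lfloor>right_limit P t\<rfloor>"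
      using elim by linarith
    then show ?case
      by (simp add: frac_def)
  qed
  moreover have "(\<lambda>n. P (t + 1 / real (Suc n)) - of_int \<lfloor>right_limit P t\<rfloor>) \<longlonglongrightarrow> frac (right_limit P t)"
    unfolding frac_def by (intro tendsto_intros lim)
  ultimately show ?thesis
    by (rule Lim_transform_eventually[rotated])
qed

text \<open>An increasing homeomorphism takes right neighbourhoods to right neighbourhoods, so both
  terms converge from the right, and integrality passes to the limit because the integers are
  closed. Making the semiconjugacy right continuous therefore keeps its equivariance.\<close>

lemma right_limit_intertwine:
  assumes F: "F \<in> homeo_Z_real" and K: "K \<in> homeo_Z_real" and P: "mono P" "mono P'"
    and int: "\<And>s. F (P' s) - P (K s) \<in> \<int>"
  shows "F (right_limit P' t) - right_limit P (K t) \<in> \<int>"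
proof (rule Lim_in_closed_set[OF closed_Ints])
  have cont: "isCont F x" "isCont K x" for x
    using homeo_Z_real_continuous[OF F] homeo_Z_real_continuous[OF K]
    by (simp_all add: continuous_on_eq_continuous_at)
  have "(K \<longlongrightarrow> K t) (at_right t)"
    using cont(2)[of t] unfolding isCont_def by (rule filterlim_mono) (simp_all add: at_le)
  moreover have "eventually (\<lambda>s. K s \<in> {K t<..} \<and> K s \<noteq> K t) (at_right t)"
    using eventually_at_right_less[of t]
    by eventually_elim (auto simp: homeo_Z_real_less_iff[OF K] homeo_Z_real_eq_iff[OF K])
  ultimately have "filterlim K (at_right (K t)) (at_right t)"
    by (simp add: filterlim_at)
  then have "((\<lambda>s. P (K s)) \<longlongrightarrow> right_limit P (K t)) (at_right t)"
    by (rule filterlim_compose[OF tendsto_right_limit[OF P(1)]])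
  moreover have "((\<lambda>s. F (P' s)) \<longlongrightarrow> F (right_limit P' t)) (at_right t)"
    by (rule isCont_tendsto_compose[OF cont(1) tendsto_right_limit[OF P(2)]])
  ultimately show "((\<lambda>s. F (P' s) - P (K s)) \<longlongrightarrow> F (right_limit P' t) - right_limit P (K t)) (at_right t)"
    by (rule tendsto_diff[rotated])
qed (simp_all add: int)

section \<open>Lifts of constant maps, uniqueness of lifts, and recovery of a lift from circle
  values\<close>

lemma degree_one_map_frac:
  assumes "degree_one_map P"
  shows "P t = P (frac t) + of_int \<lfloor>t\<rfloor>" "P 0 \<le> P (frac t)" "P (frac t) \<le> P 0 + 1"
proof -
  have P: "mono P" "\<And>t. P (t + 1) = P t + 1"
    using assms by (auto simp: degree_one_map_def)
  show "P t = P (frac t) + of_int \<lfloor>t\<rfloor>"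
    using degree_one_add_of_int[of P "frac t" "\<lfloor>t\<rfloor>", OF P(2)] by (simp add: frac_def)
  show "P 0 \<le> P (frac t)"
    using monoD[OF P(1)] by simp
  have "P (frac t) \<le> P (0 + 1)"
    using monoD[OF P(1), of "frac t" "0 + 1"] frac_lt_1[of t] by simp
  then show "P (frac t) \<le> P 0 + 1"
    using P(2)[of 0] by simp
qed

text \<open>For a lift \<open>Q\<close> this says that the circle map below is constant; a constant
  plus the floor function is the typical right continuous example.\<close>

abbreviation constant_mod_int :: "(real \<Rightarrow> real) \<Rightarrow> bool"
  where "constant_mod_int Q \<equiv> (\<forall>s. Q s - Q 0 \<in> \<int>)"

lemma constant_mod_intI:
  assumes Q: "degree_one_map Q" and int: "\<And>s. 0 \<le> s \<Longrightarrow> s < 1 \<Longrightarrow> Q s - Q 0 \<in> \<int>"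
  shows "constant_mod_int Q"
proof
  fix s
  have "Q s - Q 0 = (Q (frac s) - Q 0) + of_int \<lfloor>s\<rfloor>"
    using degree_one_map_frac(1)[OF Q, of s] by simp
  also have "\<dots> \<in> \<int>"
    by (intro Ints_add int Ints_of_int) (simp_all add: frac_lt_1)
  finally show "Q s - Q 0 \<in> \<int>" .
qed

text \<open>On [0, 1) both increments from 0 lie in [0, 1] and differ by an integer, so a
  discrepancy at \<open>r\<close> means that one is 0 and the other 1. Monotonicity then freezes the
  former on [0, r] and the latter on [r, 1), and congruence modulo integers transfers this to
  \<open>Q\<close>, which becomes constant modulo integers.\<close>

lemma degree_one_lift_unique:
  assumes P: "degree_one_map P" and Q: "degree_one_map Q"
    and int: "\<And>s. P s - Q s \<in> \<int>" and nconst: "\<not> constant_mod_int Q"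
  shows "P t - Q t = P 0 - Q 0"
proof (rule ccontr)
  assume neq: "P t - Q t \<noteq> P 0 - Q 0"
  define r where "r = frac t"
  have r: "0 \<le> r" "r < 1"
    by (simp_all add: r_def frac_lt_1)
  define p where "p = P r - P 0"
  define q where "q = Q r - Q 0"
  have pq: "0 \<le> p" "p \<le> 1" "0 \<le> q" "q \<le> 1"
    using degree_one_map_frac(2,3)[OF P, of t] degree_one_map_frac(2,3)[OF Q, of t]
    by (auto simp: p_def q_def r_def)
  have "p \<noteq> q"
    using neq degree_one_map_frac(1)[OF P, of t] degree_one_map_frac(1)[OF Q, of t]
    by (auto simp: p_def q_def r_def)
  have "p - q = (P r - Q r) - (P 0 - Q 0)"
    by (simp add: p_def q_def)
  then have "p - q \<in> \<int>"
    using int by (metis Ints_diff)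
  then obtain k :: int where k: "p - q = of_int k"
    by (rule Ints_cases)
  have "k = 1 \<or> k = -1"
  proof -
    have "real_of_int k < 2" "real_of_int k > -2" "k \<noteq> 0"
      using k pq \<open>p \<noteq> q\<close> by auto
    then show ?thesis
      by linarith
  qed
  then have cases: "p = 1 \<and> q = 0 \<or> p = 0 \<and> q = 1"
    using k pq by auto
  have mono: "mono P" "mono Q"
    using P Q by (auto simp: degree_one_map_def)
  have "constant_mod_int Q"
  proof (rule constant_mod_intI[OF Q])
    fix s :: real assume s: "0 \<le> s" "s < 1"
    have le1: "P s \<le> P 0 + 1" "Q s \<le> Q 0 + 1" and ge0: "P 0 \<le> P s" "Q 0 \<le> Q s"
      using degree_one_map_frac(2,3)[OF P, of s] degree_one_map_frac(2,3)[OF Q, of s] s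
      by (simp_all add: frac_eq[THEN iffD2])
    have eq: "Q s - Q 0 = (P s - P 0) - ((P s - Q s) - (P 0 - Q 0))"
      by simp
    have "P s - P 0 \<in> \<int> \<or> Q s - Q 0 \<in> \<int>"
    proof (cases "s \<le> r")
      case True
      then have "P s \<le> P r" "Q s \<le> Q r"
        using mono by (auto intro: monoD)
      then have "P s - P 0 = 0 \<or> Q s - Q 0 = 0"
        using cases ge0 by (auto simp: p_def q_def)
      then show ?thesis
        by (metis Ints_0)
    next
      case False
      then have "P r \<le> P s" "Q r \<le> Q s"
        using mono by (auto intro: monoD)
      then have "P s - P 0 = 1 \<or> Q s - Q 0 = 1"
        using cases le1 by (auto simp: p_def q_def)
      then show ?thesis
        by (metis Ints_1)
    qed
    then show "Q s - Q 0 \<in> \<int>"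
      using int eq by (metis Ints_diff)
  qed
  then show False
    using nconst by blast
qed

text \<open>After subtraction of \<open>c\<close>, a value strictly between consecutive integers
  stays there slightly to the right: right continuity bounds it above, monotonicity below. Without
  right continuity an intermediate value could hide at a single irrational point.\<close>

lemma right_regular_rational:
  assumes Q: "right_regular Q" and nint: "Q s - c \<notin> \<int>" and "s < t"
  shows "\<exists>q\<in>\<rat>. s < q \<and> q < t \<and> Q q - c \<notin> \<int>"
proof -
  define m where "m = \<lfloor>Q s - c\<rfloor>"
  have "Q s - c \<noteq> of_int m"
    using nint by (metis Ints_of_int)
  then have m: "c + of_int m < Q s" "Q s < c + of_int m + 1"
    unfolding m_def by linarith+
  obtain s' where s': "s < s'" "Q s' < c + of_int m + 1"
    using Q m(2) unfolding right_regular_def by blast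
  obtain q where q: "q \<in> \<rat>" "s < q" "q < min s' t"
    using Rats_dense_in_real[of s "min s' t"] s' \<open>s < t\<close> by auto
  have "mono Q"
    using Q by (simp add: right_regular_def degree_one_map_def)
  then have "Q s \<le> Q q" "Q q \<le> Q s'"
    using q by (auto intro: monoD)
  then have b: "of_int m < Q q - c" "Q q - c < of_int m + 1"
    using m s' by linarith+
  have "Q q - c \<notin> \<int>"
  proof
    assume "Q q - c \<in> \<int>"
    then obtain k :: int where "Q q - c = of_int k"
      by (rule Ints_cases)
    then have "m < k" "k < m + 1"
      using b by linarith+
    then show False
      by linarith
  qed
  then show ?thesis
    using q by auto
qed

text \<open>Makes constancy a countable, hence measurable, condition.\<close>

lemma right_regular_constant_mod_int:
  assumes Q: "right_regular Q"
  shows "constant_mod_int Q \<longleftrightarrow> (\<forall>q\<in>\<rat>. Q q - Q 0 \<in> \<int>)"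
  using right_regular_rational[OF Q, of _ "Q 0"] by (meson less_add_one)

text \<open>On [0, 1) the increment lies in [0, 1], so its fractional part leaves only 0 and 1 to be
  told apart. It is 1 when the map has left its initial value before \<open>t\<close> and come back;
  if the increment were 1 and no rational before \<open>t\<close> saw this, the lift would be
  constant modulo integers.\<close>

lemma right_regular_lift_formula:
  assumes Q: "right_regular Q" and nconst: "\<not> constant_mod_int Q" and t: "0 \<le> t" "t < 1"
  shows "Q t - Q 0 = (if frac (Q t - Q 0) = 0 \<and> (\<exists>q\<in>\<rat>. 0 < q \<and> q < t \<and> frac (Q q - Q 0) \<noteq> 0)
    then 1 else frac (Q t - Q 0))"
proof -
  have d: "degree_one_map Q" and mono: "mono Q"
    using Q by (auto simp: right_regular_def degree_one_map_def)
  have range: "0 \<le> Q s - Q 0" "Q s - Q 0 \<le> 1" if "0 \<le> s" "s < 1" for s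
    using degree_one_map_frac(2,3)[OF d, of s] that by (simp_all add: frac_eq[THEN iffD2])
  show ?thesis
  proof (cases "Q t - Q 0 = 1")
    case True
    have "\<exists>q\<in>\<rat>. 0 < q \<and> q < t \<and> frac (Q q - Q 0) \<noteq> 0"
    proof (rule ccontr)
      assume none: "\<not> (\<exists>q\<in>\<rat>. 0 < q \<and> q < t \<and> frac (Q q - Q 0) \<noteq> 0)"
      have "constant_mod_int Q"
      proof (rule constant_mod_intI[OF d])
        fix s :: real assume s: "0 \<le> s" "s < 1"
        show "Q s - Q 0 \<in> \<int>"
        proof (cases "s < t")
          case True
          show ?thesis
          proof (rule ccontr)
            assume "Q s - Q 0 \<notin> \<int>"
            from right_regular_rational[OF Q this True] show False
              using none s by auto
          qed
        next
          case False
          then have "Q t \<le> Q s"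
            using mono by (auto intro: monoD)
          then have "Q s - Q 0 = 1"
            using True range(2)[OF s] by simp
          then show ?thesis
            by simp
        qed
      qed
      then show False
        using nconst by blast
    qed
    then show ?thesis
      using True by simp
  next
    case False
    then have fr: "frac (Q t - Q 0) = Q t - Q 0"
      using range[OF t] by (simp add: frac_eq)
    have "\<not> (frac (Q t - Q 0) = 0 \<and> (\<exists>q\<in>\<rat>. 0 < q \<and> q < t \<and> frac (Q q - Q 0) \<noteq> 0))"
    proof
      assume "frac (Q t - Q 0) = 0 \<and> (\<exists>q\<in>\<rat>. 0 < q \<and> q < t \<and> frac (Q q - Q 0) \<noteq> 0)"
      then obtain q where q: "0 < q" "q < t" "frac (Q q - Q 0) \<noteq> 0" and 0: "Q t = Q 0"
        using fr by auto
      have "Q 0 \<le> Q q" "Q q \<le> Q t"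
        using q mono by (auto intro: monoD)
      then show False
        using 0 q(3) by simp
    qed
    then show ?thesis
      using fr by simp
  qed
qed

text \<open>Supplies the invariance of the set of \<omega> with constant semiconjugacy. One
  direction transfers constancy along the surjective \<open>K\<close>, the other cancels the
  injective \<open>F\<close>.\<close>

lemma constant_mod_int_intertwine:
  assumes F: "F \<in> homeo_Z_real" and K: "K \<in> homeo_Z_real"
    and int: "\<And>t. F (Q' t) - Q (K t) \<in> \<int>"
  shows "constant_mod_int Q' \<longleftrightarrow> constant_mod_int Q"
proof
  assume c: "constant_mod_int Q'"
  have KK: "Q (K t) - Q (K 0) \<in> \<int>" for t
  proof -
    obtain m where "Q' t - Q' 0 = of_int m"
      using c by (meson Ints_cases)
    then have "Q' t = Q' 0 + of_int m"
      by simp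
    then have "Q (K t) - Q (K 0) = (F (Q' 0) - Q (K 0)) - (F (Q' t) - Q (K t)) + of_int m"
      by (simp add: homeo_Z_real_add_of_int[OF F])
    then show ?thesis
      using int by (metis Ints_add Ints_diff Ints_of_int)
  qed
  have KQ: "Q s - Q (K 0) \<in> \<int>" for s
    using KK[of "inv_fun K s"] by (simp add: homeo_Z_real_inv_right[OF K])
  show "constant_mod_int Q"
  proof
    fix s
    have "Q s - Q 0 = (Q s - Q (K 0)) - (Q 0 - Q (K 0))"
      by simp
    then show "Q s - Q 0 \<in> \<int>"
      using KQ by (metis Ints_diff)
  qed
next
  assume c: "constant_mod_int Q"
  show "constant_mod_int Q'"
  proof
    fix t
    have "F (Q' t) - F (Q' 0) =
        (F (Q' t) - Q (K t)) - (F (Q' 0) - Q (K 0)) + ((Q (K t) - Q 0) - (Q (K 0) - Q 0))"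
      by simp
    also have "\<dots> \<in> \<int>"
      using c by (intro Ints_add[OF Ints_diff[OF int int] Ints_diff]) blast+
    finally obtain m where "F (Q' t) - F (Q' 0) = of_int m"
      by (rule Ints_cases)
    then have "F (Q' t) = F (Q' 0 + of_int m)"
      by (simp add: homeo_Z_real_add_of_int[OF F])
    then show "Q' t - Q' 0 \<in> \<int>"
      by (simp add: homeo_Z_real_eq_iff[OF F])
  qed
qed

section \<open>Semicohomologous cocycles without equivariant points\<close>

context standard_borel_prob_gspace
begin

text \<open>Ergodicity is formulated for strictly invariant sets, whereas \<open>N\<close> is
  invariant only up to null sets. The intersection of all translates is strictly invariant, and by
  countability it differs from \<open>N\<close> by a null set.\<close>

lemma ergodic_AE_cases:
  assumes erg: "ergodic_action \<Gamma> M act" and count: "countable (carrier \<Gamma>)" and N: "N \<in> sets M"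
    and inv: "\<And>\<gamma>. \<gamma> \<in> carrier \<Gamma> \<Longrightarrow> AE \<omega> in M. act (inv \<gamma>) \<omega> \<in> N \<longleftrightarrow> \<omega> \<in> N"
  shows "(AE \<omega> in M. \<omega> \<in> N) \<or> (AE \<omega> in M. \<omega> \<notin> N)"
proof -
  have ne: "carrier \<Gamma> \<noteq> {}"
    using monoid.one_closed[OF group.is_monoid[OF group_\<Gamma>]] by blast
  define N' where "N' = (\<Inter>\<gamma>\<in>carrier \<Gamma>. act (inv \<gamma>) -` N \<inter> space M)"
  have N': "N' \<in> sets M"
    unfolding N'_def
    by (rule sets.countable_INT'[OF count ne]) (auto intro!: measurable_sets[OF act_measurable N])
  have mem: "\<omega> \<in> N' \<longleftrightarrow> \<omega> \<in> space M \<and> (\<forall>\<gamma>\<in>carrier \<Gamma>. act (inv \<gamma>) \<omega> \<in> N)" for \<omega>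
    using ne by (auto simp: N'_def)
  have "act \<gamma> -` N' \<inter> space M = N'" if \<gamma>: "\<gamma> \<in> carrier \<Gamma>" for \<gamma>
  proof -
    have "act \<gamma> \<omega> \<in> N' \<longleftrightarrow> \<omega> \<in> N'" if \<omega>: "\<omega> \<in> space M" for \<omega>
    proof
      assume a: "act \<gamma> \<omega> \<in> N'"
      have "act (inv \<kappa>) \<omega> \<in> N" if \<kappa>: "\<kappa> \<in> carrier \<Gamma>" for \<kappa>
      proof -
        have "act (inv (\<gamma> \<otimes> \<kappa>)) (act \<gamma> \<omega>) \<in> N"
          using a \<gamma> \<kappa> by (simp add: mem)
        then show ?thesis
          using \<gamma> \<kappa> \<omega> by (simp add: act_inv_mult act_space)
      qed
      then show "\<omega> \<in> N'"
        using \<omega> by (simp add: mem)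
    next
      assume a: "\<omega> \<in> N'"
      have "act (inv \<eta>) (act \<gamma> \<omega>) \<in> N" if \<eta>: "\<eta> \<in> carrier \<Gamma>" for \<eta>
      proof -
        have "act (inv (inv \<gamma> \<otimes> \<eta>)) \<omega> \<in> N"
          using a \<gamma> \<eta> by (simp add: mem)
        then show ?thesis
          using \<gamma> \<eta> \<omega> by (simp add: act_inv_mult)
      qed
      then show "act \<gamma> \<omega> \<in> N'"
        using \<omega> \<gamma> by (simp add: mem act_space)
    qed
    moreover have "N' \<subseteq> space M"
      by (auto simp: mem)
    ultimately show ?thesis
      by blast
  qed
  then have "prob N' = 0 \<or> prob N' = 1"
    by (intro erg[unfolded ergodic_action_def, THEN bspec, OF N', THEN mp] ballI)
  then have "(AE \<omega> in M. \<omega> \<notin> N') \<or> (AE \<omega> in M. \<omega> \<in> N')"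
    using prob_eq_0[OF N'] prob_eq_1[OF N'] by blast
  moreover have eq: "AE \<omega> in M. \<omega> \<in> N' \<longleftrightarrow> \<omega> \<in> N"
  proof -
    have "AE \<omega> in M. \<forall>\<gamma>\<in>carrier \<Gamma>. act (inv \<gamma>) \<omega> \<in> N \<longleftrightarrow> \<omega> \<in> N"
      using inv by (simp add: AE_ball_countable[OF count])
    then show ?thesis
      using AE_space by eventually_elim (use ne in \<open>auto simp: mem\<close>)
  qed
  ultimately show ?thesis
  proof (elim disjE)
    assume "AE \<omega> in M. \<omega> \<notin> N'"
    then have "AE \<omega> in M. \<omega> \<notin> N"
      using eq by eventually_elim simp
    then show ?thesis ..
  next
    assume "AE \<omega> in M. \<omega> \<in> N'"
    then have "AE \<omega> in M. \<omega> \<in> N"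
      using eq by eventually_elim simp
    then show ?thesis ..
  qed
qed

lemma euler_eq_if_left_semicohomologous:
  assumes \<sigma>\<^sub>1: "measurable_cocycle \<Gamma> M act \<sigma>\<^sub>1" and \<sigma>\<^sub>2: "measurable_cocycle \<Gamma> M act \<sigma>\<^sub>2"
    and count: "countable (carrier \<Gamma>)" and erg: "ergodic_action \<Gamma> M act"
    and no_point: "\<not> (\<exists>r. equivariant_family \<Gamma> M act \<sigma>\<^sub>1 r)"
    and sc: "left_semicohomologous \<Gamma> M act \<sigma>\<^sub>1 \<sigma>\<^sub>2"
  shows "H2b_pullback \<Gamma> M act \<sigma>\<^sub>1 bounded_euler_class = H2b_pullback \<Gamma> M act \<sigma>\<^sub>2 bounded_euler_class"
proof -
  obtain \<phi> where \<phi>_meas: "\<phi> \<in> measurable (borel \<Otimes>\<^sub>M M) borel"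
    and \<phi>_nd: "AE \<omega> in M. nondecreasing_degree_one (\<lambda>x. \<phi> (x, \<omega>))"
    and \<phi>_eq: "\<And>\<gamma>. \<gamma> \<in> carrier \<Gamma> \<Longrightarrow> AE \<omega> in M.
      \<forall>x. tau \<sigma>\<^sub>1 \<gamma> \<omega> (\<phi> (x, act (inv \<gamma>) \<omega>)) = \<phi> (tau \<sigma>\<^sub>2 \<gamma> \<omega> x, \<omega>)"
    using sc semicohomology_tau_iff[OF \<sigma>\<^sub>1 \<sigma>\<^sub>2] unfolding left_semicohomologous_def by blast
  \<comment> \<open>Almost everywhere this is the fractional part of the right limit, obtained from
    circle values of \<phi>. As a limit of Borel functions it is Borel in both variables.\<close>
  define \<psi> where "\<psi> p = lim (\<lambda>n. circle_coord (\<phi> (to_circle (fst p + 1 / real (Suc n)), snd p)))" for p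
  have \<psi>_meas: "\<psi> \<in> borel_measurable (borel \<Otimes>\<^sub>M M)"
  proof -
    have "(\<lambda>p. circle_coord (\<phi> (to_circle (fst p + c), snd p))) \<in> borel_measurable (borel \<Otimes>\<^sub>M M)" for c
    proof -
      have "(\<lambda>p. (to_circle (fst p + c), snd p)) \<in> measurable (borel \<Otimes>\<^sub>M M) (borel \<Otimes>\<^sub>M M)"
        by (intro measurable_Pair) measurable
      from measurable_compose[OF this \<phi>_meas] show ?thesis
        by (rule measurable_compose[OF _ measurable_circle_coord])
    qed
    then show ?thesis
      unfolding \<psi>_def[abs_def] by (intro borel_measurable_lim_metric)
  qed
  have \<psi>_comp: "(\<lambda>\<omega>. \<psi> (g \<omega>, \<omega>)) \<in> borel_measurable M" if "g \<in> borel_measurable M" for g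
    by (rule measurable_compose[OF measurable_Pair[OF that measurable_ident_sets[OF refl]] \<psi>_meas])
  \<comment> \<open>This choice need not depend measurably on \<omega>. It enters only statements
    about almost every \<omega>; the measurable objects are built from \<psi>.\<close>
  define P where "P \<omega> = (SOME P. degree_one_map P \<and> is_lift P (\<lambda>x. \<phi> (x, \<omega>)))" for \<omega>
  have P: "AE \<omega> in M. degree_one_map (P \<omega>) \<and> is_lift (P \<omega>) (\<lambda>x. \<phi> (x, \<omega>))"
    using \<phi>_nd
  proof eventually_elim
    case (elim \<omega>)
    then have "\<exists>P. degree_one_map P \<and> is_lift P (\<lambda>x. \<phi> (x, \<omega>))"
      by (auto simp: nondecreasing_degree_one_iff_lift degree_one_map_def)
    from someI_ex[OF this] show ?case
      by (simp add: P_def)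
  qed
  \<comment> \<open>The shift puts \<open>Q \<omega> 0\<close> into [0, 1), where it coincides with
    the Borel function \<psi> at 0 and gives a measurable base value.\<close>
  define Q where "Q \<omega> t = right_limit (P \<omega>) t - of_int \<lfloor>right_limit (P \<omega>) 0\<rfloor>" for \<omega> t
  have Q: "AE \<omega> in M. right_regular (Q \<omega>) \<and> (\<forall>t. \<psi> (t, \<omega>) = frac (Q \<omega> t)) \<and> \<psi> (0, \<omega>) = Q \<omega> 0"
    using P
  proof eventually_elim
    case (elim \<omega>)
    then have mono: "mono (P \<omega>)"
      by (simp add: degree_one_map_def)
    have reg: "right_regular (right_limit (P \<omega>))"
      using elim right_regular_right_limit by blast
    have "right_regular (Q \<omega>)"
    proof -
      have "\<exists>s>t. Q \<omega> s < a" if "Q \<omega> t < a" for t a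
      proof -
        have "right_limit (P \<omega>) t < a + of_int \<lfloor>right_limit (P \<omega>) 0\<rfloor>"
          using that by (simp add: Q_def)
        then obtain s where "s > t" "right_limit (P \<omega>) s < a + of_int \<lfloor>right_limit (P \<omega>) 0\<rfloor>"
          using reg unfolding right_regular_def by blast
        then show ?thesis
          by (intro exI[of _ s]) (simp add: Q_def)
      qed
      then show ?thesis
        using reg unfolding right_regular_def degree_one_map_def by (simp add: Q_def mono_def)
    qed
    moreover have "\<psi> (t, \<omega>) = frac (Q \<omega> t)" for t
    proof -
      have "circle_coord (\<phi> (to_circle s, \<omega>)) = frac (P \<omega> s)" for s
        using elim is_liftD[of "P \<omega>" "\<lambda>x. \<phi> (x, \<omega>)"] by simp
      then have "\<psi> (t, \<omega>) = frac (right_limit (P \<omega>) t)"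
        unfolding \<psi>_def using tendsto_frac_right_limit[OF mono, of t] by (simp add: limI)
      also have "\<dots> = frac (Q \<omega> t)"
        by (simp add: Q_def frac_eq_iff_diff_Ints)
      finally show ?thesis .
    qed
    moreover have "frac (Q \<omega> 0) = Q \<omega> 0"
      by (simp add: Q_def frac_def)
    ultimately show ?case
      by simp
  qed
  have intertwine: "AE \<omega> in M. \<forall>t.
      tau_lift \<sigma>\<^sub>1 \<gamma> \<omega> (Q (act (inv \<gamma>) \<omega>) t) - Q \<omega> (tau_lift \<sigma>\<^sub>2 \<gamma> \<omega> t) \<in> \<int>"
    if \<gamma>: "\<gamma> \<in> carrier \<Gamma>" for \<gamma>
    using P AE_act_inv[OF \<gamma> P] \<phi>_eq[OF \<gamma>] AE_space
  proof eventually_elim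
    case (elim \<omega>)
    let ?\<omega> = "act (inv \<gamma>) \<omega>"
    let ?F = "tau_lift \<sigma>\<^sub>1 \<gamma> \<omega>" and ?K = "tau_lift \<sigma>\<^sub>2 \<gamma> \<omega>"
    note F = tau_lift_homeo_Z_real[OF \<sigma>\<^sub>1 \<gamma> elim(4)]
    note K = tau_lift_homeo_Z_real[OF \<sigma>\<^sub>2 \<gamma> elim(4)]
    have lift: "\<phi> (to_circle s, \<omega>) = to_circle (P \<omega> s)" "\<phi> (to_circle s, ?\<omega>) = to_circle (P ?\<omega> s)" for s
      using elim(1,2) is_liftD by fast+
    have "?F (P ?\<omega> s) - P \<omega> (?K s) \<in> \<int>" for s
    proof -
      have "to_circle (?F (P ?\<omega> s)) = tau \<sigma>\<^sub>1 \<gamma> \<omega> (\<phi> (to_circle s, ?\<omega>))"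
        by (simp add: lift to_circle_tau_lift[OF \<sigma>\<^sub>1 \<gamma> elim(4)])
      also have "\<dots> = \<phi> (to_circle (?K s), \<omega>)"
        using elim(3) by (simp add: to_circle_tau_lift[OF \<sigma>\<^sub>2 \<gamma> elim(4)])
      also have "\<dots> = to_circle (P \<omega> (?K s))"
        by (rule lift)
      finally show ?thesis
        by (simp add: to_circle_eq_iff)
    qed
    then have int: "?F (right_limit (P ?\<omega>) t) - right_limit (P \<omega>) (?K t) \<in> \<int>" for t
      using elim(1,2) by (intro right_limit_intertwine[OF F K]) (auto simp: degree_one_map_def)
    show ?case
    proof
      fix t
      define m where "m = \<lfloor>right_limit (P ?\<omega>) 0\<rfloor>"
      define n where "n = \<lfloor>right_limit (P \<omega>) 0\<rfloor>"
      have "?F (Q ?\<omega> t) = ?F (right_limit (P ?\<omega>) t) - of_int m"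
        using homeo_Z_real_add_of_int[OF F, of "right_limit (P ?\<omega>) t" "- m"] by (simp add: Q_def m_def)
      then have "?F (Q ?\<omega> t) - Q \<omega> (?K t) =
          (?F (right_limit (P ?\<omega>) t) - right_limit (P \<omega>) (?K t)) + of_int (n - m)"
        by (simp add: Q_def n_def)
      then show "?F (Q ?\<omega> t) - Q \<omega> (?K t) \<in> \<int>"
        using int by (metis Ints_add Ints_of_int)
    qed
  qed
  define N where "N = {\<omega> \<in> space M. \<forall>q\<in>\<rat>. \<psi> (q, \<omega>) = \<psi> (0, \<omega>)}"
  have \<psi>_const: "(\<lambda>\<omega>. \<psi> (c, \<omega>)) \<in> borel_measurable M" for c
    by (rule \<psi>_comp) simp
  have N: "N \<in> sets M"
  proof -
    note [measurable] = \<psi>_const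
    have "N = (\<Inter>q\<in>\<rat>. {\<omega> \<in> space M. \<psi> (q, \<omega>) = \<psi> (0, \<omega>)})"
      using Rats_0 by (auto simp: N_def)
    also have "\<dots> \<in> sets M"
      by (rule sets.countable_INT'[OF countable_rat]) (use Rats_0 in auto)
    finally show ?thesis .
  qed
  have N_iff: "AE \<omega> in M. \<omega> \<in> N \<longleftrightarrow> constant_mod_int (Q \<omega>)"
    using Q AE_space
  proof eventually_elim
    case (elim \<omega>)
    then have "right_regular (Q \<omega>)" "\<And>t. \<psi> (t, \<omega>) = frac (Q \<omega> t)"
      by auto
    then show ?case
      using elim(2) unfolding right_regular_constant_mod_int[OF \<open>right_regular (Q \<omega>)\<close>]
      by (simp only: N_def mem_Collect_eq frac_eq_iff_diff_Ints simp_thms)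
  qed
  have "AE \<omega> in M. act (inv \<gamma>) \<omega> \<in> N \<longleftrightarrow> \<omega> \<in> N" if \<gamma>: "\<gamma> \<in> carrier \<Gamma>" for \<gamma>
    using N_iff AE_act_inv[OF \<gamma> N_iff] intertwine[OF \<gamma>] AE_space
  proof eventually_elim
    case (elim \<omega>)
    show ?case
      unfolding elim(1,2)
      by (rule constant_mod_int_intertwine[OF tau_lift_homeo_Z_real[OF \<sigma>\<^sub>1 \<gamma> elim(4)]
            tau_lift_homeo_Z_real[OF \<sigma>\<^sub>2 \<gamma> elim(4)]]) (use elim(3) in blast)
  qed
  from ergodic_AE_cases[OF erg count N this]
  have nconst: "AE \<omega> in M. \<not> constant_mod_int (Q \<omega>)"
  proof
    assume "AE \<omega> in M. \<omega> \<notin> N"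
    then show ?thesis
      using N_iff by eventually_elim simp
  next
    assume "AE \<omega> in M. \<omega> \<in> N"
    then have const: "AE \<omega> in M. constant_mod_int (Q \<omega>)"
      using N_iff by eventually_elim simp
    define r where "r \<omega> = to_circle (\<psi> (0, \<omega>))" for \<omega>
    have "r \<in> borel_measurable M"
      unfolding r_def[abs_def] by (rule measurable_compose[OF \<psi>_const measurable_to_circle])
    moreover have "AE \<omega> in M. r \<omega> = tau \<sigma>\<^sub>1 \<gamma> \<omega> (r (act (inv \<gamma>) \<omega>))" if \<gamma>: "\<gamma> \<in> carrier \<Gamma>" for \<gamma>
      using Q AE_act_inv[OF \<gamma> Q] const intertwine[OF \<gamma>] AE_space
    proof eventually_elim
      case (elim \<omega>)
      let ?\<omega> = "act (inv \<gamma>) \<omega>"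
      have "tau \<sigma>\<^sub>1 \<gamma> \<omega> (r ?\<omega>) = to_circle (tau_lift \<sigma>\<^sub>1 \<gamma> \<omega> (Q ?\<omega> 0))"
        using elim(2) by (simp add: r_def to_circle_tau_lift[OF \<sigma>\<^sub>1 \<gamma> elim(5)])
      also have "\<dots> = to_circle (Q \<omega> (tau_lift \<sigma>\<^sub>2 \<gamma> \<omega> 0))"
        unfolding to_circle_eq_iff using elim(4) by blast
      also have "\<dots> = to_circle (Q \<omega> 0)"
        unfolding to_circle_eq_iff using elim(3) by blast
      also have "\<dots> = r \<omega>"
        using elim(1) by (simp add: r_def)
      finally show ?case
        by simp
    qed
    ultimately have "equivariant_family \<Gamma> M act \<sigma>\<^sub>1 r"
      unfolding equivariant_family_iff[OF \<sigma>\<^sub>1] by blast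
    then show ?thesis
      using no_point by blast
  qed
  \<comment> \<open>\<open>right_regular_lift_formula\<close> written in terms of \<psi>, so that it
    is Borel. It recovers \<open>Q \<omega>\<close> on [0, 1), which covers the point
    \<open>tau_lift \<sigma>\<^sub>2 \<gamma> \<omega> 0\<close> at which it is evaluated.\<close>
  define L where "L t \<omega> = \<psi> (0, \<omega>) +
    (if \<psi> (t, \<omega>) = \<psi> (0, \<omega>) \<and> (\<exists>q\<in>\<rat>. 0 < q \<and> q < t \<and> \<psi> (q, \<omega>) \<noteq> \<psi> (0, \<omega>)) then 1
     else frac (\<psi> (t, \<omega>) - \<psi> (0, \<omega>)))" for t \<omega>
  have L_meas: "(\<lambda>\<omega>. L (g \<omega>) \<omega>) \<in> borel_measurable M" if [measurable]: "g \<in> borel_measurable M" for g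
  proof -
    note [measurable] = \<psi>_const \<psi>_comp[OF that]
    have "{\<omega> \<in> space M. \<exists>q\<in>\<rat>. 0 < q \<and> q < g \<omega> \<and> \<psi> (q, \<omega>) \<noteq> \<psi> (0, \<omega>)} =
      (\<Union>q\<in>\<rat>. {\<omega> \<in> space M. 0 < q \<and> q < g \<omega> \<and> \<psi> (q, \<omega>) \<noteq> \<psi> (0, \<omega>)})"
      by blast
    also have "\<dots> \<in> sets M"
      by (rule sets.countable_UN'[OF countable_rat]) auto
    finally have [measurable]:
      "Measurable.pred M (\<lambda>\<omega>. \<exists>q\<in>\<rat>. 0 < q \<and> q < g \<omega> \<and> \<psi> (q, \<omega>) \<noteq> \<psi> (0, \<omega>))"
      by (simp add: pred_def)
    show ?thesis
      unfolding L_def frac_def by measurable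
  qed
  have L: "AE \<omega> in M. \<forall>t. 0 \<le> t \<longrightarrow> t < 1 \<longrightarrow> L t \<omega> = Q \<omega> t"
    using Q nconst
  proof eventually_elim
    case (elim \<omega>)
    have \<psi>: "\<psi> (t, \<omega>) = frac (Q \<omega> t)" for t
      using elim(1) by blast
    have "frac (Q \<omega> t - Q \<omega> 0) = 0 \<longleftrightarrow> \<psi> (t, \<omega>) = \<psi> (0, \<omega>)" for t
      unfolding \<psi> frac_eq_iff_diff_Ints by simp
    moreover have diff: "frac (Q \<omega> t - Q \<omega> 0) = frac (\<psi> (t, \<omega>) - \<psi> (0, \<omega>))" for t
    proof -
      have "(Q \<omega> t - Q \<omega> 0) - (frac (Q \<omega> t) - frac (Q \<omega> 0)) = of_int (\<lfloor>Q \<omega> t\<rfloor> - \<lfloor>Q \<omega> 0\<rfloor>)"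
        by (simp add: frac_def)
      then show ?thesis
        unfolding \<psi> frac_eq_iff_diff_Ints by (metis Ints_of_int)
    qed
    ultimately have zero: "frac (\<psi> (t, \<omega>) - \<psi> (0, \<omega>)) = 0 \<longleftrightarrow> \<psi> (t, \<omega>) = \<psi> (0, \<omega>)" for t
      by simp
    show ?case
    proof (intro allI impI)
      fix t :: real assume "0 \<le> t" "t < 1"
      then have "Q \<omega> t - Q \<omega> 0 = (if \<psi> (t, \<omega>) = \<psi> (0, \<omega>) \<and>
          (\<exists>q\<in>\<rat>. 0 < q \<and> q < t \<and> \<psi> (q, \<omega>) \<noteq> \<psi> (0, \<omega>)) then 1 else frac (\<psi> (t, \<omega>) - \<psi> (0, \<omega>)))"
        using right_regular_lift_formula[of "Q \<omega>" t] elim unfolding diff zero by blast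
      then show "L t \<omega> = Q \<omega> t"
        using elim(1) unfolding L_def by linarith
    qed
  qed
  \<comment> \<open>The defect of equivariance at the single point 0, written with Borel functions.
    Almost everywhere the argument of the floor is already an integer, and uniqueness of lifts
    carries it to all points.\<close>
  define u where "u \<gamma> \<omega> = \<lfloor>tau_lift \<sigma>\<^sub>1 \<gamma> \<omega> (\<psi> (0, act (inv \<gamma>) \<omega>)) - L (tau_lift \<sigma>\<^sub>2 \<gamma> \<omega> 0) \<omega>\<rfloor>" for \<gamma> \<omega>
  have u_eq: "AE \<omega> in M. \<forall>t.
      tau_lift \<sigma>\<^sub>1 \<gamma> \<omega> (Q (act (inv \<gamma>) \<omega>) t) = Q \<omega> (tau_lift \<sigma>\<^sub>2 \<gamma> \<omega> t) + of_int (u \<gamma> \<omega>)"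
    and u_bdd: "AE \<omega> in M. \<bar>u \<gamma> \<omega>\<bar> \<le> 2"
    if \<gamma>: "\<gamma> \<in> carrier \<Gamma>" for \<gamma>
  proof -
    have "AE \<omega> in M. (\<forall>t. tau_lift \<sigma>\<^sub>1 \<gamma> \<omega> (Q (act (inv \<gamma>) \<omega>) t) =
        Q \<omega> (tau_lift \<sigma>\<^sub>2 \<gamma> \<omega> t) + of_int (u \<gamma> \<omega>)) \<and> \<bar>u \<gamma> \<omega>\<bar> \<le> 2"
      using Q AE_act_inv[OF \<gamma> Q] nconst L intertwine[OF \<gamma>] AE_space
    proof eventually_elim
      case (elim \<omega>)
      let ?\<omega> = "act (inv \<gamma>) \<omega>"
      let ?F = "tau_lift \<sigma>\<^sub>1 \<gamma> \<omega>" and ?K = "tau_lift \<sigma>\<^sub>2 \<gamma> \<omega>"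
      note F = tau_lift_homeo_Z_real[OF \<sigma>\<^sub>1 \<gamma> elim(6)]
      note K = tau_lift_homeo_Z_real[OF \<sigma>\<^sub>2 \<gamma> elim(6)]
      have d: "degree_one_map (Q \<omega>)" "degree_one_map (Q ?\<omega>)"
        using elim(1,2) by (auto simp: right_regular_def)
      have dF: "degree_one_map (\<lambda>t. ?F (Q ?\<omega> t))"
        using d(2) by (auto simp: degree_one_map_def mono_def homeo_Z_real_le_iff[OF F] homeo_Z_real_add_1[OF F])
      have dK: "degree_one_map (\<lambda>t. Q \<omega> (?K t))"
        using d(1) by (auto simp: degree_one_map_def mono_def homeo_Z_real_le_iff[OF K] homeo_Z_real_add_1[OF K])
      have int: "?F (Q ?\<omega> t) - Q \<omega> (?K t) \<in> \<int>" for t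
        using elim(5) by blast
      \<comment> \<open>The intertwining lemma with the identity, written as a translation by 0, in
        the place of \<open>F\<close>: precomposition with a homeomorphism does not create
        constancy.\<close>
      have "\<not> constant_mod_int (\<lambda>t. Q \<omega> (?K t))"
        using elim(3) constant_mod_int_intertwine[OF homeo_Z_real_add_const[OF translation_homeo_Z_real[of 0], of 0] K,
            of "\<lambda>t. Q \<omega> (?K t)" "Q \<omega>"] by (simp add: translation_def)
      then have diff: "?F (Q ?\<omega> t) - Q \<omega> (?K t) = ?F (Q ?\<omega> 0) - Q \<omega> (?K 0)" for t
        by (rule degree_one_lift_unique[OF dF dK int])
      have K0: "0 \<le> ?K 0" "?K 0 < 1"
        by (rule tau_lift_0[OF \<sigma>\<^sub>2 \<gamma> elim(6)])+
      have L0: "L (?K 0) \<omega> = Q \<omega> (?K 0)"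
        using elim(4) K0 by blast
      obtain k where k: "?F (Q ?\<omega> 0) - Q \<omega> (?K 0) = of_int k"
        using int by (meson Ints_cases)
      have "\<psi> (0, ?\<omega>) = Q ?\<omega> 0"
        using elim(2) by blast
      then have uk: "u \<gamma> \<omega> = k"
        unfolding u_def L0 by (simp only: k floor_of_int)
      have fr: "frac (?K 0) = ?K 0"
        using K0 by (simp add: frac_eq)
      have Q0: "0 \<le> Q \<omega> 0" "Q \<omega> 0 < 1" "frac (Q ?\<omega> 0) = Q ?\<omega> 0"
        using elim(1,2) by (metis frac_ge_0 frac_lt_1)+
      \<comment> \<open>Lifts that start in [0, 1) keep [0, 1) inside [0, 2). Both terms of the
        defect obey this for every \<gamma>, which makes \<open>u\<close> a bounded cochain.\<close>
      have "0 \<le> ?F (Q ?\<omega> 0)" "?F (Q ?\<omega> 0) < 2"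
        using homeo_Z_real_frac_bounds[OF F, of "Q ?\<omega> 0"] tau_lift_0[OF \<sigma>\<^sub>1 \<gamma> elim(6)] Q0(3) by simp_all
      moreover have "0 \<le> Q \<omega> (?K 0)" "Q \<omega> (?K 0) < 2"
        using degree_one_map_frac(2,3)[OF d(1), of "?K 0"] fr Q0 by simp_all
      ultimately have "\<bar>u \<gamma> \<omega>\<bar> \<le> 2"
        using k uk by linarith
      moreover have "?F (Q ?\<omega> t) = Q \<omega> (?K t) + of_int (u \<gamma> \<omega>)" for t
        using diff[of t] k uk by simp
      ultimately show ?case
        by blast
    qed
    then show "AE \<omega> in M. \<forall>t.
        tau_lift \<sigma>\<^sub>1 \<gamma> \<omega> (Q (act (inv \<gamma>) \<omega>) t) = Q \<omega> (tau_lift \<sigma>\<^sub>2 \<gamma> \<omega> t) + of_int (u \<gamma> \<omega>)"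
      "AE \<omega> in M. \<bar>u \<gamma> \<omega>\<bar> \<le> 2"
      by (auto elim: eventually_mono)
  qed
  have "u \<gamma> \<in> measurable M (count_space UNIV)" if \<gamma>: "\<gamma> \<in> carrier \<Gamma>" for \<gamma>
  proof -
    have "(\<lambda>\<omega>. \<psi> (0, act (inv \<gamma>) \<omega>)) \<in> borel_measurable M"
      by (rule measurable_compose[OF act_measurable \<psi>_const]) (use \<gamma> in simp)
    note [measurable] = measurable_tau_lift[OF \<sigma>\<^sub>1 \<gamma> this]
      L_meas[OF measurable_tau_lift[OF \<sigma>\<^sub>2 \<gamma> borel_measurable_const[of 0]]]
    show ?thesis
      unfolding u_def[abs_def] by measurable
  qed
  then have "uniformly_bounded u"
    unfolding uniformly_bounded_def using u_bdd by blast
  moreover have "AE \<omega> in M.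
      pull \<sigma>\<^sub>1 euler_cocycle \<gamma> \<eta> \<omega> = delta1 u \<gamma> \<eta> \<omega> + pull \<sigma>\<^sub>2 euler_cocycle \<gamma> \<eta> \<omega>"
    if g: "\<gamma> \<in> carrier \<Gamma>" "\<eta> \<in> carrier \<Gamma>" for \<gamma> \<eta>
    using AE_tau_lift_mult[OF \<sigma>\<^sub>1 g] AE_tau_lift_mult[OF \<sigma>\<^sub>2 g] u_eq[OF g(1)]
      AE_act_inv[OF g(1) u_eq[OF g(2)]] u_eq[OF mult_carrier[OF g]] Q AE_space
  proof eventually_elim
    case (elim \<omega>)
    let ?\<omega> = "act (inv \<gamma>) \<omega>" and ?\<omega>' = "act (inv \<eta>) (act (inv \<gamma>) \<omega>)"
    define K where "K = tau_lift \<sigma>\<^sub>2 \<eta> ?\<omega> 0"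
    have QQ: "Q \<omega> (t + of_int m) = Q \<omega> t + of_int m" for t m
      using elim(6) by (intro degree_one_add_of_int) (simp add: right_regular_def degree_one_map_def)
    \<comment> \<open>This value is computed twice. Passing both lifts through \<open>Q\<close>
      collects \<open>u \<gamma>\<close>, the translated \<open>u \<eta>\<close> and the Euler
      cocycle of \<open>\<sigma>\<^sub>2\<close>; composing the lifts first collects
      \<open>u (\<gamma> \<otimes> \<eta>)\<close> and the Euler cocycle of
      \<open>\<sigma>\<^sub>1\<close>.\<close>
    have "tau_lift \<sigma>\<^sub>1 \<gamma> \<omega> (tau_lift \<sigma>\<^sub>1 \<eta> ?\<omega> (Q ?\<omega>' 0)) =
        tau_lift \<sigma>\<^sub>1 \<gamma> \<omega> (Q ?\<omega> K + of_int (u \<eta> ?\<omega>))"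
      using elim(4) by (simp add: K_def)
    also have "\<dots> = Q \<omega> (tau_lift \<sigma>\<^sub>2 \<gamma> \<omega> K) + of_int (u \<gamma> \<omega>) + of_int (u \<eta> ?\<omega>)"
      using elim(3) by (simp add: homeo_Z_real_add_of_int[OF tau_lift_homeo_Z_real[OF \<sigma>\<^sub>1 g(1) elim(7)]])
    also have "tau_lift \<sigma>\<^sub>2 \<gamma> \<omega> K =
        tau_lift \<sigma>\<^sub>2 (\<gamma> \<otimes> \<eta>) \<omega> 0 + of_int (pull \<sigma>\<^sub>2 euler_cocycle \<gamma> \<eta> \<omega>)"
      using elim(2) unfolding K_def by blast
    finally have a: "tau_lift \<sigma>\<^sub>1 \<gamma> \<omega> (tau_lift \<sigma>\<^sub>1 \<eta> ?\<omega> (Q ?\<omega>' 0)) =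
        Q \<omega> (tau_lift \<sigma>\<^sub>2 (\<gamma> \<otimes> \<eta>) \<omega> 0) + of_int (pull \<sigma>\<^sub>2 euler_cocycle \<gamma> \<eta> \<omega>) +
          of_int (u \<gamma> \<omega>) + of_int (u \<eta> ?\<omega>)"
      by (simp add: QQ)
    have "act (inv (\<gamma> \<otimes> \<eta>)) \<omega> = ?\<omega>'"
      by (rule act_inv_mult[OF g elim(7)])
    then have "tau_lift \<sigma>\<^sub>1 (\<gamma> \<otimes> \<eta>) \<omega> (Q ?\<omega>' 0) =
        Q \<omega> (tau_lift \<sigma>\<^sub>2 (\<gamma> \<otimes> \<eta>) \<omega> 0) + of_int (u (\<gamma> \<otimes> \<eta>) \<omega>)"
      using elim(5)[rule_format, of 0] by simp
    then have "real_of_int (pull \<sigma>\<^sub>1 euler_cocycle \<gamma> \<eta> \<omega>) =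
        of_int (delta1 u \<gamma> \<eta> \<omega> + pull \<sigma>\<^sub>2 euler_cocycle \<gamma> \<eta> \<omega>)"
      using a elim(1)[rule_format, of "Q ?\<omega>' 0"] by (simp add: delta1_def)
    then show ?case
      by (simp only: of_int_eq_iff)
  qed
  ultimately show ?thesis
    unfolding H2b_pullback_eq_iff[OF \<sigma>\<^sub>1 \<sigma>\<^sub>2] by blast
qed

lemma euler_trivial_if_equivariant_family:
  assumes \<sigma>: "measurable_cocycle \<Gamma> M act \<sigma>" and r: "equivariant_family \<Gamma> M act \<sigma> r"
  shows "H2b_pullback \<Gamma> M act \<sigma> bounded_euler_class = \<one>\<^bsub>Linf_H2b \<Gamma> M act\<^esub>"
  unfolding H2b_pullback_eq_one_iff[OF \<sigma>]
  using r trivial_euler_if_equivariant_point[OF \<sigma>, of r] unfolding equivariant_family_iff[OF \<sigma>] by blast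

end

theorem theorem1:
  fixes \<Gamma> :: "('g, 'm) monoid_scheme"
    and M :: "'w measure"
    and act :: "'g \<Rightarrow> 'w \<Rightarrow> 'w"
    and \<sigma>\<^sub>1 \<sigma>\<^sub>2 :: "'g \<Rightarrow> 'w \<Rightarrow> circle \<Rightarrow> circle"
  assumes "group \<Gamma>" and "finitely_generated \<Gamma>"
    and "standard_borel_prob_gspace \<Gamma> M act"
    and "measurable_cocycle \<Gamma> M act \<sigma>\<^sub>1" and "measurable_cocycle \<Gamma> M act \<sigma>\<^sub>2"
  shows
    "(semicohomologous \<Gamma> M act \<sigma>\<^sub>1 \<sigma>\<^sub>2 \<and> (\<exists>r. equivariant_family \<Gamma> M act \<sigma>\<^sub>1 r) \<longrightarrow>
        (\<exists>r. equivariant_family \<Gamma> M act \<sigma>\<^sub>2 r) \<and>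
        H2b_pullback \<Gamma> M act \<sigma>\<^sub>1 bounded_euler_class =
          H2b_pullback \<Gamma> M act \<sigma>\<^sub>2 bounded_euler_class \<and>
        H2b_pullback \<Gamma> M act \<sigma>\<^sub>2 bounded_euler_class = \<one>\<^bsub>Linf_H2b \<Gamma> M act\<^esub>) \<and>
     (H2b_pullback \<Gamma> M act \<sigma>\<^sub>1 bounded_euler_class =
        H2b_pullback \<Gamma> M act \<sigma>\<^sub>2 bounded_euler_class \<longrightarrow>
        semicohomologous \<Gamma> M act \<sigma>\<^sub>1 \<sigma>\<^sub>2) \<and>
     (ergodic_action \<Gamma> M act \<and> \<not> (\<exists>r. equivariant_family \<Gamma> M act \<sigma>\<^sub>1 r) \<and>
        left_semicohomologous \<Gamma> M act \<sigma>\<^sub>1 \<sigma>\<^sub>2 \<longrightarrow>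
        H2b_pullback \<Gamma> M act \<sigma>\<^sub>1 bounded_euler_class =
          H2b_pullback \<Gamma> M act \<sigma>\<^sub>2 bounded_euler_class \<and>
        H2b_pullback \<Gamma> M act \<sigma>\<^sub>2 bounded_euler_class \<noteq> \<one>\<^bsub>Linf_H2b \<Gamma> M act\<^esub>)"
proof -
  interpret standard_borel_prob_gspace \<Gamma> M act
    by fact
  have count: "countable (carrier \<Gamma>)"
    by (rule countable_carrier_if_finitely_generated) fact
  note \<sigma> = \<open>measurable_cocycle \<Gamma> M act \<sigma>\<^sub>1\<close> \<open>measurable_cocycle \<Gamma> M act \<sigma>\<^sub>2\<close>
  show ?thesis
  proof (intro conjI impI; (elim conjE)?)
    assume sc: "semicohomologous \<Gamma> M act \<sigma>\<^sub>1 \<sigma>\<^sub>2" and r: "\<exists>r. equivariant_family \<Gamma> M act \<sigma>\<^sub>1 r"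
    have "left_semicohomologous \<Gamma> M act \<sigma>\<^sub>2 \<sigma>\<^sub>1"
      using sc by (simp add: semicohomologous_def right_semicohomologous_def)
    then show r2: "\<exists>r. equivariant_family \<Gamma> M act \<sigma>\<^sub>2 r"
      using r equivariant_family_semicohomologous by blast
    show "H2b_pullback \<Gamma> M act \<sigma>\<^sub>2 bounded_euler_class = \<one>\<^bsub>Linf_H2b \<Gamma> M act\<^esub>"
      using r2 euler_trivial_if_equivariant_family[OF \<sigma>(2)] by blast
    then show "H2b_pullback \<Gamma> M act \<sigma>\<^sub>1 bounded_euler_class = H2b_pullback \<Gamma> M act \<sigma>\<^sub>2 bounded_euler_class"
      using r euler_trivial_if_equivariant_family[OF \<sigma>(1)] by auto
  next
    assume eq: "H2b_pullback \<Gamma> M act \<sigma>\<^sub>1 bounded_euler_class = H2b_pullback \<Gamma> M act \<sigma>\<^sub>2 bounded_euler_class"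
    show "semicohomologous \<Gamma> M act \<sigma>\<^sub>1 \<sigma>\<^sub>2"
      unfolding semicohomologous_def right_semicohomologous_def
      using left_semicohomologous_if_euler_eq[OF \<sigma> count eq]
        left_semicohomologous_if_euler_eq[OF \<sigma>(2,1) count eq[symmetric]] by blast
  next
    assume erg: "ergodic_action \<Gamma> M act" and no: "\<not> (\<exists>r. equivariant_family \<Gamma> M act \<sigma>\<^sub>1 r)"
      and sc: "left_semicohomologous \<Gamma> M act \<sigma>\<^sub>1 \<sigma>\<^sub>2"
    show eq: "H2b_pullback \<Gamma> M act \<sigma>\<^sub>1 bounded_euler_class = H2b_pullback \<Gamma> M act \<sigma>\<^sub>2 bounded_euler_class"
      by (rule euler_eq_if_left_semicohomologous[OF \<sigma> count erg no sc])
    \<comment> \<open>The two classes agree, so a trivial one would produce an equivariant family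
      for \<open>\<sigma>\<^sub>1\<close>.\<close>
    show "H2b_pullback \<Gamma> M act \<sigma>\<^sub>2 bounded_euler_class \<noteq> \<one>\<^bsub>Linf_H2b \<Gamma> M act\<^esub>"
      using no equivariant_family_if_euler_trivial[OF \<sigma>(1) count] unfolding eq by blast
  qed
qed

end
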